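(* Let $n\ge1$, $d>0$, $d_0>0$, let $0<\theta_1<\theta_2<\cdots<\theta_n\le 2\pi$ and $\lambda_j=e^{i\theta_j}$. Let $(q_1,\dots,q_n)$, $q_j> 0$, $\sum_{j=1}^n q_j=1$, be random with the Dirichlet distribution with measure $$\frac{\Gamma((n-1)d+d_0)}{(\Gamma(d))^{n-1}\Gamma(d_0)}\Big(\prod_{j=1}^{n-1}q_j^{d-1}\Big)q_n^{d_0-1}\,dq_1\cdots dq_{n-1},$$ and let $t=e^{i\phi}$, $0<\phi<2\pi$, be independent of the $q_j$ with the distribution $$\frac{\Gamma^2(\tfrac12(d_0+(n-1)d+1))}{2\pi\,\Gamma((n-1)d+d_0)}\,|1-t|^{d_0+(n-1)d-1}\,d\phi .$$ Consider the random rational function $$C_n(\lambda)=1+(t-1)\sum_{j=1}^n\frac{\lambda_j q_j}{\lambda_j-\lambda},$$ whose zeros are $\tilde\lambda_j=e^{i\psi_j}$ ($j=1,\dots,n$), labelled so that $\theta_{i-1}<\psi_i<\theta_i$ for $i=1,\dots,n$, with $\theta_0:=\theta_n-2\pi$. Then the conditional probability density function of $(\psi_1,\dots,\psi_n)$, given $(\theta_1,\dots,\theta_n)$, on the region $\{\theta_{i-1}<\psi_i<\theta_i,\ i=1,\dots,n\}$, is equal to $$A\,\frac{\prod_{l=1}^n|e^{i\theta_n}-e^{i\psi_l}|^{d_0-1}}{\prod_{l=1}^{n-1}|e^{i\theta_n}-e^{i\theta_l}|^{d_0+d-1}}\;\frac{\prod_{j=1}^{n-1}\prod_{l=1}^n|e^{i\theta_j}-e^{i\psi_l}|^{d-1}}{\prod_{1\le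 j<k\le n-1}|e^{i\theta_k}-e^{i\theta_j}|^{2d-1}}\prod_{1\le j<k\le n}|e^{i\psi_k}-e^{i\psi_j}|,$$ where $$A=\frac{\Gamma((n-1)d+d_0)}{(\Gamma(d))^{n-1}\Gamma(d_0)}\;\frac{\Gamma^2(\tfrac12(d_0+(n-1)d+1))}{2\pi\,\Gamma((n-1)d+d_0)}.$$
   Context: The rational function $C_n$ arises as follows: if $U$ is an $n\times n$ unitary matrix with distinct eigenvalues $\lambda_j$ whose $j$th normalized eigenvector has first component of squared modulus $q_j$, then the eigenvalues of the matrix obtained from $U$ by multiplying its first row by $t$ are the zeros of $C_n$. *)

theory Defs
  imports "HOL-Probability.Probability"
begin

text \<open>
  Families indexed by $1, \ldots, n$ are functions on \<^typ>\<open>nat\<close>, of which only the values on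
  \<open>{1..n}\<close> matter.  For the angles \<open>\<theta>\<close> the value at \<open>0\<close> is used as well: it
  stands for $\theta_0 = \theta_n - 2\pi$.
\<close>

definition C_fun :: "nat \<Rightarrow> (nat \<Rightarrow> real) \<Rightarrow> (nat \<Rightarrow> real) \<Rightarrow> complex \<Rightarrow> complex \<Rightarrow> complex" where
  "C_fun n \<theta> q t z =
     1 + (t - 1) * (\<Sum>j=1..n. cis (\<theta> j) * of_real (q j) / (cis (\<theta> j) - z))"

text \<open>
  The points $e^{i\theta_j}$ are poles of the rational function.  They are excluded explicitly
  because the convention $x / 0 = 0$ gives \<^const>\<open>C_fun\<close> an arbitrary value there.
\<close>

definition C_zeros :: "nat \<Rightarrow> (nat \<Rightarrow> real) \<Rightarrow> (nat \<Rightarrow> real) \<Rightarrow> complex \<Rightarrow> complex set" where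
  "C_zeros n \<theta> q t =
     {z. z \<notin> (\<lambda>j. cis (\<theta> j)) ` {1..n} \<and> C_fun n \<theta> q t z = 0}"

definition interlacing :: "nat \<Rightarrow> (nat \<Rightarrow> real) \<Rightarrow> (nat \<Rightarrow> real) \<Rightarrow> bool" where
  "interlacing n \<theta> \<psi> \<longleftrightarrow> (\<forall>i\<in>{1..n}. \<theta> (i - 1) < \<psi> i \<and> \<psi> i < \<theta> i)"

definition zero_angles ::
    "nat \<Rightarrow> (nat \<Rightarrow> real) \<Rightarrow> (nat \<Rightarrow> real) \<Rightarrow> complex \<Rightarrow> (nat \<Rightarrow> real) \<Rightarrow> bool" where
  "zero_angles n \<theta> q t \<psi> \<longleftrightarrow>
     interlacing n \<theta> \<psi> \<and> C_zeros n \<theta> q t = (\<lambda>j. cis (\<psi> j)) ` {1..n}"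

text \<open>
  Density with respect to $dq_1 \cdots dq_{n-1}$; here $q_n = 1 - q_1 - \cdots - q_{n-1}$.
  For \<open>n = 1\<close> the reference measure is the unit mass on a one-point space and the
  density is constantly \<open>1\<close>.
\<close>

definition dirichlet_density :: "nat \<Rightarrow> real \<Rightarrow> real \<Rightarrow> (nat \<Rightarrow> real) \<Rightarrow> real" where
  "dirichlet_density n d d0 q =
     (if (\<forall>j\<in>{1..n-1}. 0 < q j) \<and> (\<Sum>j=1..n-1. q j) < 1
      then Gamma ((real n - 1) * d + d0) / (Gamma d ^ (n - 1) * Gamma d0)
             * (\<Prod>j=1..n-1. q j powr (d - 1)) * (1 - (\<Sum>j=1..n-1. q j)) powr (d0 - 1)
      else 0)"

definition phase_density :: "nat \<Rightarrow> real \<Rightarrow> real \<Rightarrow> real \<Rightarrow> real" where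
  "phase_density n d d0 x =
     (if 0 < x \<and> x < 2 * pi
      then (Gamma ((d0 + (real n - 1) * d + 1) / 2))\<^sup>2 / (2 * pi * Gamma ((real n - 1) * d + d0))
             * norm (1 - cis x) powr (d0 + (real n - 1) * d - 1)
      else 0)"

definition norm_const :: "nat \<Rightarrow> real \<Rightarrow> real \<Rightarrow> real" where
  "norm_const n d d0 =
     Gamma ((real n - 1) * d + d0) / (Gamma d ^ (n - 1) * Gamma d0)
       * ((Gamma ((d0 + (real n - 1) * d + 1) / 2))\<^sup>2 / (2 * pi * Gamma ((real n - 1) * d + d0)))"

definition zero_density ::
    "nat \<Rightarrow> real \<Rightarrow> real \<Rightarrow> (nat \<Rightarrow> real) \<Rightarrow> (nat \<Rightarrow> real) \<Rightarrow> real" where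
  "zero_density n d d0 \<theta> \<psi> =
     (if interlacing n \<theta> \<psi>
      then norm_const n d d0
        * ((\<Prod>l=1..n. norm (cis (\<theta> n) - cis (\<psi> l)) powr (d0 - 1))
           / (\<Prod>l=1..n-1. norm (cis (\<theta> n) - cis (\<theta> l)) powr (d0 + d - 1)))
        * ((\<Prod>j=1..n-1. \<Prod>l=1..n. norm (cis (\<theta> j) - cis (\<psi> l)) powr (d - 1))
           / (\<Prod>k=1..n-1. \<Prod>j=1..<k. norm (cis (\<theta> k) - cis (\<theta> j)) powr (2 * d - 1)))
        * (\<Prod>k=1..n. \<Prod>j=1..<k. norm (cis (\<psi> k) - cis (\<psi> j)))
      else 0)"

end

theory Submission
  imports Defs
begin

text \<open>
  On the unit circle, $e^{i\psi}$ is a zero of $C_n$ exactly when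
  $\sum_j q_j \cot((\psi - \theta_j)/2) = \cot(\phi/2)$.  The left-hand side decreases from $+\infty$
  to $-\infty$ between consecutive $\theta_j$, which gives existence, uniqueness and interlacing of
  the zeros.

  The coordinate $x = \cot((\theta_n - \psi)/2)$ sends the pole $e^{i\theta_n}$ to infinity.  With
  $b_j = \cot((\theta_n - \theta_j)/2)$, the equation becomes
  $x - e - \sum_{j<n} w_j / (x - b_j) = 0$, where $w_j = q_j (1 + b_j^2) / q_n$ and
  $e = (\sum_{j<n} q_j b_j - \cot(\phi/2)) / q_n$.  The Jacobian of
  $(x_1, \ldots, x_n) \mapsto (w_1, \ldots, w_{n-1}, e)$ is a quotient of Vandermonde determinants.
  Since the dimension is a variable, the change of variables is done one coordinate at a time:
  splitting off the smallest root and pole rescales the remaining coefficients, and afterwards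
  the smallest root is traded for its coefficient by a one-dimensional substitution.
\<close>

subsection \<open>Change of variables on finite products\<close>

text \<open>The substitution runs from the angles \<psi> to the parameters, because in that
  direction every map is an explicit formula. The zeros as functions of the parameters are only
  given implicitly, and for them measurability suffices.

  The induction closes because of one coincidence. Split off the smallest root s and hold the
  rescaled remaining coefficients fixed. The factor by which s enters the Vandermonde product is
  then, up to factors from the poles, the derivative in s of the coefficient that replaces s. So no
  determinant is ever expanded.

  In the end everything is a product of chord lengths. Each q_j carries the factor 1/|1 - t| and the
  Jacobian carries |1 - t| to the power -(n-1). The exponent d0 + (n-1) d - 1 in the law of t is the
  one for which all these powers cancel, so the density involves only chords, and its constant is
  the product of the normalising constants of the two laws.

  The pole exp(i \<theta>_n) is the one sent to infinity because its weight q_n is eliminated by the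
  sum condition and has its own exponent d0.\<close>

lemma absolutely_integrable_eq_nn_integral:
  fixes F :: "real \<Rightarrow> real"
  assumes S[measurable]: "S \<in> sets borel" and F[measurable]: "F \<in> borel_measurable borel"
    and nn: "\<And>x. 0 \<le> F x" and b: "0 \<le> b"
  shows "F absolutely_integrable_on S \<and> integral S F = b \<longleftrightarrow>
    (\<integral>\<^sup>+x. ennreal (F x) * indicator S x \<partial>lborel) = ennreal b"
proof -
  have eq: "(\<integral>\<^sup>+x. ennreal (F x) * indicator S x \<partial>lborel) = (\<integral>\<^sup>+x. ennreal (indicator S x * F x) \<partial>lborel)"
    by (intro nn_integral_cong) (auto simp: indicator_def)
  \<comment> \<open>\<open>absolutely_integrable_on\<close> refers to the completed Lebesgue
    measure; for Borel data the completion changes neither integrability nor the integral.\<close>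
  have int: "F absolutely_integrable_on S \<longleftrightarrow> integrable lborel (\<lambda>x. indicator S x * F x)"
    by (simp add: set_integrable_def integrable_completion)
  have I: "integral S F = (\<integral>x. indicator S x * F x \<partial>lborel)" if "F absolutely_integrable_on S"
    using set_lebesgue_integral_eq_integral(2)[OF that]
    by (simp add: set_lebesgue_integral_def integral_completion)
  have nn': "\<And>x. 0 \<le> indicator S x * F x" using nn by simp
  show ?thesis
  proof
    assume a: "F absolutely_integrable_on S \<and> integral S F = b"
    then have "(\<integral>\<^sup>+x. ennreal (indicator S x * F x) \<partial>lborel) = ennreal (\<integral>x. indicator S x * F x \<partial>lborel)"
      using int nn' by (intro nn_integral_eq_integral) auto
    then show "(\<integral>\<^sup>+x. ennreal (F x) * indicator S x \<partial>lborel) = ennreal b"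
      using a I eq by simp
  next
    assume a: "(\<integral>\<^sup>+x. ennreal (F x) * indicator S x \<partial>lborel) = ennreal b"
    then have i: "integrable lborel (\<lambda>x. indicator S x * F x)"
      using eq nn' by (intro integrableI_nonneg) (auto simp: less_top[symmetric])
    have "(\<integral>x. indicator S x * F x \<partial>lborel) = b"
      using a eq nn' b by (subst integral_eq_nn_integral) auto
    then show "F absolutely_integrable_on S \<and> integral S F = b" using i int I by simp
  qed
qed

text \<open>Proved as an identity of measures: the image under \<open>g\<close> of the density |g'|
  on \<open>S\<close> is Lebesgue measure on the image of \<open>S\<close>. Only indicators of Borel
  sets have to be checked, and all nonnegative \<open>f\<close> follow.\<close>

lemma nn_integral_substitution_inj:
  fixes g g' :: "real \<Rightarrow> real"
  assumes S[measurable]: "S \<in> sets borel" and T[measurable]: "g ` S \<in> sets borel"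
    and g[measurable]: "g \<in> borel_measurable borel" and g'[measurable]: "g' \<in> borel_measurable borel"
    and der: "\<And>x. x \<in> S \<Longrightarrow> (g has_field_derivative g' x) (at x)"
    and inj: "inj_on g S"
    and f[measurable]: "f \<in> borel_measurable borel"
  shows "(\<integral>\<^sup>+x. f (g x) * (ennreal \<bar>g' x\<bar> * indicator S x) \<partial>lborel)
    = (\<integral>\<^sup>+y. f y * indicator (g ` S) y \<partial>lborel)"
proof -
  let ?M = "distr (density lborel (\<lambda>x. ennreal \<bar>g' x\<bar> * indicator S x)) borel g"
  let ?N = "density lborel (indicator (g ` S))"
  have "?M = ?N"
  proof (rule measure_eqI)
    fix A assume "A \<in> sets ?M"
    then have A[measurable]: "A \<in> sets borel" by simp
    have iff: "(\<integral>\<^sup>+x. ennreal (\<bar>g' x\<bar> * indicator A (g x)) * indicator S x \<partial>lborel) = ennreal b \<longleftrightarrow>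
       (\<integral>\<^sup>+y. ennreal (indicator A y) * indicator (g ` S) y \<partial>lborel) = ennreal b" if "0 \<le> b" for b
      using has_absolute_integral_change_of_variables_1'[of S g g' "indicator A" b] inj that
      by (subst (1 2) absolutely_integrable_eq_nn_integral[symmetric])
         (auto intro: has_field_derivative_at_within der)
    have eq: "(\<integral>\<^sup>+x. ennreal (\<bar>g' x\<bar> * indicator A (g x)) * indicator S x \<partial>lborel) =
       (\<integral>\<^sup>+y. ennreal (indicator A y) * indicator (g ` S) y \<partial>lborel)" (is "?a = ?b")
    \<comment> \<open>\<open>iff\<close> transfers finite values only. An infinite left side is
      handled by contraposition: a finite right side would make it finite.\<close>
    proof (cases ?a rule: ennreal_cases)
      case (real r)
      then show ?thesis using iff[of r] by simp
    next
      case top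
      then show ?thesis using iff by (cases ?b rule: ennreal_cases) (metis, metis)
    qed
    have "emeasure ?M A = ?a"
      by (subst emeasure_distr, simp, simp, subst emeasure_density)
         (auto intro!: nn_integral_cong measurable_sets_borel[OF g A] simp: indicator_def)
    also have "\<dots> = ?b" by (rule eq)
    also have "\<dots> = emeasure ?N A"
      by (subst emeasure_density) (auto intro!: nn_integral_cong simp: indicator_def)
    finally show "emeasure ?M A = emeasure ?N A" .
  qed simp
  then have "integral\<^sup>N ?M f = integral\<^sup>N ?N f" by simp
  then show ?thesis
    by (simp add: nn_integral_distr nn_integral_density mult_ac)
qed

abbreviation lborel_Pi :: "nat set \<Rightarrow> (nat \<Rightarrow> real) measure" where
  "lborel_Pi I \<equiv> Pi\<^sub>M I (\<lambda>_. lborel)"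

interpretation lborel_prod: product_sigma_finite "\<lambda>_::nat. lborel :: real measure"
  by standard

lemma sigma_finite_lborel_Pi: "finite I \<Longrightarrow> sigma_finite_measure (lborel_Pi I)"
  by (rule lborel_prod.sigma_finite)

lemma measurable_fun_upd_lborel_Pi[measurable]:
  "(\<lambda>(x, y). x(i := y)) \<in> measurable (lborel_Pi I \<Otimes>\<^sub>M lborel) (lborel_Pi (insert i I))"
  by simp

lemma measurable_component_compose:
  "h \<in> measurable lborel N \<Longrightarrow> i \<in> I \<Longrightarrow> (\<lambda>x. h (x i)) \<in> measurable (lborel_Pi I) N"
  by (rule measurable_compose[of "\<lambda>x. x i" _ lborel]) simp_all

lemma measurable_prod_component:
  fixes h :: "nat \<Rightarrow> real \<Rightarrow> ennreal"
  assumes "\<And>i. i \<in> I \<Longrightarrow> h i \<in> borel_measurable lborel"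
  shows "(\<lambda>x. \<Prod>i\<in>I. h i (x i)) \<in> borel_measurable (lborel_Pi I)"
  by (intro borel_measurable_prod_ennreal measurable_component_compose assms)

lemma measurable_fun_upd_section:
  assumes "f \<in> measurable (lborel_Pi (insert k I)) N" "x \<in> space (lborel_Pi I)" "k \<notin> I"
  shows "(\<lambda>y. f (x(k := y))) \<in> measurable lborel N"
  by (rule measurable_compose[OF measurable_component_update[OF assms(2,3)] assms(1)])

lemma nn_integral_PiM_substitution:
  fixes g g' :: "nat \<Rightarrow> real \<Rightarrow> real" and S :: "nat \<Rightarrow> real set"
  assumes "finite I"
    and S: "\<And>i. i \<in> I \<Longrightarrow> S i \<in> sets borel" and T: "\<And>i. i \<in> I \<Longrightarrow> g i ` S i \<in> sets borel"
    and g: "\<And>i. i \<in> I \<Longrightarrow> g i \<in> borel_measurable borel"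
    and g': "\<And>i. i \<in> I \<Longrightarrow> g' i \<in> borel_measurable borel"
    and der: "\<And>i x. i \<in> I \<Longrightarrow> x \<in> S i \<Longrightarrow> (g i has_field_derivative g' i x) (at x)"
    and inj: "\<And>i. i \<in> I \<Longrightarrow> inj_on (g i) (S i)"
    and f: "f \<in> borel_measurable (lborel_Pi I)"
  shows "(\<integral>\<^sup>+x. f (\<lambda>i\<in>I. g i (x i)) * (\<Prod>i\<in>I. ennreal \<bar>g' i (x i)\<bar> * indicator (S i) (x i)) \<partial>lborel_Pi I)
    = (\<integral>\<^sup>+y. f y * (\<Prod>i\<in>I. indicator (g i ` S i) (y i)) \<partial>lborel_Pi I)"
  using assms
proof (induction I arbitrary: f)
  case empty
  then show ?case by (simp add: PiM_empty nn_integral_count_space_finite)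
next
  case (insert k I)
  note [measurable] = insert.prems(1-4)[of k, simplified]
  have [measurable]: "f \<in> borel_measurable (lborel_Pi (insert k I))" using insert.prems by simp
  have [measurable]: "\<And>i. i \<in> I \<Longrightarrow> S i \<in> sets borel" "\<And>i. i \<in> I \<Longrightarrow> g i ` S i \<in> sets borel"
    "\<And>i. i \<in> I \<Longrightarrow> g i \<in> borel_measurable borel" "\<And>i. i \<in> I \<Longrightarrow> g' i \<in> borel_measurable borel"
    using insert.prems by auto
  have [measurable]: "(\<lambda>x. \<lambda>i\<in>insert k I. g i (x i)) \<in> measurable (lborel_Pi (insert k I)) (lborel_Pi (insert k I))"
    by (intro measurable_restrict) (auto intro!: measurable_compose[OF measurable_component_singleton])
  have [measurable]: "(\<lambda>x. \<lambda>i\<in>I. g i (x i)) \<in> measurable (lborel_Pi I) (lborel_Pi I)"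
    by (intro measurable_restrict) (auto intro!: measurable_compose[OF measurable_component_singleton])
  have h: "(\<lambda>x. ennreal \<bar>g' i x\<bar> * indicator (S i) x) \<in> borel_measurable lborel"
    "(\<lambda>x. indicator (g i ` S i) x :: ennreal) \<in> borel_measurable lborel" if "i \<in> insert k I" for i
    using that by auto
  have [measurable]:
    "(\<lambda>x. \<Prod>i\<in>I. ennreal \<bar>g' i (x i)\<bar> * indicator (S i) (x i)) \<in> borel_measurable (lborel_Pi I)"
    "(\<lambda>x. \<Prod>i\<in>insert k I. ennreal \<bar>g' i (x i)\<bar> * indicator (S i) (x i)) \<in> borel_measurable (lborel_Pi (insert k I))"
    "(\<lambda>y. \<Prod>i\<in>insert k I. indicator (g i ` S i) (y i) :: ennreal) \<in> borel_measurable (lborel_Pi (insert k I))"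
    by (rule measurable_prod_component, rule h, simp)+
  have upd: "(\<lambda>i\<in>insert k I. g i ((x(k := y)) i)) = (\<lambda>i\<in>I. g i (x i))(k := g k y)" for x y
    using insert.hyps by (auto simp: fun_eq_iff restrict_def)
  have pr: "(\<Prod>i\<in>insert k I. h i ((x(k := y)) i)) = h k y * (\<Prod>i\<in>I. h i (x i))"
    for x y and h :: "nat \<Rightarrow> real \<Rightarrow> ennreal"
    using insert.hyps by (subst prod.insert) (auto intro!: prod.cong arg_cong2[where f="(*)"])
  have sp: "(\<lambda>i\<in>I. g i (x i)) \<in> space (lborel_Pi I)" for x
    by (simp add: space_PiM)
  note sect = measurable_fun_upd_section[OF _ _ insert.hyps(2)]
  let ?P = "\<lambda>x. \<Prod>i\<in>I. ennreal \<bar>g' i (x i)\<bar> * indicator (S i) (x i)"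
  have "(\<integral>\<^sup>+x. f (\<lambda>i\<in>insert k I. g i (x i)) * (\<Prod>i\<in>insert k I. ennreal \<bar>g' i (x i)\<bar> * indicator (S i) (x i)) \<partial>lborel_Pi (insert k I))
    = (\<integral>\<^sup>+x. (\<integral>\<^sup>+y. f ((\<lambda>i\<in>I. g i (x i))(k := g k y)) * ((ennreal \<bar>g' k y\<bar> * indicator (S k) y) * ?P x) \<partial>lborel) \<partial>lborel_Pi I)"
    by (subst lborel_prod.product_nn_integral_insert[OF insert.hyps])
       (measurable, simp only: upd pr[where h="\<lambda>i x. ennreal \<bar>g' i x\<bar> * indicator (S i) x"])
  \<comment> \<open>Inner integral: the one-dimensional substitution in coordinate \<open>k\<close>,
    with the other coordinates already mapped.\<close>
  also have "\<dots> = (\<integral>\<^sup>+x. (\<integral>\<^sup>+y. f ((\<lambda>i\<in>I. g i (x i))(k := y)) * indicator (g k ` S k) y \<partial>lborel) * ?P x \<partial>lborel_Pi I)"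
  proof (intro nn_integral_cong)
    fix x
    have [measurable]: "(\<lambda>y. f ((\<lambda>i\<in>I. g i (x i))(k := y))) \<in> borel_measurable borel"
      using sect[of f, OF _ sp] by simp
    have "(\<integral>\<^sup>+y. f ((\<lambda>i\<in>I. g i (x i))(k := g k y)) * ((ennreal \<bar>g' k y\<bar> * indicator (S k) y) * ?P x) \<partial>lborel)
      = (\<integral>\<^sup>+y. f ((\<lambda>i\<in>I. g i (x i))(k := g k y)) * (ennreal \<bar>g' k y\<bar> * indicator (S k) y) \<partial>lborel) * ?P x"
      by (subst nn_integral_multc[symmetric])
         (auto intro!: measurable_compose[where f="g k"] nn_integral_cong simp: mult_ac)
    also have "(\<integral>\<^sup>+y. f ((\<lambda>i\<in>I. g i (x i))(k := g k y)) * (ennreal \<bar>g' k y\<bar> * indicator (S k) y) \<partial>lborel)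
      = (\<integral>\<^sup>+y. f ((\<lambda>i\<in>I. g i (x i))(k := y)) * indicator (g k ` S k) y \<partial>lborel)"
      using insert.prems by (intro nn_integral_substitution_inj) auto
    finally show "(\<integral>\<^sup>+y. f ((\<lambda>i\<in>I. g i (x i))(k := g k y)) * ((ennreal \<bar>g' k y\<bar> * indicator (S k) y) * ?P x) \<partial>lborel)
      = (\<integral>\<^sup>+y. f ((\<lambda>i\<in>I. g i (x i))(k := y)) * indicator (g k ` S k) y \<partial>lborel) * ?P x" .
  qed
  also have "\<dots> = (\<integral>\<^sup>+x. (\<integral>\<^sup>+y. f (x(k := y)) * indicator (g k ` S k) y \<partial>lborel)
         * (\<Prod>i\<in>I. indicator (g i ` S i) (x i)) \<partial>lborel_Pi I)"
  \<comment> \<open>The induction hypothesis is applied to the integrand with coordinate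
    \<open>k\<close> integrated out.\<close>
  proof (rule insert.IH)
    show "(\<lambda>x. \<integral>\<^sup>+y. f (x(k := y)) * indicator (g k ` S k) y \<partial>lborel) \<in> borel_measurable (lborel_Pi I)"
      by measurable
  qed (use insert.prems in auto)
  also have "\<dots> = (\<integral>\<^sup>+x. (\<integral>\<^sup>+y. f (x(k := y)) * (indicator (g k ` S k) y * (\<Prod>i\<in>I. indicator (g i ` S i) (x i))) \<partial>lborel) \<partial>lborel_Pi I)"
  proof (intro nn_integral_cong)
    fix x assume x: "x \<in> space (lborel_Pi I)"
    have [measurable]: "(\<lambda>y. f (x(k := y))) \<in> borel_measurable borel"
      using sect[of f, OF _ x] by simp
    show "(\<integral>\<^sup>+y. f (x(k := y)) * indicator (g k ` S k) y \<partial>lborel) * (\<Prod>i\<in>I. indicator (g i ` S i) (x i))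
      = (\<integral>\<^sup>+y. f (x(k := y)) * (indicator (g k ` S k) y * (\<Prod>i\<in>I. indicator (g i ` S i) (x i))) \<partial>lborel)"
      by (subst nn_integral_multc[symmetric]) (auto intro!: nn_integral_cong simp: mult_ac)
  qed
  also have "\<dots> = (\<integral>\<^sup>+y. f y * (\<Prod>i\<in>insert k I. indicator (g i ` S i) (y i)) \<partial>lborel_Pi (insert k I))"
    by (subst lborel_prod.product_nn_integral_insert[OF insert.hyps])
       (measurable, simp only: pr[where h="\<lambda>i x. indicator (g i ` S i) x"])
  finally show ?case .
qed

subsection \<open>Partial fractions with interlacing zeros and poles\<close>

text \<open>
  Indices \<open>k, \<dots>, n - 1\<close> carry the residues of \<open>pf_fun\<close>; index \<open>n\<close> carries its constant term.
\<close>

definition pf_coeff :: "(nat \<Rightarrow> 'a::field) \<Rightarrow> nat \<Rightarrow> nat \<Rightarrow> (nat \<Rightarrow> 'a) \<Rightarrow> nat \<Rightarrow> 'a" where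
  "pf_coeff b n k x = (\<lambda>j\<in>{k..n}. if j = n then (\<Sum>l=k..n. x l) - (\<Sum>i=k..<n. b i)
     else - (\<Prod>l=k..n. b j - x l) / (\<Prod>i\<in>{k..<n} - {j}. b j - b i))"

definition pf_fun :: "(nat \<Rightarrow> 'a::field) \<Rightarrow> nat \<Rightarrow> nat \<Rightarrow> (nat \<Rightarrow> 'a) \<Rightarrow> 'a \<Rightarrow> 'a" where
  "pf_fun b n k y z = z - y n - (\<Sum>j=k..<n. y j / (z - b j))"

text \<open>Adding a root x_k and a pole b_k multiplies the rational function by (z - x_k)/(z - b_k)
  = 1 + (b_k - x_k)/(z - b_k). Old residues are multiplied by the value of this factor at their
  pole, the constant term is shifted, and the residue at b_k comes from the value of the old
  function there.\<close>

lemma pf_coeff_rec: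
  fixes b :: "nat \<Rightarrow> 'a::field"
  assumes "k < n"
  shows "k < j \<Longrightarrow> j < n \<Longrightarrow> pf_coeff b n k x j = pf_coeff b n (Suc k) x j * ((b j - x k) / (b j - b k))"
    and "pf_coeff b n k x n = pf_coeff b n (Suc k) x n + (x k - b k)"
    and "pf_coeff b n k x k = (x k - b k) * ((\<Prod>l=Suc k..n. b k - x l) / (\<Prod>i=Suc k..<n. b k - b i))"
proof -
  have e: "{k..n} = insert k {Suc k..n}" "{k..<n} = insert k {Suc k..<n}" using assms by auto
  show "pf_coeff b n k x j = pf_coeff b n (Suc k) x j * ((b j - x k) / (b j - b k))" if j: "k < j" "j < n"
  proof -
    have "{k..<n} - {j} = insert k ({Suc k..<n} - {j})" using j assms by auto
    then show ?thesis using j unfolding pf_coeff_def by (simp add: e(1) mult_ac)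
  qed
  show "pf_coeff b n k x n = pf_coeff b n (Suc k) x n + (x k - b k)"
    using assms unfolding pf_coeff_def by (simp add: e)
  have "{k..<n} - {k} = {Suc k..<n}" by auto
  then show "pf_coeff b n k x k = (x k - b k) * ((\<Prod>l=Suc k..n. b k - x l) / (\<Prod>i=Suc k..<n. b k - b i))"
    using assms unfolding pf_coeff_def
    by (simp add: e(1), subst minus_diff_eq[symmetric, of "x k"]) (simp only: mult_minus_left minus_divide_left)
qed

text \<open>Kept over an arbitrary field: the real instance describes the roots, and the complex one
  is evaluated at the imaginary unit in \<open>T_eq\<close>.\<close>

lemma pf_fun_eq_prod:
  fixes b :: "nat \<Rightarrow> 'a::field"
  assumes "k \<le> n" "inj_on b {k..<n}" "z \<notin> b ` {k..<n}"
  shows "pf_fun b n k (pf_coeff b n k x) z = (\<Prod>l=k..n. z - x l) / (\<Prod>j=k..<n. z - b j)"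
  using assms
proof (induction k arbitrary: z rule: inc_induct)
  case base
  then show ?case by (simp add: pf_fun_def pf_coeff_def)
next
  case (step k)
  let ?y = "pf_coeff b n k x" and ?y' = "pf_coeff b n (Suc k) x"
  define G where "G = pf_fun b n (Suc k) ?y'"
  have kn: "k < n" by fact
  have inj: "inj_on b {Suc k..<n}" using step.prems by (auto simp: inj_on_def)
  have bk: "b k \<notin> b ` {Suc k..<n}"
  proof
    assume "b k \<in> b ` {Suc k..<n}"
    then obtain j where "j \<in> {Suc k..<n}" "b k = b j" by auto
    then show False using inj_onD[OF step.prems(1), of k j] kn by auto
  qed
  have zk: "z \<noteq> b k" and zj: "\<And>j. k < j \<Longrightarrow> j < n \<Longrightarrow> z \<noteq> b j" using step.prems kn by auto
  have bj: "\<And>j. k < j \<Longrightarrow> j < n \<Longrightarrow> b k \<noteq> b j" using bk by auto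
  have e: "{k..n} = insert k {Suc k..n}" "{k..<n} = insert k {Suc k..<n}" using kn by auto
  have Gb: "G (b k) = (\<Prod>l=Suc k..n. b k - x l) / (\<Prod>j=Suc k..<n. b k - b j)"
    unfolding G_def using step.IH inj bk by auto
  have Gz: "G z = (\<Prod>l=Suc k..n. z - x l) / (\<Prod>j=Suc k..<n. z - b j)"
    unfolding G_def using step.prems by (intro step.IH inj) auto
  have "pf_fun b n k ?y z = z - (?y' n + (x k - b k)) - (x k - b k) * G (b k) / (z - b k)
     - (\<Sum>j=Suc k..<n. ?y' j * ((b j - x k) / (b j - b k)) / (z - b j))"
    unfolding pf_fun_def e(2) using kn by (simp add: pf_coeff_rec Gb)
  also have "\<dots> = G z + (b k - x k) / (z - b k) * G z"
  proof -
    \<comment> \<open>Separates the poles b_j and b_k, so that after summation only the old pole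
      sums at z and at b_k occur.\<close>
    have t: "?y' j * ((b j - x k) / (b j - b k)) / (z - b j) = ?y' j / (z - b j)
       + (b k - x k) / (z - b k) * (?y' j / (z - b j) - ?y' j / (b k - b j))"
      if "j \<in> {Suc k..<n}" for j
    proof -
      have *: "z - b j \<noteq> 0" "z - b k \<noteq> 0" "b j - b k \<noteq> 0" "b k - b j \<noteq> 0"
        using that zk zj[of j] bj[of j] by auto
      have 1: "?y' j / (z - b j) - ?y' j / (b k - b j) = ?y' j * ((b k - z) / ((z - b j) * (b k - b j)))"
        using * by (simp add: field_simps)
      have 2: "(b j - x k) / (b j - b k) = 1 + (b k - x k) / (b j - b k)"
        using * by (simp add: field_simps)
      have 3: "(b k - x k) / (z - b k) * ((b k - z) / ((z - b j) * (b k - b j))) = ((b k - x k) / (b j - b k)) / (z - b j)"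
        using * by (simp add: divide_simps) (simp add: algebra_simps)
      show ?thesis unfolding 1 2
        by (subst mult.left_commute, subst 3) (simp add: algebra_simps add_divide_distrib)
    qed
    \<comment> \<open>Here e is the old constant term, X the new root, c the new pole, and A, B are
      the old pole sums at z and at c.\<close>
    have alg: "z - (e + (X - c)) - (X - c) * (c - e - B) / (z - c) - (A + (c - X) / (z - c) * (A - B))
       = z - e - A + (c - X) / (z - c) * (z - e - A)" if "z \<noteq> c" for e X c A B :: 'a
      using that by (simp add: divide_simps) (simp add: algebra_simps)
    have "(\<Sum>j=Suc k..<n. ?y' j * ((b j - x k) / (b j - b k)) / (z - b j)) =
       (\<Sum>j=Suc k..<n. ?y' j / (z - b j)) + (b k - x k) / (z - b k) *
         ((\<Sum>j=Suc k..<n. ?y' j / (z - b j)) - (\<Sum>j=Suc k..<n. ?y' j / (b k - b j)))"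
      by (simp only: t sum.distrib sum_distrib_left[symmetric] sum_subtractf cong: sum.cong)
    then show ?thesis
      unfolding G_def pf_fun_def by (simp only: alg[OF zk])
  qed
  also have "\<dots> = (z - x k) / (z - b k) * G z" using zk by (simp add: field_simps)
  also have "\<dots> = (\<Prod>l=k..n. z - x l) / (\<Prod>j=k..<n. z - b j)"
    unfolding Gz e by simp
  finally show ?case .
qed

text \<open>The coefficients are \<open>y'\<close> before and \<open>y\<close> after a root s and
  the pole b_k are added. The residue at b_k is (s - b_k) times the old function at b_k; by the
  first equation this is g(s) = (s - b_k) times \<open>pf_fun\<close> of \<open>y\<close> at s. The
  second equation says that the old function at s is the derivative g'(s) for fixed
  \<open>y\<close>. This is what makes the Jacobian one-dimensional.\<close>

lemma pf_fun_rescale: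
  fixes b :: "nat \<Rightarrow> real"
  assumes bj: "\<And>j. k < j \<Longrightarrow> j < n \<Longrightarrow> b k < b j" and s: "s < b k"
    and y: "\<And>j. k < j \<Longrightarrow> j < n \<Longrightarrow> y j = y' j * ((b j - s) / (b j - b k))" "y n = y' n + (s - b k)"
  shows "pf_fun b n (Suc k) y' (b k) = pf_fun b n (Suc k) y s"
    and "pf_fun b n (Suc k) y' s = pf_fun b n (Suc k) y s + (s - b k) * (1 + (\<Sum>j=Suc k..<n. y j / (s - b j)\<^sup>2))"
proof -
  have y': "y' j = y j * ((b j - b k) / (b j - s))" if "k < j" "j < n" for j
    using y(1)[OF that] bj[OF that] s by simp
  have "(\<Sum>j=Suc k..<n. y' j / (b k - b j)) = (\<Sum>j=Suc k..<n. y j / (s - b j))"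
  proof (rule sum.cong[OF refl])
    fix j assume j: "j \<in> {Suc k..<n}"
    then have *: "y' j = y j * ((b j - b k) / (b j - s))" "b j - s \<noteq> 0" "b k - b j \<noteq> 0" "s - b j \<noteq> 0"
      using y'[of j] bj[of j] s by auto
    then show "y' j / (b k - b j) = y j / (s - b j)"
      unfolding *(1) by (simp add: divide_simps) (simp add: algebra_simps)
  qed
  then show "pf_fun b n (Suc k) y' (b k) = pf_fun b n (Suc k) y s"
    by (simp add: pf_fun_def y)
  have "(\<Sum>j=Suc k..<n. y' j / (s - b j)) = (\<Sum>j=Suc k..<n. y j / (s - b j) - (s - b k) * (y j / (s - b j)\<^sup>2))"
  proof (rule sum.cong[OF refl])
    fix j assume j: "j \<in> {Suc k..<n}"
    then have *: "y' j = y j * ((b j - b k) / (b j - s))" "b j - s \<noteq> 0" "s - b j \<noteq> 0"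
      using y'[of j] bj[of j] s by auto
    then show "y' j / (s - b j) = y j / (s - b j) - (s - b k) * (y j / (s - b j)\<^sup>2)"
      unfolding *(1) by (simp add: divide_simps) (simp add: algebra_simps power2_eq_square)
  qed
  then show "pf_fun b n (Suc k) y' s = pf_fun b n (Suc k) y s + (s - b k) * (1 + (\<Sum>j=Suc k..<n. y j / (s - b j)\<^sup>2))"
    by (simp add: pf_fun_def y sum_subtractf sum_distrib_left algebra_simps)
qed

lemma pf_fun_strict_mono:
  fixes b :: "nat \<Rightarrow> real"
  assumes bj: "\<And>j. j \<in> {k..<n} \<Longrightarrow> c \<le> b j" and y: "\<And>j. j \<in> {k..<n} \<Longrightarrow> 0 \<le> y j"
    and st: "s < t" "t < c"
  shows "pf_fun b n k y s < pf_fun b n k y t"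
proof -
  have "(\<Sum>j=k..<n. y j / (t - b j)) \<le> (\<Sum>j=k..<n. y j / (s - b j))"
  proof (rule sum_mono)
    fix j assume j: "j \<in> {k..<n}"
    have "inverse (t - b j) \<le> inverse (s - b j)"
      using bj[OF j] st by (intro le_imp_inverse_le_neg) auto
    then show "y j / (t - b j) \<le> y j / (s - b j)"
      unfolding divide_inverse using y[OF j] by (intro mult_left_mono) auto
  qed
  then show ?thesis using st by (simp add: pf_fun_def)
qed

text \<open>With the other coefficients fixed, g(t) is the residue at the pole c when t is the
  smallest root, and it has to range over all positive numbers. The sign condition in
  \<open>S\<close> expresses that c lies to the left of the next root. On \<open>S\<close> both c -
  t and the negated function are positive and decreasing, hence so is their product.\<close>

lemma pf_fun_image:
  fixes b :: "nat \<Rightarrow> real"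
  assumes bj: "\<And>j. j \<in> {k..<n} \<Longrightarrow> c < b j" and y: "\<And>j. j \<in> {k..<n} \<Longrightarrow> 0 < y j"
  defines "S \<equiv> {t. t < c \<and> pf_fun b n k y t < 0}" and "g \<equiv> \<lambda>t. (t - c) * pf_fun b n k y t"
  shows "inj_on g S" and "g ` S = {0<..}"
    and "\<And>t. t \<in> S \<Longrightarrow> (g has_field_derivative pf_fun b n k y t + (t - c) * (1 + (\<Sum>j=k..<n. y j / (t - b j)\<^sup>2))) (at t)"
proof -
  have lt: "g t < g s" if "s \<in> S" "t \<in> S" "s < t" for s t
  proof -
    have "pf_fun b n k y s < pf_fun b n k y t"
      using that bj y by (intro pf_fun_strict_mono[where c=c]) (auto simp: S_def less_imp_le)
    then have "(c - t) * (- pf_fun b n k y t) < (c - s) * (- pf_fun b n k y s)"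
      using that by (intro mult_strict_mono) (auto simp: S_def)
    then show ?thesis by (simp add: g_def algebra_simps)
  qed
  show "inj_on g S"
  proof (rule inj_onI)
    fix s t assume "s \<in> S" "t \<in> S" "g s = g t"
    then show "s = t" using lt[of s t] lt[of t s] by (cases s t rule: linorder_cases) auto
  qed
  \<comment> \<open>The endpoint t = c is included for the intermediate value theorem; all poles b j
    lie strictly to its right.\<close>
  have der: "(g has_field_derivative pf_fun b n k y t + (t - c) * (1 + (\<Sum>j=k..<n. y j / (t - b j)\<^sup>2))) (at t)"
    if t: "t \<le> c" for t
  proof -
    have ne: "t - b j \<noteq> 0" if "j \<in> {k..<n}" for j using bj[OF that] t by auto
    have "((\<lambda>z. z - y n - (\<Sum>j=k..<n. y j / (z - b j))) has_field_derivative
       (1 - 0) - (\<Sum>j=k..<n. - (y j / (t - b j)\<^sup>2))) (at t)"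
    proof (intro DERIV_diff DERIV_sum DERIV_ident DERIV_const)
      fix j assume "j \<in> {k..<n}"
      then show "((\<lambda>z. y j / (z - b j)) has_field_derivative - (y j / (t - b j)\<^sup>2)) (at t)"
        using ne[of j] by (auto intro!: derivative_eq_intros simp: power2_eq_square)
    qed
    then have "(pf_fun b n k y has_field_derivative (1 + (\<Sum>j=k..<n. y j / (t - b j)\<^sup>2))) (at t)"
      unfolding pf_fun_def[abs_def] by (simp add: sum_negf)
    from DERIV_mult[OF DERIV_diff[OF DERIV_ident DERIV_const[of c]] this] show ?thesis
      by (simp add: g_def algebra_simps)
  qed
  then show "\<And>t. t \<in> S \<Longrightarrow> (g has_field_derivative pf_fun b n k y t + (t - c) * (1 + (\<Sum>j=k..<n. y j / (t - b j)\<^sup>2))) (at t)"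
    by (simp add: S_def)
  show "g ` S = {0<..}"
  proof (intro equalityI subsetI)
    fix w assume "w \<in> g ` S"
    then show "w \<in> {0<..}" by (auto simp: S_def g_def intro!: mult_neg_neg)
  next
    fix w :: real assume "w \<in> {0<..}"
    then have w: "0 < w" by simp
    define K where "K = (\<Sum>j=k..<n. y j / (b j - c))"
    \<comment> \<open>The first bound gives c - t1 \<ge> 1, the second makes the function at most -w
      at t1; hence g(t1) \<ge> w, while g(c) = 0.\<close>
    define t1 where "t1 = min (c - 1) (y n - K - w)"
    have t1: "t1 < c" unfolding t1_def by auto
    have "(\<Sum>j=k..<n. - (y j / (b j - c))) \<le> (\<Sum>j=k..<n. y j / (t1 - b j))"
    proof (rule sum_mono)
      fix j assume j: "j \<in> {k..<n}"
      have "y j / (b j - t1) \<le> y j / (b j - c)"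
        using bj[OF j] y[OF j] t1 by (intro divide_left_mono) auto
      moreover have "y j / (t1 - b j) = - (y j / (b j - t1))"
        by (metis minus_diff_eq minus_divide_right)
      ultimately show "- (y j / (b j - c)) \<le> y j / (t1 - b j)" by simp
    qed
    then have H: "pf_fun b n k y t1 \<le> - w"
      unfolding pf_fun_def by (simp add: sum_negf K_def[symmetric] t1_def)
    have "1 * w \<le> (c - t1) * (- pf_fun b n k y t1)"
      using H w by (intro mult_mono) (auto simp: t1_def)
    then have "w \<le> g t1" by (simp add: g_def algebra_simps)
    moreover have "g c \<le> w" using w by (simp add: g_def)
    moreover have "\<forall>x. t1 \<le> x \<and> x \<le> c \<longrightarrow> isCont g x"
      using der by (auto intro: DERIV_isCont)
    ultimately obtain t where t: "t1 \<le> t" "t \<le> c" "g t = w"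
      using IVT2[of g c w t1] t1 by auto
    then have "t \<noteq> c" using w by (auto simp: g_def)
    then have "t < c" using t by simp
    moreover have "pf_fun b n k y t < 0"
      using t w \<open>t < c\<close> unfolding g_def by (auto simp: zero_less_mult_iff)
    ultimately show "w \<in> g ` S" using t by (auto simp: S_def)
  qed
qed

section \<open>Interlacing and Vandermonde products on the line\<close>

definition interlaced :: "(nat \<Rightarrow> real) \<Rightarrow> nat \<Rightarrow> nat \<Rightarrow> (nat \<Rightarrow> real) \<Rightarrow> bool" where
  "interlaced b n k x \<longleftrightarrow> (\<forall>j\<in>{k..<n}. x j < b j \<and> b j < x (Suc j))"

text \<open>Pairs are grouped by the smaller index, so that a new smallest index only adds one
  factor (\<open>vandermonde_insert\<close>).\<close>

definition vandermonde :: "nat set \<Rightarrow> (nat \<Rightarrow> real) \<Rightarrow> real" where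
  "vandermonde I x = (\<Prod>l\<in>I. \<Prod>m\<in>{m\<in>I. l < m}. \<bar>x m - x l\<bar>)"

lemma vandermonde_insert:
  assumes "finite I" "\<And>i. i \<in> I \<Longrightarrow> k < i"
  shows "vandermonde (insert k I) x = (\<Prod>m\<in>I. \<bar>x m - x k\<bar>) * vandermonde I x"
proof -
  have k: "k \<notin> I" using assms(2) by blast
  have "{m \<in> insert k I. k < m} = I" using assms by auto
  moreover have "{m \<in> insert k I. l < m} = {m \<in> I. l < m}" if "l \<in> I" for l
    using assms(2)[OF that] by auto
  ultimately show ?thesis using k assms(1) unfolding vandermonde_def by simp
qed

lemma vandermonde_nonneg: "0 \<le> vandermonde I x"
  unfolding vandermonde_def by (intro prod_nonneg) auto

lemma vandermonde_pos: "finite I \<Longrightarrow> inj_on x I \<Longrightarrow> 0 < vandermonde I x"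
  unfolding vandermonde_def by (intro prod_pos) (auto simp: inj_on_eq_iff)

lemma vandermonde_cong: "(\<And>i. i \<in> I \<Longrightarrow> x i = y i) \<Longrightarrow> vandermonde I x = vandermonde I y"
  unfolding vandermonde_def by (intro prod.cong) auto

lemma interlaced_rec:
  assumes "k < n"
  shows "interlaced b n k x \<longleftrightarrow> x k < b k \<and> b k < x (Suc k) \<and> interlaced b n (Suc k) x"
proof -
  have "{k..<n} = insert k {Suc k..<n}" using assms by auto
  then show ?thesis by (auto simp: interlaced_def)
qed

text \<open>Pair each pole b_j with the root x_(j+1) on its right. To the left of all poles every
  such quotient is positive, so the sign is that of the unpaired factor c - x_k.\<close>

lemma pf_fun_neg_iff:
  fixes b :: "nat \<Rightarrow> real"
  assumes "k \<le> n" "strict_mono_on {k..<n} b" "interlaced b n k x" "\<And>j. j \<in> {k..<n} \<Longrightarrow> c < b j"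
  shows "pf_fun b n k (pf_coeff b n k x) c < 0 \<longleftrightarrow> c < x k"
proof -
  have "pf_fun b n k (pf_coeff b n k x) c = (\<Prod>l=k..n. c - x l) / (\<Prod>j=k..<n. c - b j)"
    using assms(1,2) by (intro pf_fun_eq_prod strict_mono_on_imp_inj_on) (auto dest!: assms(4))
  also have "(\<Prod>l=k..n. c - x l) = (c - x k) * (\<Prod>l=Suc k..<Suc n. c - x l)"
    using assms(1) by (simp add: prod.atLeast_Suc_atMost atLeastLessThanSuc_atLeastAtMost)
  also have "\<dots> / (\<Prod>j=k..<n. c - b j) = (c - x k) * (\<Prod>j=k..<n. (c - x (Suc j)) / (c - b j))"
    by (simp only: prod.shift_bounds_Suc_ivl prod_dividef times_divide_eq_right)
  finally have *: "pf_fun b n k (pf_coeff b n k x) c = (c - x k) * (\<Prod>j=k..<n. (c - x (Suc j)) / (c - b j))" .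
  have "0 < (\<Prod>j=k..<n. (c - x (Suc j)) / (c - b j))"
    using assms(3,4) by (intro prod_pos divide_neg_neg) (force simp: interlaced_def)+
  then show ?thesis unfolding * by (simp add: mult_less_0_iff)
qed

text \<open>By \<open>pf_coeff_rec\<close>, the residue at b_k is x_k - b_k times the old function
  at b_k, both negative; the other residues are old ones times positive factors.\<close>

lemma pf_coeff_pos:
  fixes b :: "nat \<Rightarrow> real"
  assumes "k \<le> n" "strict_mono_on {k..<n} b" "interlaced b n k x" "j \<in> {k..<n}"
  shows "0 < pf_coeff b n k x j"
  using assms
proof (induction k rule: inc_induct)
  case (step k)
  have sm: "strict_mono_on {Suc k..<n} b" using step.prems by (auto intro: monotone_on_subset)
  have bk: "b k < b i" if "i \<in> {Suc k..<n}" for i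
    using strict_mono_onD[OF step.prems(1), of k i] that by auto
  have il: "x k < b k" "b k < x (Suc k)" "interlaced b n (Suc k) x"
    using step.prems step.hyps by (auto simp: interlaced_rec)
  show ?case
  proof (cases "j = k")
    case True
    have "pf_fun b n (Suc k) (pf_coeff b n (Suc k) x) (b k) < 0"
      using step.hyps sm il bk by (subst pf_fun_neg_iff) auto
    moreover have "pf_fun b n (Suc k) (pf_coeff b n (Suc k) x) (b k)
      = (\<Prod>l=Suc k..n. b k - x l) / (\<Prod>i=Suc k..<n. b k - b i)"
      using step.hyps sm by (intro pf_fun_eq_prod strict_mono_on_imp_inj_on) (auto dest: bk)
    ultimately show ?thesis
      using il unfolding True pf_coeff_rec(3)[OF \<open>k < n\<close>] by (intro mult_neg_neg) auto
  next
    case False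
    then have j: "j \<in> {Suc k..<n}" using step.prems by auto
    have "0 < pf_coeff b n (Suc k) x j" using step.IH sm il j by auto
    moreover have "0 < (b j - x k) / (b j - b k)" using bk[OF j] il by auto
    ultimately show ?thesis using j step.hyps by (subst pf_coeff_rec(1)) (auto intro!: mult_pos_pos simp del: times_divide_eq_right)
  qed
qed simp

section \<open>Measurability of the partial fraction data\<close>

lemma measurable_pf_fun:
  assumes "k \<le> n" "\<And>j. j \<in> {k..n} \<Longrightarrow> (\<lambda>w. f w j) \<in> borel_measurable M" "t \<in> borel_measurable M"
  shows "(\<lambda>w. pf_fun b n k (f w) (t w) :: real) \<in> borel_measurable M"
proof -
  have [measurable]: "(\<lambda>w. f w n) \<in> borel_measurable M" using assms by auto
  have [measurable]: "t \<in> borel_measurable M" by fact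
  have "(\<lambda>w. \<Sum>j=k..<n. f w j / (t w - b j)) \<in> borel_measurable M"
  proof (rule borel_measurable_sum)
    fix j assume "j \<in> {k..<n}"
    then have [measurable]: "(\<lambda>w. f w j) \<in> borel_measurable M" using assms by auto
    show "(\<lambda>w. f w j / (t w - b j)) \<in> borel_measurable M" by measurable
  qed
  then show ?thesis unfolding pf_fun_def by measurable
qed

lemma measurable_pf_deriv:
  assumes "\<And>j. j \<in> {k..<n} \<Longrightarrow> (\<lambda>w. f w j) \<in> borel_measurable M" "t \<in> borel_measurable M"
  shows "(\<lambda>w. \<Sum>j=k..<n. f w j / (t w - b j)\<^sup>2 :: real) \<in> borel_measurable M"
proof (rule borel_measurable_sum)
  have [measurable]: "t \<in> borel_measurable M" by fact
  fix j assume "j \<in> {k..<n}"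
  then have [measurable]: "(\<lambda>w. f w j) \<in> borel_measurable M" using assms by auto
  show "(\<lambda>w. f w j / (t w - b j)\<^sup>2) \<in> borel_measurable M" by measurable
qed

lemma measurable_pf_coeff: "k \<le> n \<Longrightarrow> pf_coeff b n k \<in> measurable (lborel_Pi {k..n}) (lborel_Pi {k..n})"
  unfolding pf_coeff_def[abs_def]
proof (rule measurable_restrict)
  fix j assume "k \<le> n" "j \<in> {k..n}"
  have [measurable]: "(\<lambda>x. \<Sum>l=k..n. x l) \<in> borel_measurable (lborel_Pi {k..n})"
    by (intro borel_measurable_sum measurable_component_compose) auto
  have [measurable]: "(\<lambda>x. \<Prod>l=k..n. b j - x l) \<in> borel_measurable (lborel_Pi {k..n})"
    by (intro borel_measurable_prod borel_measurable_diff measurable_component_compose) auto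
  show "(\<lambda>x. if j = n then (\<Sum>l=k..n. x l) - (\<Sum>i=k..<n. b i)
     else - (\<Prod>l=k..n. b j - x l) / (\<Prod>i\<in>{k..<n} - {j}. b j - b i)) \<in> measurable (lborel_Pi {k..n}) lborel"
    by measurable
qed

lemma measurable_vandermonde: "finite I \<Longrightarrow> I \<subseteq> J \<Longrightarrow> vandermonde I \<in> borel_measurable (lborel_Pi J)"
  unfolding vandermonde_def[abs_def]
  by (intro borel_measurable_prod borel_measurable_abs borel_measurable_diff measurable_component_compose) auto

lemma measurable_interlaced: "k \<le> n \<Longrightarrow> Measurable.pred (lborel_Pi {k..n}) (interlaced b n k)"
  unfolding interlaced_def[abs_def]
proof (intro pred_intros_finite pred_intros_logic)
  fix j assume j: "j \<in> {k..<n}"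
  have [measurable]: "(\<lambda>x. x j) \<in> borel_measurable (lborel_Pi {k..n})" "(\<lambda>x. x (Suc j)) \<in> borel_measurable (lborel_Pi {k..n})"
    using j by (auto intro!: measurable_component_compose)
  show "Measurable.pred (lborel_Pi {k..n}) (\<lambda>x. x j < b j)" "Measurable.pred (lborel_Pi {k..n}) (\<lambda>x. b j < x (Suc j))"
    by measurable
qed auto

lemma measurable_ball_pos: "finite J \<Longrightarrow> J \<subseteq> I \<Longrightarrow> Measurable.pred (lborel_Pi I) (\<lambda>y. \<forall>j\<in>J. 0 < y j)"
proof (intro pred_intros_finite)
  fix j assume j: "J \<subseteq> I" "j \<in> J"
  then have [measurable]: "(\<lambda>x. x j) \<in> borel_measurable (lborel_Pi I)"
    by (auto intro!: measurable_component_compose)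
  show "Measurable.pred (lborel_Pi I) (\<lambda>x. 0 < x j)" by measurable
qed

text \<open>The integral form lets the induction run on Fubini and one-dimensional substitutions
  alone. It encodes that, up to null sets, interlacing roots correspond to positive residues with a
  free constant term, and that the Jacobian is the Vandermonde product of the roots divided by that
  of the poles.\<close>

theorem nn_integral_interlaced:
  fixes b :: "nat \<Rightarrow> real"
  assumes "k \<le> n" "strict_mono_on {k..<n} b" "h \<in> borel_measurable (lborel_Pi {k..n})"
  shows "(\<integral>\<^sup>+x. h (pf_coeff b n k x) * (ennreal (vandermonde {k..n} x) * indicator {x. interlaced b n k x} x) \<partial>lborel_Pi {k..n})
    = ennreal (vandermonde {k..<n} b) * (\<integral>\<^sup>+y. h y * indicator {y. \<forall>j\<in>{k..<n}. 0 < y j} y \<partial>lborel_Pi {k..n})"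
  using assms
proof (induction k arbitrary: h rule: inc_induct)
  case base
  have "pf_coeff b n n x = x" if "x \<in> space (lborel_Pi {n..n})" for x
  proof
    fix j show "pf_coeff b n n x j = x j"
      using that by (cases "j = n") (simp_all add: pf_coeff_def space_PiM PiE_def extensional_def)
  qed
  moreover have "vandermonde {n..n} x = 1" for x
    using vandermonde_insert[of "{}" n x] by (simp add: vandermonde_def)
  ultimately show ?case
    by (simp add: vandermonde_def[of "{}"] interlaced_def del: atLeastAtMost_singleton cong: nn_integral_cong_simp)
next
  case (step k)
  define I where "I = {Suc k..n}"
  define J where "J = {Suc k..<n}"
  have kn: "k < n" by fact
  have I: "finite I" "k \<notin> I" "{k..n} = insert k I" "n \<in> I" "J \<subseteq> I" using kn by (auto simp: I_def J_def)
  have J: "finite J" "k \<notin> J" "{k..<n} = insert k J" using kn by (auto simp: J_def)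
  have sm: "strict_mono_on J b" using step.prems by (auto intro: monotone_on_subset simp: J_def)
  have bk: "b k < b j" if "j \<in> J" for j
    using strict_mono_onD[OF step.prems(1), of k j] that by (auto simp: J_def)
  have notin: "s \<notin> b ` {Suc k..<n}" if "s \<le> b k" for s
  proof
    assume "s \<in> b ` {Suc k..<n}"
    then obtain j where "j \<in> J" "s = b j" by (auto simp: J_def)
    then show False using bk[of j] that by simp
  qed
  have h[measurable]: "h \<in> borel_measurable (lborel_Pi (insert k I))" using step.prems I by simp
  define pf where "pf = pf_fun b n (Suc k)"
  define co where "co = pf_coeff b n (Suc k)"
  \<comment> \<open>\<open>D y s\<close> is the derivative in s of (s - b k) * pf y s.\<close>
  define D where "D y s = pf y s + (s - b k) * (1 + (\<Sum>j\<in>J. y j / (s - b j)\<^sup>2))" for y s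
  define g where "g s j r = (if j = n then r + (s - b k) else r * ((b j - s) / (b j - b k)))" for s j r
  define g' where "g' s j = (if j = n then 1 else (b j - s) / (b j - b k))" for s j
  define St where "St s y = (\<lambda>j\<in>I. g s j (y j))(k := (s - b k) * pf y (b k))" for s y
  let ?pos = "\<lambda>y. indicator {y. \<forall>j\<in>J. 0 < y j} y :: ennreal"
  \<comment> \<open>\<open>St s\<close> inserts a new smallest root \<open>s\<close> and pole \<open>b k\<close>; \<open>H\<close> is the integrand before the rescaling \<open>g s\<close>, \<open>L\<close> after it.\<close>
  define H where "H s y = indicator {..<b k} s * (h (St s y) *
      (ennreal (\<bar>pf y s\<bar> * (\<Prod>j\<in>J. \<bar>s - b j\<bar>)) * indicator {y. pf y (b k) < 0} y))" for s y
  define L where "L y s = h (y(k := (s - b k) * pf y s)) *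
      (ennreal \<bar>D y s\<bar> * (indicator {s. s < b k \<and> pf y s < 0} s * ?pos y))" for y s
  define C where "C = ennreal (\<Prod>j\<in>J. \<bar>b j - b k\<bar>)"
  define B where "B = ennreal (vandermonde J b)"

  have mpf: "(\<lambda>w. pf (f w) (t w)) \<in> borel_measurable M"
    if "\<And>j. j \<in> I \<Longrightarrow> (\<lambda>w. f w j) \<in> borel_measurable M" "t \<in> borel_measurable M" for f t and M :: "'z measure"
    using that kn unfolding pf_def I_def by (intro measurable_pf_fun) auto
  have comp: "(\<lambda>w. fst w j) \<in> borel_measurable (lborel_Pi I \<Otimes>\<^sub>M lborel)" if "j \<in> I" for j
    using that by (intro measurable_compose[OF measurable_fst] measurable_component_compose) auto
  have [measurable]: "(\<lambda>w. pf (fst w) (snd w)) \<in> borel_measurable (lborel_Pi I \<Otimes>\<^sub>M lborel)"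
    by (intro mpf comp) auto
  have [measurable]: "(\<lambda>w. pf (fst w) (b k)) \<in> borel_measurable (lborel_Pi I \<Otimes>\<^sub>M lborel)"
    by (intro mpf comp) auto
  have [measurable]: "(\<lambda>w. D (fst w) (snd w)) \<in> borel_measurable (lborel_Pi I \<Otimes>\<^sub>M lborel)"
    unfolding D_def J_def
    by (intro borel_measurable_add borel_measurable_times measurable_pf_deriv comp mpf) (auto simp: I_def)
  have [measurable]: "Measurable.pred (lborel_Pi I) (\<lambda>y. \<forall>j\<in>J. 0 < y j)"
    using I J by (intro measurable_ball_pos)
  have [measurable]: "(\<lambda>w. \<lambda>j\<in>I. g (snd w) j (fst w j)) \<in> measurable (lborel_Pi I \<Otimes>\<^sub>M lborel) (lborel_Pi I)"
  proof (rule measurable_restrict)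
    fix j assume j: "j \<in> I"
    note comp[OF j, measurable]
    show "(\<lambda>w. g (snd w) j (fst w j)) \<in> measurable (lborel_Pi I \<Otimes>\<^sub>M lborel) lborel"
      unfolding g_def by measurable
  qed
  have [measurable]: "(\<lambda>w. St (snd w) (fst w)) \<in> measurable (lborel_Pi I \<Otimes>\<^sub>M lborel) (lborel_Pi (insert k I))"
    unfolding St_def by measurable
  have H[measurable]: "(\<lambda>w. H (snd w) (fst w)) \<in> borel_measurable (lborel_Pi I \<Otimes>\<^sub>M lborel)"
    unfolding H_def by measurable
  have L[measurable]: "(\<lambda>w. L (fst w) (snd w)) \<in> borel_measurable (lborel_Pi I \<Otimes>\<^sub>M lborel)"
    unfolding L_def by measurable
  have Hs: "H s \<in> borel_measurable (lborel_Pi I)" for s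
    using measurable_compose[OF measurable_Pair1'[of s lborel "lborel_Pi I"] measurable_compose[OF measurable_pair_swap' H]]
    by simp
  have Ls: "(\<lambda>y. L y s) \<in> borel_measurable (lborel_Pi I)" for s
    using measurable_compose[OF measurable_Pair1'[of s lborel "lborel_Pi I"] measurable_compose[OF measurable_pair_swap' L]]
    by simp
  have kn': "k \<le> n" using kn by simp
  have [measurable]: "Measurable.pred (lborel_Pi (insert k I)) (\<lambda>x. interlaced b n k x)"
    "vandermonde (insert k I) \<in> borel_measurable (lborel_Pi (insert k I))"
    "pf_coeff b n k \<in> measurable (lborel_Pi (insert k I)) (lborel_Pi (insert k I))"
    using measurable_interlaced[OF kn'] measurable_pf_coeff[OF kn'] measurable_vandermonde[of "insert k I" "insert k I"] I(1)
    unfolding I(3) by simp_all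

  \<comment> \<open>The coefficients depend on the other roots only through \<open>co x\<close>,
    which is what makes the induction hypothesis applicable.\<close>
  have coeff: "pf_coeff b n k (x(k := s)) = St s (co x)" if x: "x \<in> space (lborel_Pi I)" and s: "s < b k" for x s
  proof
    fix j
    have co_upd: "pf_coeff b n (Suc k) (x(k := s)) = co x"
      unfolding co_def pf_coeff_def
      by (intro ext) (auto intro!: arg_cong2[where f="(-)"] arg_cong2[where f="(/)"] arg_cong[where f=uminus] sum.cong prod.cong)
    have "inj_on b {Suc k..<n}" using sm strict_mono_on_imp_inj_on by (auto simp: J_def)
    then have pfk: "pf (co x) (b k) = (\<Prod>l=Suc k..n. b k - x l) / (\<Prod>i=Suc k..<n. b k - b i)"
      unfolding pf_def co_def using kn by (intro pf_fun_eq_prod notin) auto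
    consider "j = k" | "j = n" | "j \<in> J" | "j \<notin> insert k I" using I J kn by (force simp: I_def J_def)
    then show "pf_coeff b n k (x(k := s)) j = St s (co x) j"
    proof cases
      case 1
      have "(\<Prod>l=Suc k..n. b k - (x(k := s)) l) = (\<Prod>l=Suc k..n. b k - x l)"
        by (intro prod.cong) auto
      then show ?thesis using kn unfolding 1 pf_coeff_rec(3)[OF kn] St_def pfk by simp
    next
      case 2
      then show ?thesis using kn I unfolding 2 pf_coeff_rec(2)[OF kn] co_upd by (simp add: St_def g_def)
    next
      case 3
      then show ?thesis using kn I by (auto simp: pf_coeff_rec(1)[OF kn] co_upd St_def g_def J_def)
    next
      case 4
      then show ?thesis using I(3) by (simp add: pf_coeff_def St_def)
    qed
  qed

  have meas: "(\<lambda>x. h (pf_coeff b n k x) * (ennreal (vandermonde (insert k I) x) * indicator {x. interlaced b n k x} x)) \<in> borel_measurable (lborel_Pi (insert k I))"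
    by measurable
  have "(\<integral>\<^sup>+x. h (pf_coeff b n k x) * (ennreal (vandermonde (insert k I) x) * indicator {x. interlaced b n k x} x) \<partial>lborel_Pi (insert k I))
    = (\<integral>\<^sup>+s. (\<integral>\<^sup>+x. H s (co x) * (ennreal (vandermonde I x) * indicator {x. interlaced b n (Suc k) x} x) \<partial>lborel_Pi I) \<partial>lborel)"
    unfolding lborel_prod.product_nn_integral_insert_rev[OF I(1,2) meas]
  proof (intro nn_integral_cong)
    fix s x assume x: "x \<in> space (lborel_Pi I)"
    have il: "interlaced b n k (x(k := s)) \<longleftrightarrow> s < b k \<and> b k < x (Suc k) \<and> interlaced b n (Suc k) x"
      unfolding interlaced_rec[OF kn] by (auto simp: interlaced_def)
    show "h (pf_coeff b n k (x(k := s))) * (ennreal (vandermonde (insert k I) (x(k := s))) * indicator {x. interlaced b n k x} (x(k := s)))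
       = H s (co x) * (ennreal (vandermonde I x) * indicator {x. interlaced b n (Suc k) x} x)"
    proof (cases "s < b k \<and> interlaced b n (Suc k) x")
      case True
      \<comment> \<open>Turns the inequality that joins the new pole to the old roots into a
        condition on their coefficients.\<close>
      have iff: "pf (co x) (b k) < 0 \<longleftrightarrow> b k < x (Suc k)"
        unfolding pf_def co_def using True kn sm bk by (intro pf_fun_neg_iff) (auto simp: J_def)
      have inj: "inj_on b {Suc k..<n}" using sm strict_mono_on_imp_inj_on by (auto simp: J_def)
      have "s \<notin> b ` {Suc k..<n}" using True by (intro notin) auto
      then have pfs: "pf (co x) s = (\<Prod>l=Suc k..n. s - x l) / (\<Prod>i=Suc k..<n. s - b i)"
        unfolding pf_def co_def using kn inj by (intro pf_fun_eq_prod) auto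
      have nz: "(\<Prod>i=Suc k..<n. s - b i) \<noteq> 0" using \<open>s \<notin> b ` {Suc k..<n}\<close> by auto
      have "vandermonde (insert k I) (x(k := s)) = (\<Prod>m\<in>I. \<bar>x m - s\<bar>) * vandermonde I x"
      proof -
        have "(\<Prod>m\<in>I. \<bar>(x(k := s)) m - (x(k := s)) k\<bar>) = (\<Prod>m\<in>I. \<bar>x m - s\<bar>)"
          using I(2) by (intro prod.cong) auto
        moreover have "vandermonde I (x(k := s)) = vandermonde I x"
          using I(2) by (intro vandermonde_cong) auto
        ultimately show ?thesis by (subst vandermonde_insert) (auto simp: I_def)
      qed
      also have "(\<Prod>m\<in>I. \<bar>x m - s\<bar>) = \<bar>\<Prod>m\<in>I. s - x m\<bar>"
        unfolding abs_prod by (intro prod.cong) auto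
      \<comment> \<open>The Vandermonde factors of the root s are a function of \<open>co x\<close>
        alone, by the product formula read backwards.\<close>
      also have "\<dots> = \<bar>pf (co x) s\<bar> * (\<Prod>j\<in>J. \<bar>s - b j\<bar>)"
        unfolding pfs abs_prod[symmetric] abs_mult[symmetric] using nz by (simp add: I_def J_def)
      finally have V: "vandermonde (insert k I) (x(k := s)) = \<bar>pf (co x) s\<bar> * (\<Prod>j\<in>J. \<bar>s - b j\<bar>) * vandermonde I x" .
      have "ennreal (vandermonde (insert k I) (x(k := s))) = ennreal (\<bar>pf (co x) s\<bar> * (\<Prod>j\<in>J. \<bar>s - b j\<bar>)) * ennreal (vandermonde I x)"
        unfolding V by (intro ennreal_mult mult_nonneg_nonneg prod_nonneg) (auto simp: vandermonde_nonneg)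
      then show ?thesis
        using True il iff x unfolding H_def by (auto simp: coeff indicator_def mult_ac)
    next
      case False
      then show ?thesis using il by (auto simp: H_def indicator_def)
    qed
  qed
  also have "\<dots> = (\<integral>\<^sup>+s. B * (\<integral>\<^sup>+y. H s y * ?pos y \<partial>lborel_Pi I) \<partial>lborel)"
    unfolding co_def B_def I_def J_def
    using sm Hs by (intro nn_integral_cong step.IH) (auto simp: I_def J_def)
  also have "\<dots> = (\<integral>\<^sup>+s. B * (C * (\<integral>\<^sup>+y. L y s \<partial>lborel_Pi I)) \<partial>lborel)"
  proof (intro nn_integral_cong arg_cong2[where f="(*)"] refl)
    fix s
    show "(\<integral>\<^sup>+y. H s y * ?pos y \<partial>lborel_Pi I) = C * (\<integral>\<^sup>+y. L y s \<partial>lborel_Pi I)"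
    proof (cases "s < b k")
      case False
      then show ?thesis by (simp add: H_def L_def)
    next
      case s: True
      have g'pos: "0 < g' s j" if "j \<in> I" for j
        using bk[of j] s that by (auto simp: g'_def I_def J_def)
      have gder: "(g s j has_field_derivative g' s j) (at r)" if "j \<in> I" for j r
        using DERIV_cmult_right[OF DERIV_ident, of "(b j - s) / (b j - b k)" r UNIV]
        by (cases "j = n") (auto intro!: derivative_eq_intros simp: g_def[abs_def] g'_def simp del: times_divide_eq_right)
      have inj: "inj (g s j)" if "j \<in> I" for j
        using g'pos[OF that] by (auto simp: inj_def g_def g'_def simp del: times_divide_eq_right split: if_splits)
      have surj: "range (g s j) = UNIV" if "j \<in> I" for j
      proof (intro equalityI subsetI UNIV_I)
        fix r
        have "g s j (if j = n then r - (s - b k) else r / g' s j) = r"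
          using g'pos[OF that] by (auto simp: g_def g'_def split: if_splits)
        then show "r \<in> range (g s j)" by (metis rangeI)
      qed
      have pw: "H s y * ?pos y = C * (L (\<lambda>j\<in>I. g s j (y j)) s * (\<Prod>j\<in>I. ennreal \<bar>g' s j\<bar>))" for y
      proof -
        let ?z = "\<lambda>j\<in>I. g s j (y j)"
        have r: "?z j = y j * ((b j - s) / (b j - b k))" if "k < j" "j < n" for j
          using that by (simp add: g_def I_def)
        have rn: "?z n = y n + (s - b k)" using I(4) by (simp add: g_def)
        have "b k < b j" if "k < j" "j < n" for j using bk[of j] that by (simp add: J_def)
        from pf_fun_rescale[of k n b s ?z y, OF this s r rn]
        have "pf y (b k) = pf ?z s" "pf y s = D ?z s"
          unfolding pf_def D_def J_def by blast+
        moreover have "St s y = ?z(k := (s - b k) * pf ?z s)"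
          using calculation by (simp add: St_def)
        moreover have "(\<forall>j\<in>J. 0 < ?z j) \<longleftrightarrow> (\<forall>j\<in>J. 0 < y j)"
        proof (intro ball_cong refl)
          fix j assume j: "j \<in> J"
          then have "j \<in> I" "j \<noteq> n" using I(5) by (auto simp: J_def)
          then have "?z j = y j * g' s j" by (simp add: g_def g'_def)
          then show "(0 < ?z j) = (0 < y j)" using g'pos[OF \<open>j \<in> I\<close>] by (simp add: zero_less_mult_iff)
        qed
        moreover have "ennreal (\<bar>pf y s\<bar> * (\<Prod>j\<in>J. \<bar>s - b j\<bar>)) = C * (ennreal \<bar>pf y s\<bar> * (\<Prod>j\<in>I. ennreal \<bar>g' s j\<bar>))"
        proof -
          have IJ: "I = insert n J" using kn by (auto simp: I_def J_def)
          then have "(\<Prod>j\<in>I. \<bar>g' s j\<bar>) = (\<Prod>j\<in>J. \<bar>b j - s\<bar> / \<bar>b j - b k\<bar>)"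
            using J(1) by (subst IJ, subst prod.insert) (auto simp: J_def g'_def intro!: prod.cong)
          \<comment> \<open>The Jacobian |b j - s| / |b j - b k| of the rescaling absorbs the
            factors |s - b j|. What remains is free of s, and in the end it supplies the Vandermonde
            factors of the pole b k.\<close>
          then have "(\<Prod>j\<in>J. \<bar>b j - b k\<bar>) * (\<Prod>j\<in>I. \<bar>g' s j\<bar>) = (\<Prod>j\<in>J. \<bar>s - b j\<bar>)"
            by (simp add: prod.distrib[symmetric]) (intro prod.cong refl, auto dest: bk)
          then have "\<bar>pf y s\<bar> * (\<Prod>j\<in>J. \<bar>s - b j\<bar>) = (\<Prod>j\<in>J. \<bar>b j - b k\<bar>) * (\<bar>pf y s\<bar> * (\<Prod>j\<in>I. \<bar>g' s j\<bar>))"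
            by simp
          then have "ennreal (\<bar>pf y s\<bar> * (\<Prod>j\<in>J. \<bar>s - b j\<bar>)) = ennreal ((\<Prod>j\<in>J. \<bar>b j - b k\<bar>) * (\<bar>pf y s\<bar> * (\<Prod>j\<in>I. \<bar>g' s j\<bar>)))"
            by (rule arg_cong)
          also have "\<dots> = C * (ennreal \<bar>pf y s\<bar> * (\<Prod>j\<in>I. ennreal \<bar>g' s j\<bar>))"
            unfolding C_def by (simp add: ennreal_mult' prod_nonneg prod_ennreal)
          finally show ?thesis .
        qed
        ultimately show ?thesis using s
          unfolding H_def L_def by (auto simp: indicator_def mult_ac)
      qed
      have "g s j \<in> borel_measurable lborel" for j
        by (cases "j = n") (simp_all add: g_def[abs_def])
      then have gm: "(\<lambda>y. \<lambda>j\<in>I. g s j (y j)) \<in> measurable (lborel_Pi I) (lborel_Pi I)"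
        by (intro measurable_restrict measurable_component_compose) auto
      have "(\<integral>\<^sup>+y. H s y * ?pos y \<partial>lborel_Pi I)
        = C * (\<integral>\<^sup>+y. L (\<lambda>j\<in>I. g s j (y j)) s * (\<Prod>j\<in>I. ennreal \<bar>g' s j\<bar> * indicator UNIV (y j)) \<partial>lborel_Pi I)"
        unfolding pw by (subst nn_integral_cmult) (auto intro!: borel_measurable_times_ennreal measurable_compose[OF gm Ls])
      also have "(\<integral>\<^sup>+y. L (\<lambda>j\<in>I. g s j (y j)) s * (\<Prod>j\<in>I. ennreal \<bar>g' s j\<bar> * indicator UNIV (y j)) \<partial>lborel_Pi I)
         = (\<integral>\<^sup>+y. L y s * (\<Prod>j\<in>I. indicator (g s j ` UNIV) (y j)) \<partial>lborel_Pi I)"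
        using I(1) gder inj surj Ls by (intro nn_integral_PiM_substitution) (auto simp: g_def[abs_def])
      finally show ?thesis using surj by simp
    qed
  qed
  also have "\<dots> = B * C * (\<integral>\<^sup>+s. \<integral>\<^sup>+y. L y s \<partial>lborel_Pi I \<partial>lborel)"
  proof -
    interpret sigma_finite_measure "lborel_Pi I" using I(1) by (rule sigma_finite_lborel_Pi)
    have [measurable]: "(\<lambda>s. \<integral>\<^sup>+y. L y s \<partial>lborel_Pi I) \<in> borel_measurable lborel"
      by (rule borel_measurable_nn_integral) (use measurable_compose[OF measurable_pair_swap' L] in \<open>simp add: case_prod_beta'\<close>)
    show ?thesis by (simp add: nn_integral_cmult mult.assoc)
  qed
  finally have lhs: "(\<integral>\<^sup>+x. h (pf_coeff b n k x) * (ennreal (vandermonde (insert k I) x) * indicator {x. interlaced b n k x} x) \<partial>lborel_Pi (insert k I))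
    = B * C * (\<integral>\<^sup>+s. \<integral>\<^sup>+y. L y s \<partial>lborel_Pi I \<partial>lborel)" .
  \<comment> \<open>With s innermost, the rescaled coefficients y are fixed and s can be traded for
    the residue at b k.\<close>
  have "(\<integral>\<^sup>+s. \<integral>\<^sup>+y. L y s \<partial>lborel_Pi I \<partial>lborel) = (\<integral>\<^sup>+y. \<integral>\<^sup>+s. L y s \<partial>lborel \<partial>lborel_Pi I)"
  proof -
    interpret pair_sigma_finite "lborel_Pi I" lborel
      using sigma_finite_lborel_Pi[OF I(1)] by (simp add: pair_sigma_finite_def sigma_finite_lborel)
    show ?thesis using L by (intro Fubini') (simp add: case_prod_beta')
  qed
  also have "\<dots> = (\<integral>\<^sup>+y. \<integral>\<^sup>+w. h (y(k := w)) * (indicator {0<..} w * ?pos y) \<partial>lborel \<partial>lborel_Pi I)"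
  proof (rule nn_integral_cong)
    fix y assume y: "y \<in> space (lborel_Pi I)"
    show "(\<integral>\<^sup>+s. L y s \<partial>lborel) = (\<integral>\<^sup>+w. h (y(k := w)) * (indicator {0<..} w * ?pos y) \<partial>lborel)"
    proof (cases "\<forall>j\<in>J. 0 < y j")
      case True
      let ?S = "{s. s < b k \<and> pf y s < 0}" and ?g = "\<lambda>s. (s - b k) * pf y s"
      have [measurable]: "pf y \<in> borel_measurable borel" by (rule mpf[of "\<lambda>_. y" borel "\<lambda>s. s"]) auto
      have [measurable]: "D y \<in> borel_measurable borel"
        unfolding D_def J_def by (intro borel_measurable_add borel_measurable_times measurable_pf_deriv) auto
      have [measurable]: "(\<lambda>w. h (y(k := w))) \<in> borel_measurable borel"
        using measurable_fun_upd_section[OF h y I(2)] by simp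
      have im: "?g ` ?S = {0<..}" "inj_on ?g ?S"
        and der: "\<And>s. s \<in> ?S \<Longrightarrow> (?g has_field_derivative D y s) (at s)"
        using pf_fun_image[of "Suc k" n "b k" b y] bk True unfolding pf_def D_def J_def by auto
      have "(\<integral>\<^sup>+s. L y s \<partial>lborel) = (\<integral>\<^sup>+s. h (y(k := ?g s)) * (ennreal \<bar>D y s\<bar> * indicator ?S s) \<partial>lborel)"
        using True by (intro nn_integral_cong) (simp add: L_def)
      also have "\<dots> = (\<integral>\<^sup>+w. h (y(k := w)) * indicator (?g ` ?S) w \<partial>lborel)"
        using im by (intro nn_integral_substitution_inj der) auto
      finally show ?thesis using True im by simp
    next
      case False
      then show ?thesis by (simp add: L_def)
    qed
  qed
  also have "\<dots> = (\<integral>\<^sup>+y. h y * indicator {y. \<forall>j\<in>insert k J. 0 < y j} y \<partial>lborel_Pi (insert k I))"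
  proof -
    have [measurable]: "Measurable.pred (lborel_Pi (insert k I)) (\<lambda>y. \<forall>j\<in>insert k J. 0 < y j)"
      using I J by (intro measurable_ball_pos) auto
    have meas: "(\<lambda>y. h y * indicator {y. \<forall>j\<in>insert k J. 0 < y j} y) \<in> borel_measurable (lborel_Pi (insert k I))"
      by measurable
    have e: "(\<forall>j\<in>insert k J. 0 < (y(k := w)) j) \<longleftrightarrow> 0 < w \<and> (\<forall>j\<in>J. 0 < y j)" for y :: "nat \<Rightarrow> real" and w
      using J(2) by auto
    have "indicator {y. \<forall>j\<in>insert k J. 0 < y j} (y(k := w)) = indicator {0<..} w * ?pos y" for y and w :: real
      unfolding indicator_def mem_Collect_eq e by simp
    then show ?thesis
      unfolding lborel_prod.product_nn_integral_insert[OF I(1,2) meas] by simp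
  qed
  finally have rhs: "(\<integral>\<^sup>+s. \<integral>\<^sup>+y. L y s \<partial>lborel_Pi I \<partial>lborel)
    = (\<integral>\<^sup>+y. h y * indicator {y. \<forall>j\<in>insert k J. 0 < y j} y \<partial>lborel_Pi (insert k I))" .
  have "B * C = ennreal (vandermonde (insert k J) b)"
    unfolding B_def C_def using J
    by (subst vandermonde_insert) (auto simp: ennreal_mult vandermonde_nonneg prod_nonneg mult.commute J_def)
  then show ?case unfolding I(3) J(3) lhs rhs by simp
qed

subsection \<open>Weights and phase as coordinates\<close>

text \<open>
  One coordinate $p_k$ is replaced by the total $T = 1 + \sum_i p_i$, the others are rescaled to
  $r_i = p_i / T$, and $T$ is then replaced by $q_k = 1 - 1/T - \sum_i r_i$.
\<close>

lemma nn_integral_projective: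
  assumes "finite I" and K: "K \<in> borel_measurable (lborel_Pi I)"
  shows "(\<integral>\<^sup>+p. K (\<lambda>i\<in>I. p i / (1 + (\<Sum>i\<in>I. p i))) * (ennreal (1 / (1 + (\<Sum>i\<in>I. p i)) ^ (card I + 1)) *
        indicator {p. \<forall>i\<in>I. 0 < p i} p) \<partial>lborel_Pi I)
    = (\<integral>\<^sup>+q. K q * indicator {q. (\<forall>i\<in>I. 0 < q i) \<and> (\<Sum>i\<in>I. q i) < 1} q \<partial>lborel_Pi I)"
proof (cases "I = {}")
  case True
  then show ?thesis by (simp add: PiM_empty nn_integral_count_space_finite)
next
  case False
  then obtain k J where IJ: "I = insert k J" "k \<notin> J" by (metis Set.set_insert all_not_in_conv)
  have J: "finite J" "k \<notin> J" "card I = Suc (card J)" using IJ assms(1) by auto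
  have K'[measurable]: "K \<in> borel_measurable (lborel_Pi (insert k J))" using K IJ by simp
  let ?s = "\<lambda>y. \<Sum>i\<in>J. y i :: real"
  let ?pos = "\<lambda>y. indicator {y. \<forall>i\<in>J. 0 < y i} y :: ennreal"
  \<comment> \<open>This is card I + 1. Rescaling the coordinates in \<open>J\<close> uses up card J
    powers of T, and the remaining 1/T^2 is the derivative of 1 - 1/T.\<close>
  define N where "N = card J + 2"
  define F where "F y T = K ((\<lambda>i\<in>J. y i / T)(k := (T - 1 - ?s y) / T)) * (ennreal (1 / T ^ N) *
     (?pos y * indicator {T. 0 < T - 1 - ?s y} T))" for y T
  define L where "L r T = K (r(k := 1 - 1 / T - ?s r)) * (ennreal (1 / T\<^sup>2) *
     (?pos r * indicator {T. 1 < T \<and> 0 < 1 - 1 / T - ?s r} T))" for r T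
  have comp[measurable]: "(\<lambda>w. fst w j) \<in> borel_measurable (lborel_Pi J \<Otimes>\<^sub>M lborel)" if "j \<in> J" for j
    using that by (intro measurable_compose[OF measurable_fst] measurable_component_compose) auto
  have [measurable]: "?s \<in> borel_measurable (lborel_Pi J)"
    by (intro borel_measurable_sum measurable_component_compose) auto
  have [measurable]: "Measurable.pred (lborel_Pi J) (\<lambda>y. \<forall>j\<in>J. 0 < y j)"
    using J by (intro measurable_ball_pos) auto
  have [measurable]: "(\<lambda>w. \<lambda>i\<in>J. fst w i / snd w) \<in> measurable (lborel_Pi J \<Otimes>\<^sub>M lborel) (lborel_Pi J)"
  proof (rule measurable_restrict)
    fix j assume j: "j \<in> J"
    note comp[OF j, measurable]
    show "(\<lambda>w. fst w j / snd w) \<in> measurable (lborel_Pi J \<Otimes>\<^sub>M lborel) lborel" by measurable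
  qed
  have F[measurable]: "(\<lambda>w. F (fst w) (snd w)) \<in> borel_measurable (lborel_Pi J \<Otimes>\<^sub>M lborel)"
    unfolding F_def by measurable
  have L[measurable]: "(\<lambda>w. L (fst w) (snd w)) \<in> borel_measurable (lborel_Pi J \<Otimes>\<^sub>M lborel)"
    unfolding L_def by measurable
  have Fy: "F y \<in> borel_measurable borel" if "y \<in> space (lborel_Pi J)" for y
    using measurable_compose[OF measurable_Pair1'[OF that, of lborel] F] by simp
  have FT: "(\<lambda>y. F y T) \<in> borel_measurable (lborel_Pi J)" for T
    using measurable_compose[OF measurable_Pair1'[of T lborel "lborel_Pi J"] measurable_compose[OF measurable_pair_swap' F]]
    by simp
  interpret pair_sigma_finite "lborel_Pi J" lborel
    using sigma_finite_lborel_Pi[OF J(1)] by (simp add: pair_sigma_finite_def sigma_finite_lborel)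
  have spos: "0 \<le> ?s y" if "\<forall>i\<in>J. 0 < y i" for y
    using that by (intro sum_nonneg) (auto intro: less_imp_le)

  let ?G = "\<lambda>p. K (\<lambda>i\<in>insert k J. p i / (1 + (\<Sum>i\<in>insert k J. p i))) * (ennreal (1 / (1 + (\<Sum>i\<in>insert k J. p i)) ^ N) *
        indicator {p. \<forall>i\<in>insert k J. 0 < p i} p)"
  have Gm: "?G \<in> borel_measurable (lborel_Pi (insert k J))"
  proof -
    have [measurable]: "(\<lambda>p. \<Sum>i\<in>insert k J. p i) \<in> borel_measurable (lborel_Pi (insert k J))"
      by (intro borel_measurable_sum measurable_component_compose) auto
    have [measurable]: "(\<lambda>p. \<lambda>i\<in>insert k J. p i / (1 + (\<Sum>i\<in>insert k J. p i))) \<in> measurable (lborel_Pi (insert k J)) (lborel_Pi (insert k J))"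
    proof (rule measurable_restrict)
      fix j assume j: "j \<in> insert k J"
      have [measurable]: "(\<lambda>p. p j) \<in> borel_measurable (lborel_Pi (insert k J))"
        using j by (intro measurable_component_compose) auto
      show "(\<lambda>p. p j / (1 + (\<Sum>i\<in>insert k J. p i))) \<in> measurable (lborel_Pi (insert k J)) lborel" by measurable
    qed
    have [measurable]: "Measurable.pred (lborel_Pi (insert k J)) (\<lambda>y. \<forall>j\<in>insert k J. 0 < y j)"
      using J by (intro measurable_ball_pos) auto
    show ?thesis by measurable
  qed
  have G_F: "?G (y(k := x)) = F y (x + (1 + ?s y))" for y x
  proof -
    have s: "(\<Sum>i\<in>insert k J. (y(k := x)) i) = x + ?s y"
      using J by (subst sum.insert) (auto intro!: sum.cong)
    have "(\<lambda>i\<in>insert k J. (y(k := x)) i / (1 + (x + ?s y))) = (\<lambda>i\<in>J. y i / (x + (1 + ?s y)))(k := x / (x + (1 + ?s y)))"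
      using J(2) by (auto simp: fun_eq_iff add_ac)
    moreover have "(\<forall>i\<in>insert k J. 0 < (y(k := x)) i) \<longleftrightarrow> (\<forall>i\<in>J. 0 < y i) \<and> 0 < x"
      using J(2) by auto
    ultimately show ?thesis
      unfolding F_def s by (simp add: indicator_def add_ac)
  qed
  have "(\<integral>\<^sup>+p. ?G p \<partial>lborel_Pi (insert k J)) = (\<integral>\<^sup>+y. \<integral>\<^sup>+x. F y (x + (1 + ?s y)) \<partial>lborel \<partial>lborel_Pi J)"
    unfolding lborel_prod.product_nn_integral_insert[OF J(1,2) Gm] G_F ..
  also have "\<dots> = (\<integral>\<^sup>+y. \<integral>\<^sup>+T. F y T \<partial>lborel \<partial>lborel_Pi J)"
  proof (rule nn_integral_cong)
    fix y assume "y \<in> space (lborel_Pi J)"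
    from nn_integral_real_affine[OF Fy[OF this], of 1 "1 + ?s y"]
    show "(\<integral>\<^sup>+x. F y (x + (1 + ?s y)) \<partial>lborel) = (\<integral>\<^sup>+T. F y T \<partial>lborel)"
      by (simp add: add_ac)
  qed
  also have "\<dots> = (\<integral>\<^sup>+T. \<integral>\<^sup>+y. F y T \<partial>lborel_Pi J \<partial>lborel)"
    using F by (intro Fubini'[symmetric]) (simp add: case_prod_beta')
  also have "\<dots> = (\<integral>\<^sup>+T. \<integral>\<^sup>+r. L r T \<partial>lborel_Pi J \<partial>lborel)"
  proof (rule nn_integral_cong)
    fix T :: real
    show "(\<integral>\<^sup>+y. F y T \<partial>lborel_Pi J) = (\<integral>\<^sup>+r. L r T \<partial>lborel_Pi J)"
    proof (cases "1 < T")
      case False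
      \<comment> \<open>Positive coordinates force T > 1, so both integrands vanish for T \<le>
        1.\<close>
      then have "F y T = 0" "L y T = 0" for y
        using spos[of y] by (auto simp: F_def L_def indicator_def)
      then show ?thesis by simp
    next
      case T: True
      have im: "(\<lambda>r. T * r) ` UNIV = UNIV" using T by (auto intro!: image_eqI[of _ _ "x / T" for x])
      have "(\<integral>\<^sup>+y. F y T \<partial>lborel_Pi J) = (\<integral>\<^sup>+y. F y T * (\<Prod>i\<in>J. indicator ((\<lambda>r. T * r) ` UNIV) (y i)) \<partial>lborel_Pi J)"
        using T by (simp add: im)
      also have "\<dots> = (\<integral>\<^sup>+r. F (\<lambda>i\<in>J. T * r i) T * (\<Prod>i\<in>J. ennreal \<bar>T\<bar> * indicator UNIV (r i)) \<partial>lborel_Pi J)"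
        using T J(1) FT im
        by (intro nn_integral_PiM_substitution[symmetric, where g="\<lambda>_ r. T * r" and g'="\<lambda>_ _. T" and S="\<lambda>_. UNIV"])
           (auto intro!: derivative_eq_intros inj_onI)
      also have "\<dots> = (\<integral>\<^sup>+r. L r T \<partial>lborel_Pi J)"
      proof (rule nn_integral_cong)
        fix r assume r: "r \<in> space (lborel_Pi J)"
        have s: "?s (\<lambda>i\<in>J. T * r i) = T * ?s r" by (simp add: sum_distrib_left)
        have 1: "(\<lambda>i\<in>J. (\<lambda>i\<in>J. T * r i) i / T) = r"
          using r T by (auto simp: fun_eq_iff space_PiM PiE_def extensional_def)
        have 2: "(T - 1 - T * ?s r) / T = 1 - 1 / T - ?s r" using T by (simp add: field_simps)
        have 3: "0 < T - 1 - T * ?s r \<longleftrightarrow> 0 < 1 - 1 / T - ?s r"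
          unfolding 2[symmetric] using T by (simp add: zero_less_divide_iff)
        have 4: "(\<forall>i\<in>J. 0 < (\<lambda>i\<in>J. T * r i) i) \<longleftrightarrow> (\<forall>i\<in>J. 0 < r i)" using T by (auto simp: zero_less_mult_iff)
        have "ennreal (1 / T ^ N) * (\<Prod>i\<in>J. ennreal \<bar>T\<bar> * indicator UNIV (r i)) = ennreal (1 / T ^ N * T ^ card J)"
          using T by (simp add: ennreal_mult[symmetric] ennreal_power)
        also have "1 / T ^ N * T ^ card J = 1 / T\<^sup>2"
          using T by (simp add: N_def power_add power2_eq_square)
        finally have 5: "ennreal (1 / T ^ N) * (\<Prod>i\<in>J. ennreal \<bar>T\<bar> * indicator UNIV (r i)) = ennreal (1 / T\<^sup>2)" .
        show "F (\<lambda>i\<in>J. T * r i) T * (\<Prod>i\<in>J. ennreal \<bar>T\<bar> * indicator UNIV (r i)) = L r T"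
          unfolding F_def L_def s 1 2 5[symmetric] indicator_def mem_Collect_eq 3 4 using T by (simp add: mult_ac)
      qed
      finally show ?thesis .
    qed
  qed
  also have "\<dots> = (\<integral>\<^sup>+r. \<integral>\<^sup>+T. L r T \<partial>lborel \<partial>lborel_Pi J)"
    using L by (intro Fubini') (simp add: case_prod_beta')
  also have "\<dots> = (\<integral>\<^sup>+r. \<integral>\<^sup>+q. K (r(k := q)) * (indicator {q. 0 < q \<and> q + ?s r < 1} q * ?pos r) \<partial>lborel \<partial>lborel_Pi J)"
  proof (rule nn_integral_cong)
    fix r assume r: "r \<in> space (lborel_Pi J)"
    show "(\<integral>\<^sup>+T. L r T \<partial>lborel) = (\<integral>\<^sup>+q. K (r(k := q)) * (indicator {q. 0 < q \<and> q + ?s r < 1} q * ?pos r) \<partial>lborel)"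
    proof (cases "\<forall>i\<in>J. 0 < r i")
      case False
      then show ?thesis by (simp add: L_def)
    next
      case True
      let ?S = "{T. 1 < T \<and> 0 < 1 - 1 / T - ?s r}" and ?g = "\<lambda>T. 1 - 1 / T - ?s r"
      have Kr: "(\<lambda>q. K (r(k := q))) \<in> borel_measurable borel"
        using measurable_fun_upd_section[OF K' r J(2)] by simp
      have im: "?g ` ?S = {q. 0 < q \<and> q + ?s r < 1}"
      proof (intro equalityI subsetI)
        fix q assume q: "q \<in> {q. 0 < q \<and> q + ?s r < 1}"
        then have "?g (1 / (1 - q - ?s r)) = q" "1 < 1 / (1 - q - ?s r)"
          using spos[OF True] by auto
        then show "q \<in> ?g ` ?S" using q by (intro image_eqI[of _ _ "1 / (1 - q - ?s r)"]) auto
      qed auto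
      have "(\<integral>\<^sup>+T. L r T \<partial>lborel) = (\<integral>\<^sup>+T. K (r(k := ?g T)) * (ennreal \<bar>1 / T\<^sup>2\<bar> * indicator ?S T) \<partial>lborel)"
        using True by (intro nn_integral_cong) (simp add: L_def)
      also have "\<dots> = (\<integral>\<^sup>+q. K (r(k := q)) * indicator (?g ` ?S) q \<partial>lborel)"
      proof (rule nn_integral_substitution_inj)
        show "?g ` ?S \<in> sets borel" unfolding im by measurable
        show "(?g has_field_derivative 1 / T\<^sup>2) (at T)" if "T \<in> ?S" for T
          using that by (auto intro!: derivative_eq_intros simp: power2_eq_square)
        show "inj_on ?g ?S" by (auto intro!: inj_onI)
      qed (use Kr in auto)
      finally show ?thesis using True im by simp
    qed
  qed
  also have "\<dots> = (\<integral>\<^sup>+q. K q * indicator {q. (\<forall>i\<in>insert k J. 0 < q i) \<and> (\<Sum>i\<in>insert k J. q i) < 1} q \<partial>lborel_Pi (insert k J))"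
  proof -
    have [measurable]: "(\<lambda>p. \<Sum>i\<in>insert k J. p i) \<in> borel_measurable (lborel_Pi (insert k J))"
      by (intro borel_measurable_sum measurable_component_compose) auto
    have [measurable]: "Measurable.pred (lborel_Pi (insert k J)) (\<lambda>y. \<forall>j\<in>insert k J. 0 < y j)"
      using J by (intro measurable_ball_pos) auto
    have meas: "(\<lambda>q. K q * indicator {q. (\<forall>i\<in>insert k J. 0 < q i) \<and> (\<Sum>i\<in>insert k J. q i) < 1} q) \<in> borel_measurable (lborel_Pi (insert k J))"
      by measurable
    have s: "(\<Sum>i\<in>insert k J. (r(k := q)) i) = q + ?s r" for r q
      using J by (subst sum.insert) (auto intro!: sum.cong)
    have p: "(\<forall>i\<in>insert k J. 0 < (r(k := q)) i) \<longleftrightarrow> 0 < q \<and> (\<forall>i\<in>J. 0 < r i)" for r :: "nat \<Rightarrow> real" and q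
      using J(2) by auto
    have "indicator {q. (\<forall>i\<in>insert k J. 0 < q i) \<and> (\<Sum>i\<in>insert k J. q i) < 1} (r(k := q))
       = indicator {q. 0 < q \<and> q + ?s r < 1} q * ?pos r" for r and q :: real
      unfolding indicator_def mem_Collect_eq s p by auto
    then show ?thesis
      unfolding lborel_prod.product_nn_integral_insert[OF J(1,2) meas] by simp
  qed
  finally show ?thesis unfolding IJ(1) using J by (simp add: N_def)
qed

text \<open>Equals 1/q_n: each summand w_j/(1 + b_j^2) is q_j/q_n, and the weights sum to 1.\<close>

definition mass_total :: "(nat \<Rightarrow> real) \<Rightarrow> nat set \<Rightarrow> (nat \<Rightarrow> real) \<Rightarrow> real" where
  "mass_total b I y = 1 + (\<Sum>j\<in>I. y j / (1 + (b j)\<^sup>2))"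

definition mass :: "(nat \<Rightarrow> real) \<Rightarrow> nat set \<Rightarrow> (nat \<Rightarrow> real) \<Rightarrow> nat \<Rightarrow> real" where
  "mass b I y j = y j / (1 + (b j)\<^sup>2) / mass_total b I y"

text \<open>The relation between e, the weights and cot(\<phi>/2), solved for cot(\<phi>/2); here
  1/\<open>mass_total\<close> stands for q_n and \<open>y n\<close> for e.\<close>

definition phase_cot :: "(nat \<Rightarrow> real) \<Rightarrow> nat \<Rightarrow> nat set \<Rightarrow> (nat \<Rightarrow> real) \<Rightarrow> real" where
  "phase_cot b n I y = (\<Sum>j\<in>I. mass b I y j * b j) - y n / mass_total b I y"

text \<open>Index \<open>n\<close> carries the phase, not the last mass, which is determined by the others.\<close>

definition mass_phase :: "(nat \<Rightarrow> real) \<Rightarrow> nat \<Rightarrow> nat set \<Rightarrow> (nat \<Rightarrow> real) \<Rightarrow> nat \<Rightarrow> real" where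
  "mass_phase b n I y = (\<lambda>j\<in>I. mass b I y j)(n := pi - 2 * arctan (phase_cot b n I y))"

text \<open>One factor for each substitution: normalising to total mass 1, scaling w_j by 1/(1 +
  b_j^2), and the derivative of \<phi> in the constant term \<open>y n\<close>.\<close>

definition mass_phase_jac :: "(nat \<Rightarrow> real) \<Rightarrow> nat \<Rightarrow> nat set \<Rightarrow> (nat \<Rightarrow> real) \<Rightarrow> real" where
  "mass_phase_jac b n I y = 1 / mass_total b I y ^ (card I + 1) * (\<Prod>j\<in>I. 1 / (1 + (b j)\<^sup>2))
     * (2 / mass_total b I y / (1 + (phase_cot b n I y)\<^sup>2))"

lemma one_plus_square_pos: "0 < 1 + (x::real)\<^sup>2"
  by (simp add: add_pos_nonneg)

lemma zero_less_divide_one_plus_square: "0 < x / (1 + (c::real)\<^sup>2) \<longleftrightarrow> 0 < x"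
  using one_plus_square_pos[of c] by (auto simp: zero_less_divide_iff)

lemma mass_total_pos: "(\<And>j. j \<in> I \<Longrightarrow> 0 < y j) \<Longrightarrow> 0 < mass_total b I y"
  unfolding mass_total_def by (intro add_pos_nonneg sum_nonneg divide_nonneg_nonneg) (auto intro: less_imp_le)

lemma measurable_mass_total: "I \<subseteq> J \<Longrightarrow> mass_total b I \<in> borel_measurable (lborel_Pi J)"
  unfolding mass_total_def[abs_def]
proof (intro borel_measurable_add borel_measurable_sum borel_measurable_const)
  fix j assume "I \<subseteq> J" "j \<in> I"
  then show "(\<lambda>y. y j / (1 + (b j)\<^sup>2)) \<in> borel_measurable (lborel_Pi J)"
    by (intro measurable_component_compose[of "\<lambda>r. r / (1 + (b j)\<^sup>2)"]) auto
qed

lemma measurable_mass: "I \<subseteq> J \<Longrightarrow> j \<in> J \<Longrightarrow> (\<lambda>y. mass b I y j) \<in> borel_measurable (lborel_Pi J)"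
  unfolding mass_def
  by (intro borel_measurable_divide measurable_mass_total measurable_component_compose) auto

lemma measurable_phase_cot: "phase_cot b n I \<in> borel_measurable (lborel_Pi (insert n I))"
  unfolding phase_cot_def[abs_def]
  by (intro borel_measurable_diff borel_measurable_sum borel_measurable_times borel_measurable_divide
    measurable_mass measurable_mass_total measurable_component_compose) auto

lemma measurable_mass_phase: "mass_phase b n I \<in> measurable (lborel_Pi (insert n I)) (lborel_Pi (insert n I))"
proof -
  have 1: "(\<lambda>y. \<lambda>j\<in>I. mass b I y j) \<in> measurable (lborel_Pi (insert n I)) (lborel_Pi I)"
    using measurable_mass[of I "insert n I" _ b] by (intro measurable_restrict) auto
  have 2: "(\<lambda>y. pi - 2 * arctan (phase_cot b n I y)) \<in> measurable (lborel_Pi (insert n I)) lborel"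
    using measurable_phase_cot[of b n I] by simp
  show ?thesis
    using measurable_compose[OF measurable_Pair[OF 1 2] measurable_fun_upd_lborel_Pi[of n I]]
    by (simp add: mass_phase_def[abs_def])
qed

lemma measurable_mass_phase_jac: "mass_phase_jac b n I \<in> borel_measurable (lborel_Pi (insert n I))"
proof -
  note [measurable] = measurable_phase_cot[of b n I]
  have [measurable]: "mass_total b I \<in> borel_measurable (lborel_Pi (insert n I))"
    by (intro measurable_mass_total) auto
  show ?thesis unfolding mass_phase_jac_def[abs_def] by measurable
qed

text \<open>pi - 2 arctan maps the line onto the interval (0, 2 pi) and thus picks the branch of the
  angle whose half has the given cotangent.\<close>

lemma nn_integral_arctan_substitution:
  assumes f: "f \<in> borel_measurable borel" and T: "0 < T"
  shows "(\<integral>\<^sup>+e. f (pi - 2 * arctan (s - e / T)) * ennreal (2 / T / (1 + (s - e / T)\<^sup>2)) \<partial>lborel)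
    = (\<integral>\<^sup>+x. f x * indicator {0<..<2 * pi} x \<partial>lborel)"
proof -
  let ?g = "\<lambda>e. pi - 2 * arctan (s - e / T)" and ?g' = "\<lambda>e. 2 / T / (1 + (s - e / T)\<^sup>2)"
  have im: "range ?g = {0<..<2 * pi}"
  proof (intro equalityI subsetI)
    fix x assume "x \<in> range ?g"
    then obtain e where "x = ?g e" by auto
    then show "x \<in> {0<..<2 * pi}" using arctan_bounded[of "s - e / T"] by auto
  next
    fix x assume "x \<in> {0<..<2 * pi}"
    then have "arctan (tan ((pi - x) / 2)) = (pi - x) / 2" by (intro arctan_tan) auto
    then have "x = ?g ((s - tan ((pi - x) / 2)) * T)" using T by simp
    then show "x \<in> range ?g" by blast
  qed
  have "(\<integral>\<^sup>+e. f (?g e) * ennreal (?g' e) \<partial>lborel) = (\<integral>\<^sup>+e. f (?g e) * (ennreal \<bar>?g' e\<bar> * indicator UNIV e) \<partial>lborel)"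
    using T one_plus_square_pos by (intro nn_integral_cong) (simp add: abs_of_pos add_pos_nonneg)
  also have "\<dots> = (\<integral>\<^sup>+x. f x * indicator (range ?g) x \<partial>lborel)"
  proof (rule nn_integral_substitution_inj)
    show "range ?g \<in> sets borel" unfolding im by simp
    show "(?g has_field_derivative ?g' e) (at e)" for e
      using T by (auto intro!: derivative_eq_intros simp: divide_simps)
    show "inj ?g" using T by (auto intro!: injI simp: arctan_eq_iff)
  qed (use f in auto)
  finally show ?thesis unfolding im .
qed

text \<open>The map is triangular: the masses and their total do not involve coordinate
  \<open>n\<close>. So the phase is substituted first with the masses fixed, and the masses are then
  scaled and normalised.\<close>

lemma nn_integral_mass_phase:
  assumes I: "finite I" "n \<notin> I" and g[measurable]: "g \<in> borel_measurable (lborel_Pi (insert n I))"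
  shows "(\<integral>\<^sup>+y. g (mass_phase b n I y) * (ennreal (mass_phase_jac b n I y) * indicator {y. \<forall>j\<in>I. 0 < y j} y) \<partial>lborel_Pi (insert n I))
    = (\<integral>\<^sup>+q. (\<integral>\<^sup>+x. g (q(n := x)) * indicator {0<..<2 * pi} x \<partial>lborel)
        * indicator {q. (\<forall>i\<in>I. 0 < q i) \<and> (\<Sum>i\<in>I. q i) < 1} q \<partial>lborel_Pi I)"
proof -
  define M where "M q = (\<integral>\<^sup>+x. g (q(n := x)) * indicator {0<..<2 * pi} x \<partial>lborel)" for q
  have M[measurable]: "M \<in> borel_measurable (lborel_Pi I)" unfolding M_def[abs_def] by measurable
  let ?pos = "\<lambda>y. indicator {y. \<forall>i\<in>I. 0 < y i} y :: ennreal"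
  define f where "f p = M (\<lambda>i\<in>I. p i / (1 + (\<Sum>i\<in>I. p i))) * (ennreal (1 / (1 + (\<Sum>i\<in>I. p i)) ^ (card I + 1)) * ?pos p)" for p
  have [measurable]: "(\<lambda>p. \<Sum>i\<in>I. p i) \<in> borel_measurable (lborel_Pi I)"
    by (intro borel_measurable_sum measurable_component_compose) auto
  have [measurable]: "(\<lambda>p. \<lambda>i\<in>I. p i / (1 + (\<Sum>i\<in>I. p i))) \<in> measurable (lborel_Pi I) (lborel_Pi I)"
  proof (rule measurable_restrict)
    fix j assume j: "j \<in> I"
    have [measurable]: "(\<lambda>p. p j) \<in> borel_measurable (lborel_Pi I)"
      using j by (intro measurable_component_compose) auto
    show "(\<lambda>p. p j / (1 + (\<Sum>i\<in>I. p i))) \<in> measurable (lborel_Pi I) lborel" by measurable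
  qed
  have [measurable]: "Measurable.pred (lborel_Pi I) (\<lambda>y. \<forall>j\<in>I. 0 < y j)"
    "Measurable.pred (lborel_Pi (insert n I)) (\<lambda>y. \<forall>j\<in>I. 0 < y j)"
    using I by (auto intro!: measurable_ball_pos)
  have f: "f \<in> borel_measurable (lborel_Pi I)" unfolding f_def[abs_def] by measurable
  let ?H = "\<lambda>y. g (mass_phase b n I y) * (ennreal (mass_phase_jac b n I y) * ?pos y)"
  note [measurable] = measurable_mass_phase[of b n I] measurable_mass_phase_jac[of b n I]
  have H: "?H \<in> borel_measurable (lborel_Pi (insert n I))" by measurable
  have inner: "(\<integral>\<^sup>+e. ?H (w(n := e)) \<partial>lborel) = f (\<lambda>i\<in>I. w i / (1 + (b i)\<^sup>2)) * (\<Prod>i\<in>I. ennreal \<bar>1 / (1 + (b i)\<^sup>2)\<bar> * indicator UNIV (w i))"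
    if w: "w \<in> space (lborel_Pi I)" for w
  proof (cases "\<forall>j\<in>I. 0 < w j")
    case False
    then have "\<not> (\<forall>j\<in>I. 0 < (w(n := e)) j)" for e using I(2) by auto
    then have 1: "?pos (w(n := e)) = 0" for e by (intro indicator_simps(2)) simp
    have "\<not> (\<forall>j\<in>I. 0 < (\<lambda>i\<in>I. w i / (1 + (b i)\<^sup>2)) j)"
      using False by (auto simp: zero_less_divide_one_plus_square)
    then have 2: "?pos (\<lambda>i\<in>I. w i / (1 + (b i)\<^sup>2)) = 0" by (intro indicator_simps(2)) simp
    show ?thesis unfolding f_def 1 2 by simp
  next
    case True
    let ?T = "mass_total b I w" and ?q = "\<lambda>i\<in>I. mass b I w i"
    let ?s = "\<Sum>j\<in>I. mass b I w j * b j"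
    have T: "0 < ?T" using True by (intro mass_total_pos) auto
    have tot: "mass_total b I (w(n := e)) = ?T" for e
      using I(2) unfolding mass_total_def by (auto intro!: arg_cong2[where f="(+)"] sum.cong)
    have ms: "mass b I (w(n := e)) j = mass b I w j" if "j \<in> I" for j e
      using that I(2) by (auto simp: mass_def tot)
    have pc: "phase_cot b n I (w(n := e)) = ?s - e / ?T" for e
      unfolding phase_cot_def tot by (simp add: ms)
    have mp: "mass_phase b n I (w(n := e)) = ?q(n := pi - 2 * arctan (?s - e / ?T))" for e
      unfolding mass_phase_def pc by (auto simp: fun_eq_iff ms)
    define c where "c = 1 / ?T ^ (card I + 1) * (\<Prod>j\<in>I. 1 / (1 + (b j)\<^sup>2))"
    have c: "0 \<le> c" unfolding c_def using T one_plus_square_pos by (intro mult_nonneg_nonneg prod_nonneg) (auto intro: less_imp_le)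
    have jac: "ennreal (mass_phase_jac b n I (w(n := e))) = ennreal c * ennreal (2 / ?T / (1 + (?s - e / ?T)\<^sup>2))" for e
      unfolding mass_phase_jac_def tot pc c_def[symmetric] using c by (intro ennreal_mult')
    have pos: "(\<forall>j\<in>I. 0 < (w(n := e)) j)" for e using True I(2) by auto
    have sp: "?q \<in> space (lborel_Pi I)" by (simp add: space_PiM)
    have gq: "(\<lambda>x. g (?q(n := x))) \<in> borel_measurable borel"
      using measurable_fun_upd_section[OF g sp I(2)] by simp
    have gq': "(\<lambda>e. g (?q(n := pi - 2 * arctan (?s - e / ?T))) * ennreal (2 / ?T / (1 + (?s - e / ?T)\<^sup>2))) \<in> borel_measurable lborel"
      by (intro borel_measurable_times_ennreal measurable_compose[OF _ gq]) measurable
    have "(\<integral>\<^sup>+e. ?H (w(n := e)) \<partial>lborel)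
      = (\<integral>\<^sup>+e. ennreal c * (g (?q(n := pi - 2 * arctan (?s - e / ?T))) * ennreal (2 / ?T / (1 + (?s - e / ?T)\<^sup>2))) \<partial>lborel)"
      unfolding mp jac using pos by (intro nn_integral_cong) (simp add: mult_ac)
    also have "\<dots> = ennreal c * (\<integral>\<^sup>+e. g (?q(n := pi - 2 * arctan (?s - e / ?T))) * ennreal (2 / ?T / (1 + (?s - e / ?T)\<^sup>2)) \<partial>lborel)"
      by (rule nn_integral_cmult[OF gq'])
    also have "(\<integral>\<^sup>+e. g (?q(n := pi - 2 * arctan (?s - e / ?T))) * ennreal (2 / ?T / (1 + (?s - e / ?T)\<^sup>2)) \<partial>lborel) = M ?q"
      unfolding M_def by (rule nn_integral_arctan_substitution[OF gq T])
    finally have E: "(\<integral>\<^sup>+e. ?H (w(n := e)) \<partial>lborel) = ennreal c * M ?q" .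
    have s: "1 + (\<Sum>i\<in>I. (\<lambda>i\<in>I. w i / (1 + (b i)\<^sup>2)) i) = ?T" by (simp add: mass_total_def)
    have q: "(\<lambda>i\<in>I. (\<lambda>i\<in>I. w i / (1 + (b i)\<^sup>2)) i / ?T) = ?q"
      by (auto simp: fun_eq_iff mass_def)
    have p: "\<forall>j\<in>I. 0 < (\<lambda>i\<in>I. w i / (1 + (b i)\<^sup>2)) j"
      using True one_plus_square_pos by auto
    have "(\<Prod>i\<in>I. ennreal \<bar>1 / (1 + (b i)\<^sup>2)\<bar> * indicator UNIV (w i)) = ennreal (\<Prod>i\<in>I. 1 / (1 + (b i)\<^sup>2))"
      using one_plus_square_pos by (simp add: prod_ennreal less_imp_le)
    then have "ennreal (1 / ?T ^ (card I + 1)) * (\<Prod>i\<in>I. ennreal \<bar>1 / (1 + (b i)\<^sup>2)\<bar> * indicator UNIV (w i)) = ennreal c"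
      unfolding c_def using T by (simp only:) (intro ennreal_mult'[symmetric], simp)
    then show ?thesis unfolding E f_def s q using p by (simp add: mult_ac)
  qed
  have "(\<integral>\<^sup>+y. ?H y \<partial>lborel_Pi (insert n I)) = (\<integral>\<^sup>+w. \<integral>\<^sup>+e. ?H (w(n := e)) \<partial>lborel \<partial>lborel_Pi I)"
    by (rule lborel_prod.product_nn_integral_insert[OF I H])
  also have "\<dots> = (\<integral>\<^sup>+w. f (\<lambda>i\<in>I. w i / (1 + (b i)\<^sup>2)) * (\<Prod>i\<in>I. ennreal \<bar>1 / (1 + (b i)\<^sup>2)\<bar> * indicator UNIV (w i)) \<partial>lborel_Pi I)"
    by (rule nn_integral_cong) (rule inner)
  also have "\<dots> = (\<integral>\<^sup>+p. f p * (\<Prod>i\<in>I. indicator (range (\<lambda>x. x / (1 + (b i)\<^sup>2))) (p i)) \<partial>lborel_Pi I)"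
  proof (rule nn_integral_PiM_substitution)
    fix i
    have nz: "1 + (b i)\<^sup>2 \<noteq> 0" using one_plus_square_pos[of "b i"] by linarith
    then have "range (\<lambda>x. x / (1 + (b i)\<^sup>2)) = UNIV"
      by (auto intro!: image_eqI[of _ _ "x * (1 + (b i)\<^sup>2)" for x])
    then show "range (\<lambda>x. x / (1 + (b i)\<^sup>2)) \<in> sets borel" by simp
    show "inj (\<lambda>x. x / (1 + (b i)\<^sup>2))" using nz by (auto intro!: injI)
    show "((\<lambda>x. x / (1 + (b i)\<^sup>2)) has_field_derivative 1 / (1 + (b i)\<^sup>2)) (at x)" for x
      using DERIV_cdivide[OF DERIV_ident] .
  qed (use I f in auto)
  also have "\<dots> = (\<integral>\<^sup>+p. f p \<partial>lborel_Pi I)"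
  proof -
    have "x \<in> range (\<lambda>x. x / (1 + (b i)\<^sup>2))" for x i
      using one_plus_square_pos[of "b i"] by (intro image_eqI[of _ _ "x * (1 + (b i)\<^sup>2)"]) auto
    then show ?thesis by simp
  qed
  also have "\<dots> = (\<integral>\<^sup>+q. M q * indicator {q. (\<forall>i\<in>I. 0 < q i) \<and> (\<Sum>i\<in>I. q i) < 1} q \<partial>lborel_Pi I)"
    unfolding f_def by (rule nn_integral_projective[OF I(1) M])
  finally show ?thesis unfolding M_def .
qed

subsection \<open>Angles and half-angle cotangents\<close>

lemma norm_cis_diff: "norm (cis a - cis b) = 2 * \<bar>sin ((a - b) / 2)\<bar>"
proof -
  have "(norm (cis a - cis b))\<^sup>2 = (cos a - cos b)\<^sup>2 + (sin a - sin b)\<^sup>2"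
    by (simp add: cmod_power2)
  also have "\<dots> = 2 - 2 * cos (a - b)"
    by (simp add: cos_diff power2_diff sin_squared_eq)
  also have "\<dots> = (2 * \<bar>sin ((a - b) / 2)\<bar>)\<^sup>2"
  proof -
    have "2 * ((a - b) / 2) = a - b" by simp
    then have "cos (a - b) = 1 - 2 * (sin ((a - b) / 2))\<^sup>2"
      using cos_double_sin[of "(a - b) / 2"] by (simp only:)
    then show ?thesis by (simp add: power_mult_distrib)
  qed
  finally show ?thesis by (rule power2_eq_imp_eq) auto
qed

lemma cot_diff_eq:
  fixes u v :: real
  assumes "sin u \<noteq> 0" "sin v \<noteq> 0"
  shows "cot u - cot v = sin (v - u) / (sin u * sin v)"
  using assms by (simp add: cot_def sin_diff field_simps)

lemma one_plus_cot_squared: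
  fixes u :: real
  assumes "sin u \<noteq> 0"
  shows "1 + (cot u)\<^sup>2 = 1 / (sin u)\<^sup>2"
proof -
  have "1 + (cot u)\<^sup>2 = ((sin u)\<^sup>2 + (cos u)\<^sup>2) / (sin u)\<^sup>2"
    using assms by (simp add: cot_def power_divide add_divide_distrib del: sin_cos_squared_add sin_cos_squared_add2)
  then show ?thesis by simp
qed

lemma sin_half_pos: "c - 2 * pi < s \<Longrightarrow> s < c \<Longrightarrow> 0 < sin ((c - s) / 2)"
  by (intro sin_gt_zero) auto

lemma cot_half_less_iff:
  assumes "c - 2 * pi < s" "s < c" "c - 2 * pi < t" "t < c"
  shows "cot ((c - s) / 2) < cot ((c - t) / 2) \<longleftrightarrow> s < t"
proof -
  have *: "cot ((c - s) / 2) < cot ((c - t) / 2)" if "c - 2 * pi < s" "s < t" "t < c" for s t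
  proof -
    have p: "0 < sin ((c - s) / 2)" "0 < sin ((c - t) / 2)" "0 < sin ((t - s) / 2)"
      using that by (auto intro!: sin_gt_zero)
    have "cot ((c - t) / 2) - cot ((c - s) / 2) = sin ((t - s) / 2) / (sin ((c - t) / 2) * sin ((c - s) / 2))"
      using p by (subst cot_diff_eq) (auto simp: diff_divide_distrib)
    then have "0 < cot ((c - t) / 2) - cot ((c - s) / 2)" using p by simp
    then show ?thesis by simp
  qed
  show ?thesis using *[of s t] *[of t s] assms by (cases s t rule: linorder_cases) auto
qed

lemma cot_half_image: "(\<lambda>s. cot ((c - s) / 2)) ` {c - 2 * pi<..<c} = (UNIV :: real set)"
proof (intro equalityI subsetI UNIV_I)
  fix x :: real
  have "cot ((c - (c - 2 * (pi / 2 - arctan x))) / 2) = cot (pi / 2 - arctan x)"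
    by (simp add: diff_divide_distrib)
  also have "\<dots> = x" using tan_cot'[of "pi / 2 - arctan x"] by (simp add: tan_arctan)
  finally show "x \<in> (\<lambda>s. cot ((c - s) / 2)) ` {c - 2 * pi<..<c}"
    using arctan_bounded[of x] by (intro image_eqI[of _ _ "c - 2 * (pi / 2 - arctan x)"]) auto
qed

lemma nn_integral_cot_half:
  assumes "finite I" "f \<in> borel_measurable (lborel_Pi I)"
  shows "(\<integral>\<^sup>+\<psi>. f (\<lambda>i\<in>I. cot ((c - \<psi> i) / 2)) *
      (\<Prod>i\<in>I. ennreal \<bar>1 / (2 * (sin ((c - \<psi> i) / 2))\<^sup>2)\<bar> * indicator {c - 2 * pi<..<c} (\<psi> i)) \<partial>lborel_Pi I)
    = (\<integral>\<^sup>+x. f x \<partial>lborel_Pi I)"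
proof -
  have "(\<integral>\<^sup>+\<psi>. f (\<lambda>i\<in>I. cot ((c - \<psi> i) / 2)) *
      (\<Prod>i\<in>I. ennreal \<bar>1 / (2 * (sin ((c - \<psi> i) / 2))\<^sup>2)\<bar> * indicator {c - 2 * pi<..<c} (\<psi> i)) \<partial>lborel_Pi I)
    = (\<integral>\<^sup>+x. f x * (\<Prod>i\<in>I. indicator ((\<lambda>s. cot ((c - s) / 2)) ` {c - 2 * pi<..<c}) (x i)) \<partial>lborel_Pi I)"
  proof (rule nn_integral_PiM_substitution)
    show "((\<lambda>s. cot ((c - s) / 2)) has_field_derivative 1 / (2 * (sin ((c - s) / 2))\<^sup>2)) (at s)"
      if "s \<in> {c - 2 * pi<..<c}" for s
    proof -
      have "sin ((c - s) / 2) \<noteq> 0" using sin_half_pos[of c s] that by simp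
      moreover have "((\<lambda>s. (c - s) / 2) has_field_derivative - (1 / 2)) (at s)"
        by (auto intro!: derivative_eq_intros)
      ultimately have "((\<lambda>s. cot ((c - s) / 2)) has_field_derivative - inverse ((sin ((c - s) / 2))\<^sup>2) * - (1 / 2)) (at s)"
        by (intro DERIV_chain2[OF DERIV_cot])
      then show ?thesis by (simp add: inverse_eq_divide mult.commute)
    qed
    show "inj_on (\<lambda>s. cot ((c - s) / 2)) {c - 2 * pi<..<c}"
    proof (rule inj_onI)
      fix s t assume "s \<in> {c - 2 * pi<..<c}" "t \<in> {c - 2 * pi<..<c}" "cot ((c - s) / 2) = cot ((c - t) / 2)"
      then show "s = t" using cot_half_less_iff[of c s t] cot_half_less_iff[of c t s]
        by (cases s t rule: linorder_cases) auto
    qed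
    show "(\<lambda>s. cot ((c - s) / 2)) \<in> borel_measurable borel" unfolding cot_def by measurable
  qed (use assms cot_half_image in auto)
  then show ?thesis by (simp add: cot_half_image)
qed

text \<open>Chains three substitutions: angles to cotangents, cotangents to coefficients,
  coefficients to weights and phase. Later \<open>c\<close> is \<open>\<theta> n\<close>, and
  \<open>g\<close> is the density of the parameters restricted to an event about the zeros.\<close>

lemma nn_integral_roots:
  fixes b :: "nat \<Rightarrow> real" and c :: real
  assumes n: "1 \<le> n" and b: "strict_mono_on {1..<n} b" and g[measurable]: "g \<in> borel_measurable (lborel_Pi {1..n})"
  defines "X \<equiv> \<lambda>\<psi>. \<lambda>i\<in>{1..n}. cot ((c - \<psi> i) / 2)"
  defines "Y \<equiv> \<lambda>\<psi>. pf_coeff b n 1 (X \<psi>)"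
  shows "(\<integral>\<^sup>+\<psi>. g (mass_phase b n {1..<n} (Y \<psi>)) * ennreal (mass_phase_jac b n {1..<n} (Y \<psi>)) *
        (ennreal (vandermonde {1..n} (X \<psi>)) * indicator {x. interlaced b n 1 x} (X \<psi>)) *
        (\<Prod>i\<in>{1..n}. ennreal \<bar>1 / (2 * (sin ((c - \<psi> i) / 2))\<^sup>2)\<bar> * indicator {c - 2 * pi<..<c} (\<psi> i)) \<partial>lborel_Pi {1..n})
    = ennreal (vandermonde {1..<n} b) * (\<integral>\<^sup>+q. (\<integral>\<^sup>+x. g (q(n := x)) * indicator {0<..<2 * pi} x \<partial>lborel)
        * indicator {q. (\<forall>i\<in>{1..<n}. 0 < q i) \<and> (\<Sum>i\<in>{1..<n}. q i) < 1} q \<partial>lborel_Pi {1..<n})"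
proof -
  have I: "insert n {1..<n} = {1..n}" "n \<notin> {1..<n}" "finite {1..<n}" using n by auto
  define h where "h y = g (mass_phase b n {1..<n} y) * ennreal (mass_phase_jac b n {1..<n} y)" for y
  note [measurable] = measurable_mass_phase[of b n "{1..<n}", unfolded I] measurable_mass_phase_jac[of b n "{1..<n}", unfolded I]
    measurable_interlaced[OF n] measurable_pf_coeff[OF n]
  have [measurable]: "vandermonde {1..n} \<in> borel_measurable (lborel_Pi {1..n})"
    by (intro measurable_vandermonde) auto
  have h[measurable]: "h \<in> borel_measurable (lborel_Pi {1..n})" unfolding h_def by measurable
  have m: "(\<lambda>x. h (pf_coeff b n 1 x) * (ennreal (vandermonde {1..n} x) * indicator {x. interlaced b n 1 x} x)) \<in> borel_measurable (lborel_Pi {1..n})"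
    by measurable
  have "(\<integral>\<^sup>+\<psi>. h (Y \<psi>) * (ennreal (vandermonde {1..n} (X \<psi>)) * indicator {x. interlaced b n 1 x} (X \<psi>)) *
        (\<Prod>i\<in>{1..n}. ennreal \<bar>1 / (2 * (sin ((c - \<psi> i) / 2))\<^sup>2)\<bar> * indicator {c - 2 * pi<..<c} (\<psi> i)) \<partial>lborel_Pi {1..n})
    = (\<integral>\<^sup>+x. h (pf_coeff b n 1 x) * (ennreal (vandermonde {1..n} x) * indicator {x. interlaced b n 1 x} x) \<partial>lborel_Pi {1..n})"
    unfolding X_def Y_def by (rule nn_integral_cot_half[OF _ m]) simp
  also have "\<dots> = ennreal (vandermonde {1..<n} b) * (\<integral>\<^sup>+y. h y * indicator {y. \<forall>j\<in>{1..<n}. 0 < y j} y \<partial>lborel_Pi {1..n})"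
    by (rule nn_integral_interlaced[OF n b h])
  also have "(\<integral>\<^sup>+y. h y * indicator {y. \<forall>j\<in>{1..<n}. 0 < y j} y \<partial>lborel_Pi {1..n}) =
     (\<integral>\<^sup>+q. (\<integral>\<^sup>+x. g (q(n := x)) * indicator {0<..<2 * pi} x \<partial>lborel)
        * indicator {q. (\<forall>i\<in>{1..<n}. 0 < q i) \<and> (\<Sum>i\<in>{1..<n}. q i) < 1} q \<partial>lborel_Pi {1..<n})"
    using nn_integral_mass_phase[of "{1..<n}" n g b] g I by (simp add: h_def mult.assoc)
  finally show ?thesis unfolding h_def .
qed

section \<open>Products over pairs of indices\<close>

definition pairprod :: "nat set \<Rightarrow> (nat \<Rightarrow> nat \<Rightarrow> real) \<Rightarrow> real" where
  "pairprod I f = (\<Prod>m\<in>I. \<Prod>l\<in>{l\<in>I. l < m}. f l m)"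

lemma pairprod_insert:
  assumes "finite I" "\<forall>i\<in>I. i < k"
  shows "pairprod (insert k I) f = (\<Prod>l\<in>I. f l k) * pairprod I f"
proof -
  have k: "k \<notin> I" using assms(2) by blast
  have "{l \<in> insert k I. l < k} = I" using assms by auto
  moreover have "{l \<in> insert k I. l < m} = {l \<in> I. l < m}" if "m \<in> I" for m
    using assms(2) that by auto
  ultimately show ?thesis using k assms(1) unfolding pairprod_def by simp
qed

lemma pairprod_mult: "pairprod I (\<lambda>l m. f l m * g l m) = pairprod I f * pairprod I g"
  unfolding pairprod_def by (simp add: prod.distrib)

lemma pairprod_cong: "(\<And>l m. l \<in> I \<Longrightarrow> m \<in> I \<Longrightarrow> l < m \<Longrightarrow> f l m = g l m) \<Longrightarrow> pairprod I f = pairprod I g"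
  unfolding pairprod_def by (intro prod.cong) auto

lemma pairprod_pos: "(\<And>l m. l \<in> I \<Longrightarrow> m \<in> I \<Longrightarrow> l < m \<Longrightarrow> 0 < f l m) \<Longrightarrow> 0 < pairprod I f"
  unfolding pairprod_def by (intro prod_pos) auto

text \<open>Regroups the pairs by their larger index, the arrangement used in
  \<open>zero_density\<close>.\<close>

lemma vandermonde_eq_pairprod: "finite I \<Longrightarrow> vandermonde I x = pairprod I (\<lambda>l m. \<bar>x m - x l\<bar>)"
  unfolding vandermonde_def pairprod_def by (intro prod.swap_restrict) auto

text \<open>Each index occurs in card I - 1 pairs.\<close>

lemma pairprod_separable:
  assumes "finite I"
  shows "pairprod I (\<lambda>l m. r l * r m) = (\<Prod>l\<in>I. r l) ^ (card I - 1)"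
  using assms
proof (induction I rule: finite_linorder_max_induct)
  case empty
  then show ?case by (simp add: pairprod_def)
next
  case (insert k I)
  have k: "k \<notin> I" using insert by blast
  have "pairprod (insert k I) (\<lambda>l m. r l * r m) = (\<Prod>l\<in>I. r l) * r k ^ card I * (\<Prod>l\<in>I. r l) ^ (card I - 1)"
    using insert by (simp add: pairprod_insert prod.distrib)
  also have "\<dots> = (r k * (\<Prod>l\<in>I. r l)) ^ card I"
  proof (cases "card I")
    case 0
    then show ?thesis using insert by simp
  next
    case (Suc m)
    then show ?thesis by (simp add: power_mult_distrib)
  qed
  finally show ?case using k insert by simp
qed

text \<open>The left side meets every pair in both orders. It evaluates the product of the residue
  denominators over all poles.\<close>

lemma pairprod_square:
  assumes "finite I" and sym: "\<And>i j. f i j = f j i"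
  shows "(\<Prod>j\<in>I. \<Prod>i\<in>I - {j}. f j i) = (pairprod I f)\<^sup>2"
  using assms(1)
proof (induction I rule: finite_linorder_max_induct)
  case empty
  then show ?case by (simp add: pairprod_def)
next
  case (insert k I)
  have k: "k \<notin> I" using insert by blast
  have "(\<Prod>j\<in>insert k I. \<Prod>i\<in>insert k I - {j}. f j i) = (\<Prod>i\<in>I. f k i) * (\<Prod>j\<in>I. f j k * (\<Prod>i\<in>I - {j}. f j i))"
  proof (subst prod.insert)
    have "insert k I - {k} = I" using k by auto
    moreover have "(\<Prod>i\<in>insert k I - {j}. f j i) = f j k * (\<Prod>i\<in>I - {j}. f j i)" if "j \<in> I" for j
    proof -
      have "insert k I - {j} = insert k (I - {j})" using k that by auto
      then show ?thesis using k insert by simp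
    qed
    ultimately show "(\<Prod>i\<in>insert k I - {k}. f k i) * (\<Prod>j\<in>I. \<Prod>i\<in>insert k I - {j}. f j i) =
      (\<Prod>i\<in>I. f k i) * (\<Prod>j\<in>I. f j k * (\<Prod>i\<in>I - {j}. f j i))" by simp
  qed (use k insert in auto)
  also have "\<dots> = ((\<Prod>l\<in>I. f l k) * pairprod I f)\<^sup>2"
    using insert.IH by (simp add: prod.distrib power2_eq_square sym[of k])
  finally show ?case using insert by (simp add: pairprod_insert)
qed

section \<open>Half-angle formulas in terms of chords\<close>

abbreviation chord :: "real \<Rightarrow> real \<Rightarrow> real" where
  "chord s t \<equiv> norm (cis s - cis t)"

lemma chord_half_sin: "c - 2 * pi < s \<Longrightarrow> s < c \<Longrightarrow> chord c s = 2 * sin ((c - s) / 2)"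
  using sin_half_pos[of c s] by (simp add: norm_cis_diff)

lemma chord_pos:
  assumes "c - 2 * pi < s" "s < t" "t \<le> c"
  shows "0 < chord s t" "0 < chord t s"
proof -
  have "0 < sin ((t - s) / 2)" using assms by (intro sin_gt_zero) auto
  then show "0 < chord t s" by (simp add: norm_cis_diff)
  then show "0 < chord s t" by (simp add: norm_minus_commute)
qed

text \<open>The absolute half-angle sines are half chords, and a difference of cotangents is one
  such sine divided by two others.\<close>

lemma abs_cot_diff_chord:
  assumes "c - 2 * pi < s" "s < c" "c - 2 * pi < t" "t < c"
  shows "\<bar>cot ((c - s) / 2) - cot ((c - t) / 2)\<bar> = 2 * chord s t / (chord c s * chord c t)"
proof -
  have p: "0 < sin ((c - s) / 2)" "0 < sin ((c - t) / 2)" using assms by (auto intro: sin_half_pos)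
  have "\<bar>cot ((c - s) / 2) - cot ((c - t) / 2)\<bar> = \<bar>sin ((s - t) / 2)\<bar> / (sin ((c - s) / 2) * sin ((c - t) / 2))"
    using p by (subst cot_diff_eq) (auto simp: diff_divide_distrib abs_mult)
  then show ?thesis using p assms by (simp add: chord_half_sin norm_cis_diff[of s t])
qed

lemma one_plus_cot_squared_chord:
  assumes "c - 2 * pi < s" "s < c"
  shows "1 + (cot ((c - s) / 2))\<^sup>2 = 4 / (chord c s)\<^sup>2"
  using assms sin_half_pos[OF assms]
  by (simp add: one_plus_cot_squared chord_half_sin power_mult_distrib)

lemma one_plus_cot_squared_chord_sqrt:
  assumes "c - 2 * pi < s" "s < c"
  shows "sqrt (1 + (cot ((c - s) / 2))\<^sup>2) = 2 / chord c s"
  using assms chord_pos[of c s c] by (simp add: one_plus_cot_squared_chord real_sqrt_divide)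

lemma pf_coeff_of_real:
  "j \<in> {k..n} \<Longrightarrow> pf_coeff (\<lambda>i. of_real (b i) :: complex) n k (\<lambda>i. of_real (x i)) j = of_real (pf_coeff b n k x j)"
  unfolding pf_coeff_def by simp

text \<open>Since 1/(i - b) = -(b + i)/(1 + b^2), the pole terms at the imaginary unit produce
  exactly the summands of \<open>mass_total\<close>: the imaginary part is the total, the real part
  the total times \<open>phase_cot\<close>.\<close>

lemma pf_fun_at_ii:
  fixes b y :: "nat \<Rightarrow> real"
  assumes "mass_total b {k..<n} y \<noteq> 0"
  shows "pf_fun (\<lambda>i. of_real (b i)) n k (\<lambda>i. of_real (y i)) \<i>
    = of_real (mass_total b {k..<n} y) * (of_real (phase_cot b n {k..<n} y) + \<i>)"
proof -
  let ?T = "mass_total b {k..<n} y"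
  have nz: "1 + (b j)\<^sup>2 \<noteq> 0" for j using one_plus_square_pos[of "b j"] by linarith
  have t: "complex_of_real (y j) / (\<i> - of_real (b j)) = - of_real (y j / (1 + (b j)\<^sup>2)) * \<i> - of_real (y j / (1 + (b j)\<^sup>2) * b j)" for j
  proof -
    have "\<i> - of_real (b j) \<noteq> 0" by (auto simp: complex_eq_iff)
    moreover have "(- of_real w * \<i> - of_real (w * b j)) * (\<i> - of_real (b j)) = complex_of_real (w * (1 + (b j)\<^sup>2))" for w
      by (simp add: complex_eq_iff power2_eq_square algebra_simps)
    from this[of "y j / (1 + (b j)\<^sup>2)"]
    have "(- of_real (y j / (1 + (b j)\<^sup>2)) * \<i> - of_real (y j / (1 + (b j)\<^sup>2) * b j)) * (\<i> - of_real (b j)) = complex_of_real (y j)"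
      using nz[of j] by (simp only: nonzero_eq_divide_eq[symmetric] times_divide_eq_left) simp
    ultimately show ?thesis by (metis nonzero_mult_div_cancel_right)
  qed
  have m: "y j / (1 + (b j)\<^sup>2) = ?T * mass b {k..<n} y j" for j
    using assms by (simp add: mass_def)
  have "pf_fun (\<lambda>i. of_real (b i)) n k (\<lambda>i. of_real (y i)) \<i>
    = of_real (1 + (\<Sum>j=k..<n. y j / (1 + (b j)\<^sup>2))) * \<i> + of_real ((\<Sum>j=k..<n. y j / (1 + (b j)\<^sup>2) * b j) - y n)"
  proof -
    define w where "w j = y j / (1 + (b j)\<^sup>2)" for j
    show ?thesis unfolding pf_fun_def t w_def[symmetric]
      by (simp add: sum_subtractf sum_negf sum_distrib_left algebra_simps)
  qed
  also have "(\<Sum>j=k..<n. y j / (1 + (b j)\<^sup>2) * b j) - y n = ?T * phase_cot b n {k..<n} y"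
    using assms unfolding phase_cot_def by (simp add: m sum_distrib_left algebra_simps)
  finally show ?thesis by (simp add: mass_total_def algebra_simps)
qed

section \<open>The given angles within one turn, and coordinates relative to the last one\<close>

locale poles =
  fixes n :: nat and \<theta> :: "nat \<Rightarrow> real"
  assumes n: "1 \<le> n" and \<theta>_mono: "strict_mono_on {1..n} \<theta>"
    and \<theta>_0: "\<theta> 0 = \<theta> n - 2 * pi" and \<theta>_01: "\<theta> 0 < \<theta> 1"
begin

text \<open>The pole at exp(i \<theta>_n) has gone to infinity, which leaves index \<open>n\<close>
  free to carry the constant term in \<open>pf_coeff\<close>.\<close>

definition b :: "nat \<Rightarrow> real" where "b j = cot ((\<theta> n - \<theta> j) / 2)"

definition X :: "(nat \<Rightarrow> real) \<Rightarrow> nat \<Rightarrow> real" where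
  "X \<psi> = (\<lambda>i\<in>{1..n}. cot ((\<theta> n - \<psi> i) / 2))"

definition Y :: "(nat \<Rightarrow> real) \<Rightarrow> nat \<Rightarrow> real" where "Y \<psi> = pf_coeff b n 1 (X \<psi>)"

lemma \<theta>_less: "i < j \<Longrightarrow> j \<le> n \<Longrightarrow> \<theta> i < \<theta> j"
proof -
  assume ij: "i < j" "j \<le> n"
  show ?thesis
  proof (cases "i = 0")
    case True
    have "\<theta> 1 \<le> \<theta> j"
      using strict_mono_onD[OF \<theta>_mono, of 1 j] ij by (cases "j = 1") auto
    then show ?thesis using \<theta>_01 True by simp
  next
    case False
    then show ?thesis using strict_mono_onD[OF \<theta>_mono, of i j] ij by auto
  qed
qed

lemma \<theta>_le: "i \<le> j \<Longrightarrow> j \<le> n \<Longrightarrow> \<theta> i \<le> \<theta> j"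
  using \<theta>_less[of i j] by (cases "i = j") auto

lemma \<theta>_range: "j \<in> {1..<n} \<Longrightarrow> \<theta> n - 2 * pi < \<theta> j" "j \<in> {1..<n} \<Longrightarrow> \<theta> j < \<theta> n"
  using \<theta>_less[of 0 j] \<theta>_less[of j n] \<theta>_0 by auto

lemma b_mono: "strict_mono_on {1..<n} b"
proof (rule strict_mono_onI)
  fix i j assume "i \<in> {1..<n}" "j \<in> {1..<n}" "i < j"
  then show "b i < b j" unfolding b_def
    using \<theta>_range \<theta>_less by (subst cot_half_less_iff) auto
qed

text \<open>The half-angle cotangent preserves order on the turn ending at
  \<open>\<theta> n\<close>. The two outer inequalities of \<open>interlacing\<close>, at \<theta>_0
  and \<theta>_n, have no counterpart on the line and are supplied by the range hypothesis.\<close>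

lemma interlaced_iff:
  assumes r: "\<And>i. i \<in> {1..n} \<Longrightarrow> \<theta> n - 2 * pi < \<psi> i \<and> \<psi> i < \<theta> n"
  shows "interlaced b n 1 (X \<psi>) \<longleftrightarrow> interlacing n \<theta> \<psi>"
proof -
  have "interlaced b n 1 (X \<psi>) \<longleftrightarrow> (\<forall>j\<in>{1..<n}. \<psi> j < \<theta> j \<and> \<theta> j < \<psi> (Suc j))"
    unfolding interlaced_def
  proof (intro ball_cong refl arg_cong2[where f="(\<and>)"])
    fix j assume j: "j \<in> {1..<n}"
    then show "(X \<psi> j < b j) = (\<psi> j < \<theta> j)" "(b j < X \<psi> (Suc j)) = (\<theta> j < \<psi> (Suc j))"
      using r[of j] r[of "Suc j"] \<theta>_range[OF j] by (simp_all add: X_def b_def cot_half_less_iff)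
  qed
  also have "\<dots> \<longleftrightarrow> interlacing n \<theta> \<psi>"
  proof
    assume *: "\<forall>j\<in>{1..<n}. \<psi> j < \<theta> j \<and> \<theta> j < \<psi> (Suc j)"
    show "interlacing n \<theta> \<psi>" unfolding interlacing_def
    proof
      fix i assume i: "i \<in> {1..n}"
      have "\<psi> i < \<theta> i" using * r[OF i] i by (cases "i = n") auto
      moreover have "\<theta> (i - 1) < \<psi> i"
      proof (cases "i = 1")
        case False
        then have "i - 1 \<in> {1..<n}" "Suc (i - 1) = i" using i by auto
        then show ?thesis using * by metis
      qed (use r[OF i] \<theta>_0 in auto)
      ultimately show "\<theta> (i - 1) < \<psi> i \<and> \<psi> i < \<theta> i" by simp
    qed
  next
    assume *: "interlacing n \<theta> \<psi>"
    show "\<forall>j\<in>{1..<n}. \<psi> j < \<theta> j \<and> \<theta> j < \<psi> (Suc j)"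
    proof
      fix j assume "j \<in> {1..<n}"
      then show "\<psi> j < \<theta> j \<and> \<theta> j < \<psi> (Suc j)"
        using *[unfolded interlacing_def, rule_format, of j] *[unfolded interlacing_def, rule_format, of "Suc j"] by auto
    qed
  qed
  finally show ?thesis .
qed

end

locale interlaced_angles = poles +
  fixes \<psi> :: "nat \<Rightarrow> real"
  assumes il: "interlacing n \<theta> \<psi>"
begin

lemma \<psi>_bounds: "i \<in> {1..n} \<Longrightarrow> \<theta> (i - 1) < \<psi> i" "i \<in> {1..n} \<Longrightarrow> \<psi> i < \<theta> i"
  using il by (auto simp: interlacing_def)

lemma \<psi>_range: assumes "i \<in> {1..n}" shows "\<theta> n - 2 * pi < \<psi> i" "\<psi> i < \<theta> n"
proof -
  have "\<theta> 0 \<le> \<theta> (i - 1)" "\<theta> i \<le> \<theta> n"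
    using \<theta>_less[of 0 "i - 1"] \<theta>_less[of i n] assms by (cases "i = 1"; cases "i = n"; force)+
  then show "\<theta> n - 2 * pi < \<psi> i" "\<psi> i < \<theta> n" using \<psi>_bounds[OF assms] \<theta>_0 by auto
qed

lemma \<theta>_\<psi>_neq: "j \<in> {1..n} \<Longrightarrow> l \<in> {1..n} \<Longrightarrow> \<theta> j \<noteq> \<psi> l"
proof (cases "l \<le> j")
  case True
  assume "j \<in> {1..n}" "l \<in> {1..n}"
  then show ?thesis using True \<psi>_bounds[of l] \<theta>_less[of l j] by (cases "l = j") auto
next
  case False
  assume *: "j \<in> {1..n}" "l \<in> {1..n}"
  then have "\<theta> j \<le> \<theta> (l - 1)" using False by (intro \<theta>_le) auto
  then show ?thesis using \<psi>_bounds[OF *(2)] by simp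
qed

lemma chord_\<theta>_\<psi>_pos: assumes "j \<in> {1..n}" "l \<in> {1..n}" shows "0 < chord (\<theta> j) (\<psi> l)"
proof -
  have "\<theta> n - 2 * pi < \<theta> j" "\<theta> j \<le> \<theta> n" using \<theta>_less[of 0 j] \<theta>_less[of j n] \<theta>_0 assms
    by (auto, cases "j = n", auto)
  then show ?thesis
    using chord_pos(1)[of "\<theta> n" "\<theta> j" "\<psi> l"] chord_pos(2)[of "\<theta> n" "\<psi> l" "\<theta> j"] \<psi>_range[OF assms(2)] \<theta>_\<psi>_neq[OF assms]
    by (cases "\<theta> j" "\<psi> l" rule: linorder_cases) auto
qed

lemma chord_\<theta>_pos: assumes "j \<in> {1..n}" "i \<in> {1..n}" "i \<noteq> j" shows "0 < chord (\<theta> i) (\<theta> j)"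
proof -
  have *: "\<theta> n - 2 * pi < \<theta> j" "\<theta> j \<le> \<theta> n" if "j \<in> {1..n}" for j
    using \<theta>_less[of 0 j] \<theta>_less[of j n] \<theta>_0 that by (auto, cases "j = n", auto)
  show ?thesis
    using chord_pos[of "\<theta> n" "\<theta> i" "\<theta> j"] chord_pos[of "\<theta> n" "\<theta> j" "\<theta> i"] *[OF assms(1)] *[OF assms(2)]
      \<theta>_less[of i j] \<theta>_less[of j i] assms
    by (cases i j rule: linorder_cases) auto
qed

lemma interlaced_X: "interlaced b n 1 (X \<psi>)"
  using interlaced_iff[of \<psi>] \<psi>_range il by auto

lemma Y_pos: "j \<in> {1..<n} \<Longrightarrow> 0 < Y \<psi> j"
  unfolding Y_def using pf_coeff_pos[OF n b_mono interlaced_X] by simp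

abbreviation "T \<equiv> mass_total b {1..<n} (Y \<psi>)"
abbreviation "cc \<equiv> phase_cot b n {1..<n} (Y \<psi>)"
abbreviation "q j \<equiv> mass b {1..<n} (Y \<psi>) j"
definition "\<phi> = pi - 2 * arctan cc"
text \<open>This is |1 - t|.\<close>

definition "\<tau> = chord 0 \<phi>"
definition "P = (\<Prod>l=1..n. chord (\<theta> n) (\<psi> l))"
definition "A = (\<Prod>j=1..<n. chord (\<theta> n) (\<theta> j))"

lemma T_pos: "0 < T" using Y_pos by (intro mass_total_pos) auto

lemma P_pos: "0 < P" unfolding P_def using chord_\<theta>_\<psi>_pos n by (intro prod_pos) auto

lemma A_pos: "0 < A" unfolding A_def using chord_\<theta>_pos n by (intro prod_pos) auto

lemma \<tau>_eq: "\<tau> = 2 / sqrt (1 + cc\<^sup>2)"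
proof -
  have "\<tau> = 2 * \<bar>sin (\<phi> / 2)\<bar>" unfolding \<tau>_def using norm_cis_diff[of 0 \<phi>] by simp
  also have "sin (\<phi> / 2) = cos (arctan cc)"
    unfolding \<phi>_def by (simp add: diff_divide_distrib sin_diff)
  finally show ?thesis by (simp add: cos_arctan)
qed

lemma \<tau>_pos: "0 < \<tau>" unfolding \<tau>_eq using one_plus_square_pos by simp

lemma one_plus_cc: "1 + cc\<^sup>2 = 4 / \<tau>\<^sup>2"
  unfolding \<tau>_eq using one_plus_square_pos[of cc] by (simp add: power_divide)

text \<open>
  Evaluate the partial fraction identity at the imaginary unit, the image of the center of the circle:
  its modulus is $T \sqrt{1 + c^2}$ with $c = \cot(\phi/2)$ on one side and a ratio of chords on the other.
\<close>

lemma T_eq: "T = \<tau> * A / P"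
proof -
  let ?b = "\<lambda>i. complex_of_real (b i)" and ?x = "\<lambda>i. complex_of_real (X \<psi> i)"
  have inj: "inj_on b {1..<n}" using b_mono by (rule strict_mono_on_imp_inj_on)
  then have injc: "inj_on ?b {1..<n}" by (auto simp: inj_on_def)
  have "pf_fun ?b n 1 (\<lambda>i. of_real (Y \<psi> i)) \<i> = pf_fun ?b n 1 (pf_coeff ?b n 1 ?x) \<i>"
    unfolding pf_fun_def Y_def using n by (auto simp: pf_coeff_of_real intro!: arg_cong2[where f="(-)"] sum.cong)
  also have "\<dots> = (\<Prod>l=1..n. \<i> - ?x l) / (\<Prod>j=1..<n. \<i> - ?b j)"
    using n injc by (intro pf_fun_eq_prod) (auto simp: complex_eq_iff)
  finally have "of_real T * (of_real cc + \<i>) = (\<Prod>l=1..n. \<i> - ?x l) / (\<Prod>j=1..<n. \<i> - ?b j)"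
    using T_pos by (subst (asm) pf_fun_at_ii) auto
  then have "norm (of_real T * (of_real cc + \<i>)) = norm ((\<Prod>l=1..n. \<i> - ?x l) / (\<Prod>j=1..<n. \<i> - ?b j))"
    by simp
  also have "norm (of_real T * (of_real cc + \<i>)) = T * sqrt (1 + cc\<^sup>2)"
  proof -
    have "norm (complex_of_real cc + \<i>) = sqrt (1 + cc\<^sup>2)" by (simp add: cmod_def add.commute)
    then show ?thesis using T_pos by (simp only: norm_mult norm_of_real)
  qed
  also have "norm ((\<Prod>l=1..n. \<i> - ?x l) / (\<Prod>j=1..<n. \<i> - ?b j)) =
     (\<Prod>l=1..n. 2 / chord (\<theta> n) (\<psi> l)) / (\<Prod>j=1..<n. 2 / chord (\<theta> n) (\<theta> j))"
  proof -
    have "norm (\<i> - ?x l) = 2 / chord (\<theta> n) (\<psi> l)" if "l \<in> {1..n}" for l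
      using one_plus_cot_squared_chord_sqrt[of "\<theta> n" "\<psi> l"] \<psi>_range[OF that] that
      by (simp add: cmod_def X_def add.commute)
    moreover have "norm (\<i> - ?b j) = 2 / chord (\<theta> n) (\<theta> j)" if "j \<in> {1..<n}" for j
      using one_plus_cot_squared_chord_sqrt[of "\<theta> n" "\<theta> j"] \<theta>_range[OF that]
      by (simp add: cmod_def b_def add.commute)
    ultimately show ?thesis by (simp add: norm_divide prod_norm[symmetric])
  qed
  also have "\<dots> = 2 ^ n / 2 ^ (n - 1) * A / P" unfolding A_def P_def by (simp add: prod_dividef)
  \<comment> \<open>There is one root more than there are finite poles, so a single factor 2
    survives.\<close>
  also have "(2::real) ^ n / 2 ^ (n - 1) = 2" using n by (cases n) auto
  finally have "T * sqrt (1 + cc\<^sup>2) = 2 * A / P" .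
  then have "T * (2 / \<tau>) = 2 * A / P"
    unfolding \<tau>_eq using one_plus_square_pos[of cc] by simp
  then show ?thesis using \<tau>_pos P_pos by (simp add: field_simps)
qed

end

text \<open>V and W stand for the chord products of the new points and of the first n - 1 given
  points, t for |1 - t|. Splitting the factor 2 of a pair evenly between its indices gives the
  square roots. For n = 1 the truncated n - 2 is 0 where -1 is meant; A is then an empty product, so
  the identity still holds.\<close>

lemma jacobian_algebra:
  fixes P A t V W :: real
  assumes n: "1 \<le> n" and pos: "0 < P" "0 < A" "0 < t" "0 < W" and A: "n = 1 \<Longrightarrow> A = 1"
  shows "(P / (t * A)) ^ n * (A\<^sup>2 / 4 ^ (n - 1)) * (P * t / (2 * A)) * (V * (sqrt 2 ^ n / P) ^ (n - 1)) * (2 ^ n / P\<^sup>2)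
    = W * (sqrt 2 ^ (n - 1) / A) ^ (n - 2) * (V / (t ^ (n - 1) * A * W))"
proof -
  obtain m where m: "n = Suc m" using n by (cases n) auto
  have nz: "P \<noteq> 0" "A \<noteq> 0" "t \<noteq> 0" "W \<noteq> 0" using pos by auto
  show ?thesis
  proof (cases m)
    case 0
    then show ?thesis using nz A unfolding m by (simp add: field_simps power2_eq_square)
  next
    case (Suc k)
    have "(P / (t * A)) ^ Suc m * (A\<^sup>2 / 4 ^ m) * (P * t / (2 * A)) * (V * (sqrt 2 ^ Suc m / P) ^ m) * (2 ^ Suc m / P\<^sup>2)
      = V / (t ^ m * A ^ m) * (sqrt 2 ^ (Suc m * m) / 2 ^ m)"
    proof -
      have "(4::real) ^ m = 2 ^ m * 2 ^ m" by (simp add: power_mult_distrib[symmetric])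
      then show ?thesis using nz
        by (simp add: power_mult[symmetric] power_add power2_eq_square field_simps)
    qed
    also have "sqrt 2 ^ (Suc m * m) = sqrt 2 ^ (m * k) * 2 ^ m"
    proof -
      have "Suc m * m = m * k + 2 * m" unfolding Suc by simp
      then show ?thesis by (simp only: power_add power_mult) (simp add: power_mult[symmetric])
    qed
    also have "V / (t ^ m * A ^ m) * (sqrt 2 ^ (m * k) * 2 ^ m / 2 ^ m)
      = W * (sqrt 2 ^ m / A) ^ k * (V / (t ^ m * A * W))"
      using nz by (simp add: power_mult[symmetric] power_add Suc field_simps)
    finally show ?thesis by (simp add: m Suc)
  qed
qed

text \<open>After taking logarithms the identity is linear in the exponents. That of t on the left
  is -m (d - 1) - (d0 - 1) + (d0 + m d - 1) - m = 0, so |1 - t| disappears.\<close>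

lemma density_algebra:
  fixes Q P A W V t d d0 :: real
  assumes "0 < Q" "0 < P" "0 < A" "0 < W" "0 < t"
  shows "(Q / (t ^ m * A * W\<^sup>2)) powr (d - 1) * (P / (t * A)) powr (d0 - 1) * t powr (d0 + real m * d - 1) * (V / (t ^ m * A * W))
    = P powr (d0 - 1) / A powr (d0 + d - 1) * (Q powr (d - 1) / W powr (2 * d - 1)) * V"
proof -
  obtain q p a w s where e: "Q = exp q" "P = exp p" "A = exp a" "W = exp w" "t = exp s"
    using assms by (metis exp_ln)
  have pw: "exp x powr y = exp (y * x)" for x y :: real by (simp add: powr_def)
  have pn: "exp x ^ k = exp (real k * x)" for x :: real and k by (simp add: exp_of_nat_mult)
  show ?thesis unfolding e
    by (simp add: pn pw exp_diff[symmetric] divide_inverse exp_minus[symmetric] mult_exp_exp)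
       (simp add: mult_exp_exp algebra_simps)
qed

section \<open>Weights, Jacobian and densities in terms of chords\<close>

context interlaced_angles
begin

definition "Q j = (\<Prod>l=1..n. chord (\<theta> j) (\<psi> l))"
definition "E j = (\<Prod>i\<in>{1..<n} - {j}. chord (\<theta> j) (\<theta> i))"
definition "W\<^sub>\<psi> = pairprod {1..n} (\<lambda>l m. chord (\<psi> m) (\<psi> l))"
definition "W\<^sub>\<theta> = pairprod {1..<n} (\<lambda>l m. chord (\<theta> m) (\<theta> l))"

lemma Q_pos: "j \<in> {1..<n} \<Longrightarrow> 0 < Q j"
  unfolding Q_def using chord_\<theta>_\<psi>_pos by (intro prod_pos) auto

lemma E_pos: "j \<in> {1..<n} \<Longrightarrow> 0 < E j"
  unfolding E_def using chord_\<theta>_pos by (intro prod_pos) auto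

lemma W\<^sub>\<theta>_pos: "0 < W\<^sub>\<theta>"
  unfolding W\<^sub>\<theta>_def using chord_\<theta>_pos by (intro pairprod_pos) auto

lemma prod_E: "(\<Prod>j=1..<n. E j) = W\<^sub>\<theta>\<^sup>2"
  unfolding E_def W\<^sub>\<theta>_def
  using pairprod_square[of "{1..<n}" "\<lambda>j i. chord (\<theta> j) (\<theta> i)"]
  by (simp add: norm_minus_commute pairprod_def)

text \<open>The residue at b_j is a quotient of products of cotangent differences. In chord form, 1
  + b_j^2 removes the powers of 2 and all but one power of the chord to \<open>\<theta> n\<close>,
  and dividing by the total from \<open>T_eq\<close> removes \<open>A\<close> and
  \<open>P\<close>.\<close>

lemma mass_eq:
  assumes j: "j \<in> {1..<n}"
  shows "q j = Q j / (\<tau> * chord (\<theta> n) (\<theta> j) * E j)"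
proof -
  obtain m where m: "n = Suc (Suc m)" using j by (cases n; cases "n - 1") auto
  let ?a = "\<lambda>i. chord (\<theta> n) (\<theta> i)"
  have a: "0 < ?a i" if "i \<in> {1..<n}" for i using chord_\<theta>_pos that by auto
  have Aj: "A = ?a j * (\<Prod>i\<in>{1..<n} - {j}. ?a i)" unfolding A_def using j by (subst prod.remove[of _ j]) auto
  have A': "(\<Prod>i\<in>{1..<n} - {j}. ?a i) = A / ?a j" using Aj a[OF j] by simp
  have c: "card ({1..<n} - {j}) = m" using j m by simp
  have "Y \<psi> j = \<bar>Y \<psi> j\<bar>" using Y_pos[OF j] by simp
  also have "\<dots> = (\<Prod>l=1..n. \<bar>b j - X \<psi> l\<bar>) / (\<Prod>i\<in>{1..<n} - {j}. \<bar>b j - b i\<bar>)"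
    using j unfolding Y_def pf_coeff_def by (simp add: abs_prod)
  also have "(\<Prod>l=1..n. \<bar>b j - X \<psi> l\<bar>) = (\<Prod>l=1..n. 2 * chord (\<theta> j) (\<psi> l) / (?a j * chord (\<theta> n) (\<psi> l)))"
    using \<theta>_range[OF j] \<psi>_range by (intro prod.cong) (auto simp: b_def X_def abs_cot_diff_chord)
  also have "\<dots> = 2 ^ n * Q j / (?a j ^ n * P)"
    unfolding Q_def P_def by (simp add: prod_dividef prod.distrib)
  also have "(\<Prod>i\<in>{1..<n} - {j}. \<bar>b j - b i\<bar>) = (\<Prod>i\<in>{1..<n} - {j}. 2 * chord (\<theta> j) (\<theta> i) / (?a j * ?a i))"
    using \<theta>_range j by (intro prod.cong) (auto simp: b_def abs_cot_diff_chord)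
  also have "\<dots> = 2 ^ m * E j / (?a j ^ m * (A / ?a j))"
    unfolding E_def A'[symmetric] by (simp add: prod_dividef prod.distrib c del: One_nat_def)
  finally have Y: "Y \<psi> j = 2 ^ n * Q j / (?a j ^ n * P) / (2 ^ m * E j / (?a j ^ m * (A / ?a j)))" .
  have sq: "1 + (b j)\<^sup>2 = 4 / (?a j)\<^sup>2"
    unfolding b_def using \<theta>_range[OF j] by (rule one_plus_cot_squared_chord)
  have e: "(2::real) ^ n = 2 ^ m * 4" "?a j ^ n = ?a j ^ m * (?a j)\<^sup>2"
    by (simp_all add: m power2_eq_square mult_ac)
  show ?thesis
    unfolding mass_def Y sq T_eq e
    using a[OF j] A_pos P_pos \<tau>_pos E_pos[OF j] Q_pos[OF j]
    by (simp add: field_simps power2_eq_square)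
qed

lemma mass_pos: "j \<in> {1..<n} \<Longrightarrow> 0 < q j"
  using mass_eq Q_pos E_pos \<tau>_pos chord_\<theta>_pos[of n j] by auto

lemma sum_mass: "(\<Sum>j=1..<n. q j) = 1 - 1 / T"
proof -
  have "(\<Sum>j=1..<n. q j) = (T - 1) / T"
    unfolding mass_def sum_divide_distrib[symmetric] by (simp add: mass_total_def)
  then show ?thesis using T_pos by (simp add: diff_divide_distrib)
qed

lemma \<phi>_range: "0 < \<phi>" "\<phi> < 2 * pi"
  unfolding \<phi>_def using arctan_bounded[of cc] by auto

text \<open>Writing the factor 2 of each pair as sqrt 2 for each of its indices makes the conversion
  from cotangents to chords separable.\<close>

lemma vandermonde_X: "vandermonde {1..n} (X \<psi>) = W\<^sub>\<psi> * (sqrt 2 ^ n / P) ^ (n - 1)"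
proof -
  have "vandermonde {1..n} (X \<psi>) = pairprod {1..n} (\<lambda>l m. chord (\<psi> m) (\<psi> l) * (sqrt 2 / chord (\<theta> n) (\<psi> l) * (sqrt 2 / chord (\<theta> n) (\<psi> m))))"
    unfolding vandermonde_eq_pairprod[OF finite_atLeastAtMost]
    using \<psi>_range by (intro pairprod_cong) (auto simp: X_def abs_cot_diff_chord mult_ac)
  also have "\<dots> = W\<^sub>\<psi> * (\<Prod>l=1..n. sqrt 2 / chord (\<theta> n) (\<psi> l)) ^ (n - 1)"
    by (subst pairprod_mult, subst pairprod_separable) (auto simp: W\<^sub>\<psi>_def)
  also have "(\<Prod>l=1..n. sqrt 2 / chord (\<theta> n) (\<psi> l)) = sqrt 2 ^ n / P"
    unfolding P_def by (simp add: prod_dividef)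
  finally show ?thesis .
qed

lemma vandermonde_b: "vandermonde {1..<n} b = W\<^sub>\<theta> * (sqrt 2 ^ (n - 1) / A) ^ (n - 2)"
proof -
  have "vandermonde {1..<n} b = pairprod {1..<n} (\<lambda>l m. chord (\<theta> m) (\<theta> l) * (sqrt 2 / chord (\<theta> n) (\<theta> l) * (sqrt 2 / chord (\<theta> n) (\<theta> m))))"
    unfolding vandermonde_eq_pairprod[OF finite_atLeastLessThan]
    using \<theta>_range by (intro pairprod_cong) (auto simp: b_def abs_cot_diff_chord mult_ac)
  also have "\<dots> = W\<^sub>\<theta> * (\<Prod>l=1..<n. sqrt 2 / chord (\<theta> n) (\<theta> l)) ^ (n - 1 - 1)"
    by (subst pairprod_mult, subst pairprod_separable) (auto simp: W\<^sub>\<theta>_def)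
  also have "(\<Prod>l=1..<n. sqrt 2 / chord (\<theta> n) (\<theta> l)) = sqrt 2 ^ (n - 1) / A"
    unfolding A_def by (simp add: prod_dividef)
  finally show ?thesis by (simp add: numeral_2_eq_2)
qed

lemma mass_phase_jac_eq:
  "mass_phase_jac b n {1..<n} (Y \<psi>) = (P / (\<tau> * A)) ^ n * (A\<^sup>2 / 4 ^ (n - 1)) * (P * \<tau> / (2 * A))"
proof -
  have "(\<Prod>j=1..<n. 1 / (1 + (b j)\<^sup>2)) = (\<Prod>j=1..<n. (chord (\<theta> n) (\<theta> j))\<^sup>2 / 4)"
    using \<theta>_range one_plus_cot_squared_chord by (intro prod.cong) (auto simp: b_def)
  also have "\<dots> = A\<^sup>2 / 4 ^ (n - 1)"
    unfolding A_def by (simp add: prod_dividef prod_power_distrib)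
  finally have 1: "(\<Prod>j=1..<n. 1 / (1 + (b j)\<^sup>2)) = A\<^sup>2 / 4 ^ (n - 1)" .
  have 2: "1 / T = P / (\<tau> * A)" unfolding T_eq by simp
  have 3: "2 / T / (1 + cc\<^sup>2) = P * \<tau> / (2 * A)"
    unfolding one_plus_cc T_eq using \<tau>_pos A_pos P_pos by (simp add: field_simps power2_eq_square)
  have "1 / T ^ (card {1..<n} + 1) = (P / (\<tau> * A)) ^ n"
    using n by (simp add: 2[symmetric] power_one_over del: power_Suc)
  then show ?thesis unfolding mass_phase_jac_def 1 3 by simp
qed

lemma prod_derivative: "(\<Prod>i=1..n. 1 / (2 * (sin ((\<theta> n - \<psi> i) / 2))\<^sup>2)) = 2 ^ n / P\<^sup>2"
proof -
  have "(\<Prod>i=1..n. 1 / (2 * (sin ((\<theta> n - \<psi> i) / 2))\<^sup>2)) = (\<Prod>i=1..n. 2 / (chord (\<theta> n) (\<psi> i))\<^sup>2)"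
    using \<psi>_range by (intro prod.cong) (auto simp: chord_half_sin power_mult_distrib)
  then show ?thesis unfolding P_def by (simp add: prod_dividef prod_power_distrib)
qed

text \<open>\<open>A * W\<^sub>\<theta>\<close> is the product of all chords between given points.
  Up to the Vandermonde factor of \<open>b\<close>, which reappears in
  \<open>nn_integral_roots\<close>, the Jacobian from \<psi> to weights and phase is the product of
  the new chords divided by that of the given ones and by |1 - t|^(n-1).\<close>

lemma jacobian_eq:
  "mass_phase_jac b n {1..<n} (Y \<psi>) * vandermonde {1..n} (X \<psi>) * (\<Prod>i=1..n. 1 / (2 * (sin ((\<theta> n - \<psi> i) / 2))\<^sup>2))
    = vandermonde {1..<n} b * (W\<^sub>\<psi> / (\<tau> ^ (n - 1) * A * W\<^sub>\<theta>))"
  unfolding mass_phase_jac_eq vandermonde_X vandermonde_b prod_derivative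
  using n P_pos A_pos \<tau>_pos W\<^sub>\<theta>_pos by (rule jacobian_algebra, unfold A_def) simp

end

text \<open>A rotation of the circle acts on half-angle cotangents by a Moebius map, here with its
  pole at cot v. The residue 1 + (cot v)^2 is the source of the factor 1 + b_j^2 in the
  weights.\<close>

lemma cot_diff_moebius:
  fixes u v :: real
  assumes "sin u \<noteq> 0" "sin v \<noteq> 0" "cot u \<noteq> cot v"
  shows "cot (v - u) = cot v + (1 + (cot v)\<^sup>2) / (cot u - cot v)"
proof -
  have nz: "sin (v - u) \<noteq> 0" using cot_diff_eq[of u v] assms by auto
  have "sin u = sin v * cos (v - u) - cos v * sin (v - u)"
    using sin_diff[of v "v - u"] by simp
  then have "cot v + (1 / (sin v)\<^sup>2) / (sin (v - u) / (sin u * sin v)) = cot (v - u)"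
    using assms(1,2) nz by (simp add: cot_def field_simps power2_eq_square)
  then show ?thesis using assms by (simp add: one_plus_cot_squared cot_diff_eq)
qed

context interlaced_angles
begin

text \<open>The cotangent of \<psi>_i is a root of the partial fraction. Division by T and
  \<open>cot_diff_moebius\<close> in each term turn this into the cotangent equation; the pole at
  \<open>\<theta> n\<close> contributes the linear term.\<close>

lemma zero_equation:
  assumes i: "i \<in> {1..n}"
  shows "(\<Sum>j=1..<n. q j * cot ((\<psi> i - \<theta> j) / 2)) + (1 / T) * cot ((\<psi> i - \<theta> n) / 2) = cc"
proof -
  let ?u = "(\<theta> n - \<psi> i) / 2" and ?x = "X \<psi> i"
  have x: "?x = cot ?u" using i by (simp add: X_def)
  have neq: "?x \<noteq> b j" if "j \<in> {1..<n}" for j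
    using cot_half_less_iff[of "\<theta> n" "\<psi> i" "\<theta> j"] cot_half_less_iff[of "\<theta> n" "\<theta> j" "\<psi> i"] \<psi>_range[OF i] \<theta>_range[OF that] \<theta>_\<psi>_neq[of j i] i that
    unfolding x b_def by (cases "\<psi> i" "\<theta> j" rule: linorder_cases) auto
  have "pf_fun b n 1 (Y \<psi>) ?x = (\<Prod>l=1..n. ?x - X \<psi> l) / (\<Prod>j=1..<n. ?x - b j)"
    unfolding Y_def using n b_mono neq by (intro pf_fun_eq_prod strict_mono_on_imp_inj_on; blast)
  also have "(\<Prod>l=1..n. ?x - X \<psi> l) = 0" using i by (intro prod_zero) auto
  finally have pf: "?x = Y \<psi> n + (\<Sum>j=1..<n. Y \<psi> j / (?x - b j))" by (simp add: pf_fun_def)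
  have c: "q j * cot ((\<psi> i - \<theta> j) / 2) = q j * b j + (Y \<psi> j / (?x - b j)) / T" if j: "j \<in> {1..<n}" for j
  proof -
    have "sin ?u \<noteq> 0" "sin ((\<theta> n - \<theta> j) / 2) \<noteq> 0"
      using sin_half_pos[of "\<theta> n" "\<psi> i"] sin_half_pos[of "\<theta> n" "\<theta> j"] \<psi>_range[OF i] \<theta>_range[OF j] by auto
    then have "cot ((\<theta> n - \<theta> j) / 2 - ?u) = b j + (1 + (b j)\<^sup>2) / (?x - b j)"
      using neq[OF j] unfolding x b_def by (intro cot_diff_moebius)
    then have "cot ((\<psi> i - \<theta> j) / 2) = b j + (1 + (b j)\<^sup>2) / (?x - b j)"
      by (simp add: diff_divide_distrib)
    moreover have "q j * (1 + (b j)\<^sup>2) = Y \<psi> j / T"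
      using one_plus_square_pos[of "b j"] unfolding mass_def by simp
    then have "q j * ((1 + (b j)\<^sup>2) / (?x - b j)) = (Y \<psi> j / (?x - b j)) / T"
      by (metis times_divide_eq_right divide_divide_eq_left mult.commute)
    ultimately show ?thesis by (simp add: distrib_left)
  qed
  have "cot ((\<psi> i - \<theta> n) / 2) = - ?x"
    unfolding x using cot_minus[of ?u] by (simp add: minus_divide_left)
  moreover have "(\<Sum>j=1..<n. q j * cot ((\<psi> i - \<theta> j) / 2)) = (\<Sum>j=1..<n. q j * b j) + (\<Sum>j=1..<n. Y \<psi> j / (?x - b j)) / T"
    unfolding sum_divide_distrib sum.distrib[symmetric] by (rule sum.cong[OF refl c])
  ultimately have "(\<Sum>j=1..<n. q j * cot ((\<psi> i - \<theta> j) / 2)) + (1 / T) * cot ((\<psi> i - \<theta> n) / 2)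
     = (\<Sum>j=1..<n. q j * b j) + ((\<Sum>j=1..<n. Y \<psi> j / (?x - b j)) - ?x) / T"
    by (simp only: diff_divide_distrib) simp
  also have "(\<Sum>j=1..<n. Y \<psi> j / (?x - b j)) - ?x = - Y \<psi> n" using pf by simp
  finally show ?thesis unfolding phase_cot_def by simp
qed

lemma cot_half_\<phi>: "cot (\<phi> / 2) = cc"
  using tan_cot'[of "\<phi> / 2"] by (simp add: \<phi>_def diff_divide_distrib tan_arctan)

text \<open>The pointwise core of the change of variables: \<open>z\<close> holds the parameters
  belonging to \<psi>. Once all quantities are chords, \<open>density_algebra\<close> combines the
  powers.\<close>

lemma density_identity:
  fixes d d0 :: real
  defines "z \<equiv> mass_phase b n {1..<n} (Y \<psi>)"
  shows "dirichlet_density n d d0 z * phase_density n d d0 (z n) * (mass_phase_jac b n {1..<n} (Y \<psi>) *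
      vandermonde {1..n} (X \<psi>) * (\<Prod>i=1..n. 1 / (2 * (sin ((\<theta> n - \<psi> i) / 2))\<^sup>2)))
    = vandermonde {1..<n} b * zero_density n d d0 \<theta> \<psi>"
proof -
  have I: "{1..n - 1} = {1..<n}" using n by auto
  have rn: "real n - 1 = real (n - 1)" using n by simp
  define QQ where "QQ = (\<Prod>j=1..<n. Q j)"
  have QQ: "0 < QQ" unfolding QQ_def using Q_pos by (intro prod_pos) auto
  have pos: "0 < P" "0 < A" "0 < \<tau>" "0 < W\<^sub>\<theta>" using P_pos A_pos \<tau>_pos W\<^sub>\<theta>_pos by auto
  have z: "z j = q j" if "j \<in> {1..<n}" for j using that by (simp add: z_def mass_phase_def)
  have zn: "z n = \<phi>" unfolding z_def mass_phase_def \<phi>_def by simp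
  have zs: "(\<Sum>j=1..<n. z j) = 1 - 1 / T" using sum_mass by (simp add: z)
  define C1 where "C1 = Gamma ((real n - 1) * d + d0) / (Gamma d ^ (n - 1) * Gamma d0)"
  define C2 where "C2 = (Gamma ((d0 + (real n - 1) * d + 1) / 2))\<^sup>2 / (2 * pi * Gamma ((real n - 1) * d + d0))"
  have "(\<Prod>j=1..<n. z j powr (d - 1)) = (\<Prod>j=1..<n. z j) powr (d - 1)"
    by (rule prod_powr_distrib[symmetric])
  also have "(\<Prod>j=1..<n. z j) = QQ / (\<tau> ^ (n - 1) * A * W\<^sub>\<theta>\<^sup>2)"
    by (simp add: z mass_eq prod_dividef prod.distrib prod_E A_def QQ_def del: One_nat_def)
  finally have prod_z: "(\<Prod>j=1..<n. z j powr (d - 1)) = (QQ / (\<tau> ^ (n - 1) * A * W\<^sub>\<theta>\<^sup>2)) powr (d - 1)" .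
  have D: "dirichlet_density n d d0 z = C1 * (QQ / (\<tau> ^ (n - 1) * A * W\<^sub>\<theta>\<^sup>2)) powr (d - 1) * (P / (\<tau> * A)) powr (d0 - 1)"
  proof -
    have cond: "\<forall>j\<in>{1..<n}. 0 < z j" "(\<Sum>j=1..<n. z j) < 1" using z mass_pos T_pos zs by auto
    have e: "1 - (\<Sum>j=1..<n. z j) = P / (\<tau> * A)" unfolding zs T_eq by simp
    show ?thesis
      unfolding dirichlet_density_def I C1_def prod_z e if_P[OF conjI[OF cond]] ..
  qed
  have "norm (1 - cis \<phi>) = \<tau>" unfolding \<tau>_def by simp
  then have Ph: "phase_density n d d0 (z n) = C2 * \<tau> powr (d0 + real (n - 1) * d - 1)"
    unfolding phase_density_def zn C2_def rn[symmetric] using \<phi>_range by simp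
  have c1: "(\<Prod>l=1..n. chord (\<theta> n) (\<psi> l) powr (d0 - 1)) = P powr (d0 - 1)"
    unfolding P_def by (rule prod_powr_distrib[symmetric])
  have c2: "(\<Prod>l=1..<n. chord (\<theta> n) (\<theta> l) powr (d0 + d - 1)) = A powr (d0 + d - 1)"
    unfolding A_def by (rule prod_powr_distrib[symmetric])
  have c3: "(\<Prod>j=1..<n. \<Prod>l=1..n. chord (\<theta> j) (\<psi> l) powr (d - 1)) = QQ powr (d - 1)"
    unfolding QQ_def Q_def by (simp add: prod_powr_distrib prod_nonneg)
  have c4: "(\<Prod>k=1..<n. \<Prod>j=1..<k. chord (\<theta> k) (\<theta> j) powr (2 * d - 1)) = W\<^sub>\<theta> powr (2 * d - 1)"
    unfolding W\<^sub>\<theta>_def pairprod_def prod_powr_distrib by (intro prod.cong) auto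
  have c5: "(\<Prod>k=1..n. \<Prod>j=1..<k. chord (\<psi> k) (\<psi> j)) = W\<^sub>\<psi>"
    unfolding W\<^sub>\<psi>_def pairprod_def by (intro prod.cong) auto
  have Z: "zero_density n d d0 \<theta> \<psi> = C1 * C2 * (P powr (d0 - 1) / A powr (d0 + d - 1) * (QQ powr (d - 1) / W\<^sub>\<theta> powr (2 * d - 1)) * W\<^sub>\<psi>)"
    unfolding zero_density_def norm_const_def I c1 c2 c3 c4 c5 C1_def C2_def using il by simp
  show ?thesis
    unfolding jacobian_eq D Ph Z density_algebra[OF QQ pos(1,2,4,3), of "n - 1" d d0 W\<^sub>\<psi>, symmetric] by simp
qed

end

subsection \<open>Zeros of the random rational function\<close>

text \<open>The map w -> 1/(1 - w) takes the unit circle to the line of real part 1/2. Both 1/(1 -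
  t) and, on the circle, the pole terms of C_n divided by their weights lie on that line.\<close>

lemma inverse_one_minus_cis:
  assumes "sin (x / 2) \<noteq> 0"
  shows "1 / (1 - cis x) = (1 + \<i> * of_real (cot (x / 2))) / 2"
proof -
  define y where "y = x / 2"
  have s: "sin y \<noteq> 0" using assms by (simp add: y_def)
  have c: "cos x = 1 - 2 * sin y * sin y" and sn: "sin x = 2 * sin y * cos y"
    using cos_double_sin[of y] sin_double[of y] by (simp_all add: y_def power2_eq_square)
  have e: "cos y * cos y = 1 - sin y * sin y" using cos_squared_eq[of y] by (simp add: power2_eq_square)
  have "sin x * cot y = 2 - 2 * sin y * sin y" unfolding sn cot_def using s e by simp
  moreover have "(1 - cos x) * cot y = sin x" unfolding c sn cot_def using s by simp
  ultimately have "(1 - cis x) * (1 + \<i> * of_real (cot y)) = 2"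
    unfolding complex_eq_iff by (simp add: c)
  moreover from this have "1 - cis x \<noteq> 0" by (metis mult_zero_left zero_neq_numeral)
  ultimately have "1 + \<i> * of_real (cot y) = 2 / (1 - cis x)"
    by (metis nonzero_mult_div_cancel_left)
  moreover have "2 / w / 2 = 1 / w" for w :: complex by simp
  ultimately show ?thesis unfolding y_def by (simp only:)
qed

text \<open>C_n = 0 says that 1/(1 - t) is the q-weighted mean of the numbers 1/(1 - e^(i(s -
  \<theta>_j))). All of them have real part 1/2, so only the imaginary parts give a
  condition.\<close>

lemma C_fun_cis_eq_0_iff:
  assumes q: "(\<Sum>j=1..n. q j) = 1" and s: "\<And>j. j \<in> {1..n} \<Longrightarrow> sin ((s - \<theta> j) / 2) \<noteq> 0"
    and \<phi>: "sin (\<phi> / 2) \<noteq> 0"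
  shows "C_fun n \<theta> q (cis \<phi>) (cis s) = 0 \<longleftrightarrow> (\<Sum>j=1..n. q j * cot ((s - \<theta> j) / 2)) = cot (\<phi> / 2)"
proof -
  let ?c = "cot (\<phi> / 2)" and ?S = "\<Sum>j=1..n. q j * cot ((s - \<theta> j) / 2)"
  have t: "cis (\<theta> j) * of_real (q j) / (cis (\<theta> j) - cis s) = (of_real (q j) + \<i> * of_real (q j * cot ((s - \<theta> j) / 2))) / 2"
    if j: "j \<in> {1..n}" for j
  proof -
    have "cis (\<theta> j) - cis s = cis (\<theta> j) * (1 - cis (s - \<theta> j))" by (simp add: algebra_simps cis_mult)
    then have "cis (\<theta> j) * of_real (q j) / (cis (\<theta> j) - cis s) = of_real (q j) * (1 / (1 - cis (s - \<theta> j)))"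
      by simp
    then show ?thesis unfolding inverse_one_minus_cis[OF s[OF j]] by (simp add: algebra_simps)
  qed
  have "(\<Sum>j=1..n. cis (\<theta> j) * of_real (q j) / (cis (\<theta> j) - cis s))
     = (\<Sum>j=1..n. (of_real (q j) + \<i> * of_real (q j * cot ((s - \<theta> j) / 2))) / 2)"
    by (rule sum.cong[OF refl t])
  also have "\<dots> = (of_real (\<Sum>j=1..n. q j) + \<i> * of_real ?S) / 2"
    by (simp only: sum_divide_distrib[symmetric] sum.distrib sum_distrib_left[symmetric] of_real_sum)
  finally have C: "C_fun n \<theta> q (cis \<phi>) (cis s) = 1 + (cis \<phi> - 1) * ((1 + \<i> * of_real ?S) / 2)"
    unfolding C_fun_def q by simp
  have "1 - cis \<phi> \<noteq> 0"
  proof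
    assume "1 - cis \<phi> = 0"
    then have "norm (cis 0 - cis \<phi>) = 0" by simp
    then show False using \<phi> unfolding norm_cis_diff by simp
  qed
  moreover have "1 + (u - 1) * x = (1 - u) * (1 / (1 - u) - x)" if "1 - u \<noteq> 0" for u x :: complex
    using that by (simp add: right_diff_distrib left_diff_distrib)
  ultimately have "C_fun n \<theta> q (cis \<phi>) (cis s) = (1 - cis \<phi>) * (1 / (1 - cis \<phi>) - (1 + \<i> * of_real ?S) / 2)"
    unfolding C by blast
  also have "\<dots> = (1 - cis \<phi>) * (\<i> * of_real (?c - ?S) / 2)"
    unfolding inverse_one_minus_cis[OF \<phi>] by (simp add: algebra_simps diff_divide_distrib add_divide_distrib)
  finally show ?thesis using \<open>1 - cis \<phi> \<noteq> 0\<close> by (auto simp del: of_real_diff)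
qed

text \<open>
  For $|\lambda| = 1$, $\mathrm{Re}\,(\lambda / (\lambda - z)) = 1/2 + (1 - |z|^2) / (2 |\lambda - z|^2)$,
  while $1/(1 - t)$ has real part $1/2$ for $|t| = 1$.
\<close>

lemma C_fun_zero_norm:
  assumes n: "1 \<le> n" and q: "(\<Sum>j=1..n. q j) = 1" "\<forall>j\<in>{1..n}. 0 < q j"
    and \<phi>: "sin (\<phi> / 2) \<noteq> 0" and z: "z \<in> C_zeros n \<theta> q (cis \<phi>)"
  shows "norm z = 1"
proof -
  have zn: "cis (\<theta> j) - z \<noteq> 0" if "j \<in> {1..n}" for j using z that by (auto simp: C_zeros_def)
  have "1 - cis \<phi> \<noteq> 0"
  proof
    assume "1 - cis \<phi> = 0"
    then have "norm (cis 0 - cis \<phi>) = 0" by simp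
    then show False using \<phi> unfolding norm_cis_diff by simp
  qed
  moreover have "1 - (1 - cis \<phi>) * (\<Sum>j=1..n. cis (\<theta> j) * of_real (q j) / (cis (\<theta> j) - z)) = 0"
    using z by (simp add: C_zeros_def C_fun_def algebra_simps)
  ultimately have "(\<Sum>j=1..n. cis (\<theta> j) * of_real (q j) / (cis (\<theta> j) - z)) = 1 / (1 - cis \<phi>)"
    by (simp add: field_simps)
  then have "Re (\<Sum>j=1..n. cis (\<theta> j) * of_real (q j) / (cis (\<theta> j) - z)) = Re ((1 + \<i> * of_real (cot (\<phi> / 2))) / 2)"
    unfolding inverse_one_minus_cis[OF \<phi>] by (rule arg_cong)
  also have "\<dots> = 1 / 2" by simp
  finally have "Re (\<Sum>j=1..n. cis (\<theta> j) * of_real (q j) / (cis (\<theta> j) - z)) = 1 / 2" .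
  moreover have "Re (cis (\<theta> j) * of_real (q j) / (cis (\<theta> j) - z)) = q j / 2 + (1 - (norm z)\<^sup>2) * (q j / (2 * (norm (cis (\<theta> j) - z))\<^sup>2))"
    if j: "j \<in> {1..n}" for j
  proof -
    let ?w = "cis (\<theta> j) - z"
    have w: "norm ?w \<noteq> 0" using zn[OF j] by simp
    have "cis (\<theta> j) * of_real (q j) / ?w = of_real (q j / (norm ?w)\<^sup>2) * (cis (\<theta> j) * cnj ?w)"
      by (subst complex_div_cnj) (simp add: field_simps)
    then have "Re (cis (\<theta> j) * of_real (q j) / ?w) = q j / (norm ?w)\<^sup>2 * Re (cis (\<theta> j) * cnj ?w)"
      by simp
    also have "Re (cis (\<theta> j) * cnj ?w) = ((norm ?w)\<^sup>2 + (1 - (norm z)\<^sup>2)) / 2"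
      using sin_cos_squared_add[of "\<theta> j"] unfolding cmod_power2
      by (simp add: power2_eq_square algebra_simps)
    finally show ?thesis using w by (simp add: field_simps)
  qed
  ultimately have "(\<Sum>j=1..n. q j / 2 + (1 - (norm z)\<^sup>2) * (q j / (2 * (norm (cis (\<theta> j) - z))\<^sup>2))) = 1 / 2"
    by simp
  then have "(1 - (norm z)\<^sup>2) * (\<Sum>j=1..n. q j / (2 * (norm (cis (\<theta> j) - z))\<^sup>2)) = 0"
    unfolding sum.distrib sum_distrib_left[symmetric] sum_divide_distrib[symmetric] q(1) by simp
  moreover have "0 < (\<Sum>j=1..n. q j / (2 * (norm (cis (\<theta> j) - z))\<^sup>2))"
    using n zn q(2) by (intro sum_pos) auto
  ultimately have "(norm z)\<^sup>2 = 1" by auto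
  then show ?thesis using norm_ge_zero[of z] by (auto simp: power2_eq_1_iff simp del: norm_ge_zero)
qed

lemma cot_strict_decreasing:
  fixes u v :: real
  assumes "u < v" "v - u < pi" "0 < sin u * sin v"
  shows "cot v < cot u"
proof -
  have "0 < sin (v - u)" using assms by (intro sin_gt_zero) auto
  moreover have "sin u \<noteq> 0" "sin v \<noteq> 0" using assms(3) by auto
  ultimately have "0 < cot u - cot v" using assms(3) by (subst cot_diff_eq) auto
  then show ?thesis by simp
qed

lemma cot_minus_pi: "cot (x - pi :: real) = cot x"
  by (simp add: cot_def)

section \<open>Existence, uniqueness and labelling of the zeros\<close>

context poles
begin

definition cot_sum :: "(nat \<Rightarrow> real) \<Rightarrow> real \<Rightarrow> real" where
  "cot_sum q s = (\<Sum>j=1..n. q j * cot ((s - \<theta> j) / 2))"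

definition gap :: "nat \<Rightarrow> real set" where "gap i = {\<theta> (i - 1)<..<\<theta> i}"

lemma gap_sin:
  assumes i: "i \<in> {1..n}" and j: "j \<in> {1..n}" and s: "s \<in> gap i"
  shows "if j < i then 0 < sin ((s - \<theta> j) / 2) else sin ((s - \<theta> j) / 2) < 0"
proof (cases "j < i")
  case True
  then have "\<theta> j \<le> \<theta> (i - 1)" "\<theta> i \<le> \<theta> n" "\<theta> 0 < \<theta> j" using i j by (auto intro: \<theta>_le \<theta>_less)
  then have "0 < sin ((s - \<theta> j) / 2)" using s \<theta>_0 by (intro sin_gt_zero) (auto simp: gap_def)
  then show ?thesis using True by simp
next
  case False
  then have "\<theta> i \<le> \<theta> j" "\<theta> 0 \<le> \<theta> (i - 1)" "\<theta> j \<le> \<theta> n" using i j by (auto intro: \<theta>_le)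
  then have "0 < sin ((\<theta> j - s) / 2)" using s \<theta>_0 by (intro sin_gt_zero) (auto simp: gap_def)
  then show ?thesis using False sin_minus[of "(\<theta> j - s) / 2"] by (simp add: minus_divide_left)
qed

lemma gap_length:
  assumes "i \<in> {1..n}" "s \<in> gap i" "t \<in> gap i"
  shows "(t - s) / 2 < pi"
proof -
  have "\<theta> 0 \<le> \<theta> (i - 1)" "\<theta> i \<le> \<theta> n" using assms(1) by (auto intro!: \<theta>_le)
  then show ?thesis using assms(2,3) \<theta>_0 by (auto simp: gap_def)
qed

lemma cot_gap_decreasing:
  assumes "i \<in> {1..n}" "j \<in> {1..n}" "s \<in> gap i" "t \<in> gap i" "s < t"
  shows "cot ((t - \<theta> j) / 2) < cot ((s - \<theta> j) / 2)"
proof (rule cot_strict_decreasing)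
  show "0 < sin ((s - \<theta> j) / 2) * sin ((t - \<theta> j) / 2)"
    using gap_sin[OF assms(1,2,3)] gap_sin[OF assms(1,2,4)] by (auto intro: mult_neg_neg split: if_splits)
  show "(t - \<theta> j) / 2 - (s - \<theta> j) / 2 < pi"
    using gap_length[OF assms(1,3,4)] by (simp add: diff_divide_distrib)
qed (use assms in simp)

lemma cot_sum_decreasing:
  assumes "i \<in> {1..n}" "s \<in> gap i" "t \<in> gap i" "s < t" and q: "\<forall>j\<in>{1..n}. 0 < q j"
  shows "cot_sum q t < cot_sum q s"
  unfolding cot_sum_def
proof (rule sum_strict_mono)
  fix j assume j: "j \<in> {1..n}"
  show "q j * cot ((t - \<theta> j) / 2) < q j * cot ((s - \<theta> j) / 2)"
    using cot_gap_decreasing[OF assms(1) j assms(2-4)] bspec[OF q j] by (rule mult_strict_left_mono)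
qed (use n in auto)

lemma cot_sum_isCont: "i \<in> {1..n} \<Longrightarrow> s \<in> gap i \<Longrightarrow> isCont (cot_sum q) s"
  unfolding cot_sum_def[abs_def]
proof (rule continuous_sum)
  fix j assume "i \<in> {1..n}" "s \<in> gap i" "j \<in> {1..n}"
  then have "sin ((s - \<theta> j) / 2) \<noteq> 0" using gap_sin[of i j s] by (auto split: if_splits)
  then show "isCont (\<lambda>s. q j * cot ((s - \<theta> j) / 2)) s" by (intro continuous_intros) auto
qed

lemma gap_midpoint: "i \<in> {1..n} \<Longrightarrow> (\<theta> (i - 1) + \<theta> i) / 2 \<in> gap i"
  using \<theta>_less[of "i - 1" i] by (simp add: gap_def)

text \<open>Near the left end of the gap the term of the pole at \<theta>_(i-1) dominates, while the
  other terms only grow as s moves left.\<close>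

lemma cot_sum_large:
  assumes i: "i \<in> {1..n}" and q: "\<forall>j\<in>{1..n}. 0 < q j"
  shows "\<exists>s\<in>gap i. K < cot_sum q s"
proof -
  \<comment> \<open>For i = 1 the left end \<theta>_0 is \<theta>_n one turn earlier, so the
    dominating term has index n.\<close>
  define m where "m = (if i = 1 then n else i - 1)"
  have m: "m \<in> {1..n}" using i n by (auto simp: m_def)
  have cm: "cot ((s - \<theta> m) / 2) = cot ((s - \<theta> (i - 1)) / 2)" for s
    using cot_minus_pi[of "(s - \<theta> 0) / 2"] by (simp add: m_def \<theta>_0 diff_divide_distrib add_divide_distrib)
  define s0 where "s0 = (\<theta> (i - 1) + \<theta> i) / 2"
  have s0: "s0 \<in> gap i" unfolding s0_def by (rule gap_midpoint[OF i])
  define R where "R s = (\<Sum>j\<in>{1..n} - {m}. q j * cot ((s - \<theta> j) / 2))" for s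
  have FR: "cot_sum q s = q m * cot ((s - \<theta> m) / 2) + R s" for s
    unfolding cot_sum_def R_def using m by (subst sum.remove[of _ m]) auto
  \<comment> \<open>The first bound puts s to the left of the midpoint s0, the second lets the
    dominating term exceed K - R s0.\<close>
  define k where "k = max (cot ((s0 - \<theta> m) / 2)) ((K - R s0) / q m) + 1"
  define s where "s = \<theta> (i - 1) + 2 * (pi / 2 - arctan k)"
  have ck: "cot ((s - \<theta> (i - 1)) / 2) = k"
    using tan_cot'[of "pi / 2 - arctan k"] by (simp add: s_def tan_arctan diff_divide_distrib)
  have "\<theta> (i - 1) < s" "(s - \<theta> (i - 1)) / 2 < pi"
    using arctan_bounded[of k] by (auto simp: s_def field_simps)
  moreover have "s < s0"
  proof (rule ccontr)
    assume "\<not> s < s0"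
    moreover have "s0 \<noteq> s" using ck unfolding k_def by (auto simp: cm)
    ultimately have "s0 < s" by simp
    have g: "0 < (s0 - \<theta> (i - 1)) / 2" using s0 by (auto simp: gap_def)
    have "cot ((s - \<theta> (i - 1)) / 2) < cot ((s0 - \<theta> (i - 1)) / 2)"
      using \<open>s0 < s\<close> g \<open>(s - \<theta> (i - 1)) / 2 < pi\<close>
      by (intro cot_strict_decreasing mult_pos_pos sin_gt_zero) (auto simp: field_simps)
    then show False unfolding ck k_def by (auto simp: cm)
  qed
  ultimately have s: "s \<in> gap i" using s0 by (auto simp: gap_def)
  have "R s0 \<le> R s"
    unfolding R_def using cot_gap_decreasing[OF i _ s s0 \<open>s < s0\<close>] q
    by (intro sum_mono mult_left_mono) (auto intro: less_imp_le)
  moreover have "K - R s0 < q m * k"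
  proof -
    have "(K - R s0) / q m < k" unfolding k_def by auto
    then show ?thesis using bspec[OF q m] by (simp add: field_simps)
  qed
  ultimately have "K < cot_sum q s" unfolding FR cm ck by simp
  then show ?thesis using s by blast
qed

text \<open>Mirror image of \<open>cot_sum_large\<close>: at the right end the term of index i tends
  to minus infinity.\<close>

lemma cot_sum_small:
  assumes i: "i \<in> {1..n}" and q: "\<forall>j\<in>{1..n}. 0 < q j"
  shows "\<exists>s\<in>gap i. cot_sum q s < K"
proof -
  define s0 where "s0 = (\<theta> (i - 1) + \<theta> i) / 2"
  have s0: "s0 \<in> gap i" unfolding s0_def by (rule gap_midpoint[OF i])
  define R where "R s = (\<Sum>j\<in>{1..n} - {i}. q j * cot ((s - \<theta> j) / 2))" for s
  have FR: "cot_sum q s = q i * cot ((s - \<theta> i) / 2) + R s" for s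
    unfolding cot_sum_def R_def using i by (subst sum.remove[of _ i]) auto
  have cm: "cot ((s - \<theta> i) / 2) = - cot ((\<theta> i - s) / 2)" for s
    using cot_minus[of "(\<theta> i - s) / 2"] by (simp add: minus_divide_left)
  define k where "k = max (cot ((\<theta> i - s0) / 2)) ((R s0 - K) / q i) + 1"
  define s where "s = \<theta> i - 2 * (pi / 2 - arctan k)"
  have ck: "cot ((\<theta> i - s) / 2) = k"
    using tan_cot'[of "pi / 2 - arctan k"] by (simp add: s_def tan_arctan diff_divide_distrib)
  have "s < \<theta> i" "(\<theta> i - s) / 2 < pi"
    using arctan_bounded[of k] by (auto simp: s_def field_simps)
  moreover have "s0 < s"
  proof (rule ccontr)
    assume "\<not> s0 < s"
    moreover have "s0 \<noteq> s" using ck unfolding k_def by auto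
    ultimately have "s < s0" by simp
    have g: "0 < (\<theta> i - s0) / 2" using s0 by (auto simp: gap_def)
    have "cot ((\<theta> i - s) / 2) < cot ((\<theta> i - s0) / 2)"
      using \<open>s < s0\<close> g \<open>(\<theta> i - s) / 2 < pi\<close>
      by (intro cot_strict_decreasing mult_pos_pos sin_gt_zero) (auto simp: field_simps)
    then show False unfolding ck k_def by auto
  qed
  ultimately have s: "s \<in> gap i" using s0 by (auto simp: gap_def)
  have "R s \<le> R s0"
    unfolding R_def using cot_gap_decreasing[OF i _ s0 s \<open>s0 < s\<close>] q
    by (intro sum_mono mult_left_mono) (auto intro: less_imp_le)
  moreover have "R s0 - K < q i * k"
  proof -
    have "(R s0 - K) / q i < k" unfolding k_def by auto
    then show ?thesis using bspec[OF q i] by (simp add: field_simps)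
  qed
  ultimately have "cot_sum q s < K" unfolding FR cm ck by simp
  then show ?thesis using s by blast
qed

lemma cot_sum_ex1:
  assumes i: "i \<in> {1..n}" and q: "\<forall>j\<in>{1..n}. 0 < q j"
  shows "\<exists>!s. s \<in> gap i \<and> cot_sum q s = c"
proof -
  obtain s t where s: "s \<in> gap i" "c < cot_sum q s" and t: "t \<in> gap i" "cot_sum q t < c"
    using cot_sum_large[OF i q, where K=c] cot_sum_small[OF i q, where K=c] by blast
  have st: "s \<le> t" using cot_sum_decreasing[OF i t(1) s(1) _ q] s t by (cases "t < s") auto
  have "\<forall>x. s \<le> x \<and> x \<le> t \<longrightarrow> isCont (cot_sum q) x"
    using s(1) t(1) by (auto intro!: cot_sum_isCont[OF i] simp: gap_def)
  then obtain x where "s \<le> x" "x \<le> t" "cot_sum q x = c"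
    using IVT2[of "cot_sum q" t c s] s t st by auto
  then have "x \<in> gap i \<and> cot_sum q x = c" using s(1) t(1) by (auto simp: gap_def)
  moreover have "y = x" if "y \<in> gap i \<and> cot_sum q y = c" for y
    using cot_sum_decreasing[OF i, of x y q] cot_sum_decreasing[OF i, of y x q] q that calculation
    by (cases x y rule: linorder_cases) auto
  ultimately show ?thesis by blast
qed

lemma gap_cover:
  assumes "\<theta> 0 < s" "s \<le> \<theta> n" "\<And>j. j \<in> {1..n} \<Longrightarrow> s \<noteq> \<theta> j"
  shows "\<exists>i\<in>{1..n}. s \<in> gap i"
proof -
  define i where "i = (LEAST i. s \<le> \<theta> i)"
  have i: "s \<le> \<theta> i" unfolding i_def by (rule LeastI[of _ n]) (rule assms)
  have "i \<le> n" unfolding i_def by (rule Least_le) (rule assms)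
  moreover have i0: "i \<noteq> 0" using i assms(1) by (cases "i = 0") auto
  moreover have "\<not> s \<le> \<theta> (i - 1)" using not_less_Least[of "i - 1" "\<lambda>i. s \<le> \<theta> i"] i0 unfolding i_def[symmetric] by auto
  moreover have "s < \<theta> i" using i assms(3)[of i] \<open>i \<le> n\<close> i0 by simp
  ultimately show ?thesis by (intro bexI[of _ i]) (simp_all add: gap_def)
qed

text \<open>Zeros have modulus 1 and avoid the poles, so each lies in a gap, where the cotangent
  equation has a unique solution. The set equation in \<open>zero_angles\<close> thus splits into n
  scalar equations.\<close>

lemma zero_angles_iff:
  assumes q: "(\<Sum>j=1..n. q j) = 1" "\<forall>j\<in>{1..n}. 0 < q j" and \<phi>: "0 < \<phi>" "\<phi> < 2 * pi"
  shows "zero_angles n \<theta> q (cis \<phi>) \<psi> \<longleftrightarrow> (\<forall>i\<in>{1..n}. \<psi> i \<in> gap i \<and> cot_sum q (\<psi> i) = cot (\<phi> / 2))"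
proof -
  have s\<phi>: "sin (\<phi> / 2) \<noteq> 0" using sin_gt_zero[of "\<phi> / 2"] \<phi> by auto
  have sgap: "sin ((s - \<theta> j) / 2) \<noteq> 0" if "i \<in> {1..n}" "s \<in> gap i" "j \<in> {1..n}" for s i j
    using gap_sin[OF that(1,3,2)] by (auto split: if_splits)
  have iff: "C_fun n \<theta> q (cis \<phi>) (cis s) = 0 \<longleftrightarrow> cot_sum q s = cot (\<phi> / 2)" if "i \<in> {1..n}" "s \<in> gap i" for i s
    unfolding cot_sum_def using sgap[OF that] s\<phi> q(1) by (intro C_fun_cis_eq_0_iff) auto
  have neq: "cis s \<notin> (\<lambda>j. cis (\<theta> j)) ` {1..n}" if "i \<in> {1..n}" "s \<in> gap i" for i s
  proof
    assume "cis s \<in> (\<lambda>j. cis (\<theta> j)) ` {1..n}"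
    then obtain j where j: "j \<in> {1..n}" "cis s = cis (\<theta> j)" by auto
    then have "norm (cis s - cis (\<theta> j)) = 0" by simp
    then show False unfolding norm_cis_diff using sgap[OF that j(1)] by simp
  qed
  have il: "interlacing n \<theta> \<psi> \<longleftrightarrow> (\<forall>i\<in>{1..n}. \<psi> i \<in> gap i)" by (auto simp: interlacing_def gap_def)
  show ?thesis
  proof
    assume z: "zero_angles n \<theta> q (cis \<phi>) \<psi>"
    show "\<forall>i\<in>{1..n}. \<psi> i \<in> gap i \<and> cot_sum q (\<psi> i) = cot (\<phi> / 2)"
    proof
      fix i assume i: "i \<in> {1..n}"
      then have g: "\<psi> i \<in> gap i" using z il by (auto simp: zero_angles_def)
      have "cis (\<psi> i) \<in> C_zeros n \<theta> q (cis \<phi>)" using z i by (auto simp: zero_angles_def)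
      then show "\<psi> i \<in> gap i \<and> cot_sum q (\<psi> i) = cot (\<phi> / 2)" using iff[OF i g] g by (simp add: C_zeros_def)
    qed
  next
    assume *: "\<forall>i\<in>{1..n}. \<psi> i \<in> gap i \<and> cot_sum q (\<psi> i) = cot (\<phi> / 2)"
    have "C_zeros n \<theta> q (cis \<phi>) = (\<lambda>j. cis (\<psi> j)) ` {1..n}"
    proof (intro equalityI subsetI)
      fix z assume "z \<in> (\<lambda>j. cis (\<psi> j)) ` {1..n}"
      then obtain i where i: "i \<in> {1..n}" "z = cis (\<psi> i)" by auto
      then have g: "\<psi> i \<in> gap i" "cot_sum q (\<psi> i) = cot (\<phi> / 2)" using * by auto
      show "z \<in> C_zeros n \<theta> q (cis \<phi>)"
        using iff[OF i(1) g(1)] neq[OF i(1) g(1)] g(2) unfolding C_zeros_def i(2) by blast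
    next
      fix z assume z: "z \<in> C_zeros n \<theta> q (cis \<phi>)"
      have "norm z = 1" by (rule C_fun_zero_norm[OF n q s\<phi> z])
      then have "z \<noteq> 0" by auto
      then have zc: "z = cis (Arg z)" using cis_Arg[of z] \<open>norm z = 1\<close> by (simp add: sgn_eq)
      \<comment> \<open>The number of turns that brings the argument above \<theta>_0 and up to at
        most \<theta>_n.\<close>
      define k where "k = \<lfloor>(\<theta> n - Arg z) / (2 * pi)\<rfloor>"
      define s where "s = Arg z + 2 * pi * of_int k"
      have zs: "z = cis s" unfolding s_def cis_mult[symmetric] zc[symmetric] using cis_multiple_2pi[of "of_int k"] by simp
      have "of_int k \<le> (\<theta> n - Arg z) / (2 * pi)" "(\<theta> n - Arg z) / (2 * pi) < of_int k + 1"
        unfolding k_def by linarith+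
      then have "\<theta> 0 < s" "s \<le> \<theta> n" unfolding s_def \<theta>_0 by (simp_all add: field_simps)
      moreover have "s \<noteq> \<theta> j" if "j \<in> {1..n}" for j using z zs that by (auto simp: C_zeros_def)
      ultimately obtain i where i: "i \<in> {1..n}" "s \<in> gap i" using gap_cover by blast
      have "cot_sum q s = cot (\<phi> / 2)" using iff[OF i] z zs by (simp add: C_zeros_def)
      then have "s = \<psi> i" using cot_sum_ex1[OF i(1) q(2)] i * by blast
      then show "z \<in> (\<lambda>j. cis (\<psi> j)) ` {1..n}" using zs i by auto
    qed
    then show "zero_angles n \<theta> q (cis \<phi>) \<psi>" using * il by (auto simp: zero_angles_def)
  qed
qed

text \<open>\<open>zero_angles\<close> constrains the indices in \<open>{1..n}\<close>, one equation
  in each gap; extensionality fixes all other values.\<close>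

lemma zero_angles_ex1:
  assumes q: "(\<Sum>j=1..n. q j) = 1" "\<forall>j\<in>{1..n}. 0 < q j" and \<phi>: "0 < \<phi>" "\<phi> < 2 * pi"
  shows "\<exists>!\<psi>. \<psi> \<in> extensional {1..n} \<and> zero_angles n \<theta> q (cis \<phi>) \<psi>"
proof -
  let ?c = "cot (\<phi> / 2)"
  note iff = zero_angles_iff[OF q \<phi>]
  define r where "r i = (THE s. s \<in> gap i \<and> cot_sum q s = ?c)" for i
  have r: "r i \<in> gap i \<and> cot_sum q (r i) = ?c" if "i \<in> {1..n}" for i
    unfolding r_def by (rule theI'[OF cot_sum_ex1[OF that q(2)]])
  show ?thesis
  proof (rule ex1I[of _ "\<lambda>i\<in>{1..n}. r i"])
    show "(\<lambda>i\<in>{1..n}. r i) \<in> extensional {1..n} \<and> zero_angles n \<theta> q (cis \<phi>) (\<lambda>i\<in>{1..n}. r i)"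
    proof
      show "zero_angles n \<theta> q (cis \<phi>) (\<lambda>i\<in>{1..n}. r i)"
      proof (rule iffD2[OF iff], rule ballI)
        fix i assume "i \<in> {1..n}"
        from r[OF this] this show "(\<lambda>i\<in>{1..n}. r i) i \<in> gap i \<and> cot_sum q ((\<lambda>i\<in>{1..n}. r i) i) = ?c"
          by (simp only: restrict_apply if_True)
      qed
    qed (rule restrict_extensional)
  next
    fix \<psi> assume *: "\<psi> \<in> extensional {1..n} \<and> zero_angles n \<theta> q (cis \<phi>) \<psi>"
    show "\<psi> = (\<lambda>i\<in>{1..n}. r i)"
    proof
      fix i
      show "\<psi> i = (\<lambda>i\<in>{1..n}. r i) i"
      proof (cases "i \<in> {1..n}")
        case True
        then have "\<psi> i \<in> gap i \<and> cot_sum q (\<psi> i) = ?c" using * unfolding iff by blast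
        then have "\<psi> i = r i" using cot_sum_ex1[OF True q(2), of ?c] r[OF True] by blast
        then show ?thesis using True by simp
      next
        case False
        have "\<psi> i = undefined" by (rule extensional_arb[OF conjunct1[OF *] False])
        then show ?thesis using False by (simp only: restrict_apply if_False)
      qed
    qed
  qed
qed

end

section \<open>The zeros as a measurable function of the parameters\<close>

context poles
begin

text \<open>\<open>z\<close> holds q_1, ..., q_(n-1) and, at index \<open>n\<close>, the phase, as
  in \<open>mass_phase\<close>; here the last weight is restored.\<close>

definition all_weights :: "(nat \<Rightarrow> real) \<Rightarrow> nat \<Rightarrow> real" where
  "all_weights z j = (if j = n then 1 - (\<Sum>i=1..<n. z i) else z j)"

definition admissible :: "(nat \<Rightarrow> real) \<Rightarrow> bool" where
  "admissible z \<longleftrightarrow> (\<forall>j\<in>{1..<n}. 0 < z j) \<and> (\<Sum>j=1..<n. z j) < 1 \<and> 0 < z n \<and> z n < 2 * pi"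

text \<open>The default 0 makes the function total, so that measurability can be stated on the whole
  product space.\<close>

definition zeros :: "(nat \<Rightarrow> real) \<Rightarrow> nat \<Rightarrow> real" where
  "zeros z = (\<lambda>i\<in>{1..n}. if admissible z then THE s. s \<in> gap i \<and> cot_sum (all_weights z) s = cot (z n / 2) else 0)"

lemma atLeastAtMost_insert: "{1..n} = insert n {1..<n}" "{1..n - 1} = {1..<n}"
  using n by auto

lemma all_weights_pos: "admissible z \<Longrightarrow> \<forall>j\<in>{1..n}. 0 < all_weights z j"
  by (auto simp: all_weights_def admissible_def)

lemma cot_sum_all_weights: "cot_sum (all_weights z) s = (\<Sum>j=1..<n. z j * cot ((s - \<theta> j) / 2)) + (1 - (\<Sum>j=1..<n. z j)) * cot ((s - \<theta> n) / 2)"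
  unfolding cot_sum_def atLeastAtMost_insert(1) by (simp add: all_weights_def)

lemma cot_sum_cong: "(\<And>j. j \<in> {1..n} \<Longrightarrow> p j = r j) \<Longrightarrow> cot_sum p s = cot_sum r s"
  unfolding cot_sum_def by (intro sum.cong) auto

lemma zeros_eq:
  assumes z: "admissible z" and \<psi>: "\<And>i. i \<in> {1..n} \<Longrightarrow> \<psi> i \<in> gap i \<and> cot_sum (all_weights z) (\<psi> i) = cot (z n / 2)"
  shows "zeros z = (\<lambda>i\<in>{1..n}. \<psi> i)"
  unfolding zeros_def if_P[OF z]
proof (rule restrict_ext)
  fix i assume i: "i \<in> {1..n}"
  show "(THE s. s \<in> gap i \<and> cot_sum (all_weights z) s = cot (z n / 2)) = \<psi> i"
    by (rule the1_equality[OF cot_sum_ex1[OF i all_weights_pos[OF z]] \<psi>[OF i]])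
qed

text \<open>Monotonicity replaces an implicit function argument: for a in the gap, the root is at
  most a iff the cotangent sum at the fixed point a is at most cot(\<phi>/2).\<close>

lemma measurable_zeros: "zeros \<in> measurable (lborel_Pi {1..n}) (lborel_Pi {1..n})"
  unfolding zeros_def[abs_def]
proof (rule measurable_restrict)
  fix i assume i: "i \<in> {1..n}"
  let ?M = "lborel_Pi {1..n}"
  let ?r = "\<lambda>z. THE s. s \<in> gap i \<and> cot_sum (all_weights z) s = cot (z n / 2)"
  have comp: "(\<lambda>z. z j) \<in> borel_measurable ?M" if "j \<in> {1..n}" for j
    using that by (intro measurable_component_compose) auto
  note [measurable] = comp[of n, simplified]
  have [measurable]: "(\<lambda>z. \<Sum>j=1..<n. z j) \<in> borel_measurable ?M"
    using comp by (intro borel_measurable_sum) auto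
  have [measurable]: "(\<lambda>z. z n) \<in> borel_measurable ?M" using n by (intro comp) auto
  have [measurable]: "Measurable.pred ?M (\<lambda>z. \<forall>j\<in>{1..<n}. 0 < z j)" by (intro measurable_ball_pos) auto
  have [measurable]: "Measurable.pred ?M admissible" unfolding admissible_def[abs_def] by measurable
  have [measurable]: "(\<lambda>z. cot_sum (all_weights z) a) \<in> borel_measurable ?M" for a
    unfolding cot_sum_all_weights using comp
    by (intro borel_measurable_add borel_measurable_sum borel_measurable_times) (auto, measurable)
  have [measurable]: "(\<lambda>z. cot (z n / 2)) \<in> borel_measurable ?M" unfolding cot_def by measurable
  have "(\<lambda>z. if admissible z then ?r z else 0) \<in> borel_measurable ?M"
    unfolding borel_measurable_iff_le
  proof
    fix a
    have "(if admissible z then ?r z else 0) \<le> a \<longleftrightarrow>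
       admissible z \<and> (\<theta> i \<le> a \<or> a \<in> gap i \<and> cot_sum (all_weights z) a \<le> cot (z n / 2)) \<or> \<not> admissible z \<and> 0 \<le> a" for z
    proof (cases "admissible z")
      case True
      have r: "?r z \<in> gap i" "cot_sum (all_weights z) (?r z) = cot (z n / 2)"
        using theI'[OF cot_sum_ex1[OF i all_weights_pos[OF True]]] by auto
      have "?r z \<le> a \<longleftrightarrow> cot_sum (all_weights z) a \<le> cot (z n / 2)" if a: "a \<in> gap i"
        using cot_sum_decreasing[OF i r(1) a _ all_weights_pos[OF True]] cot_sum_decreasing[OF i a r(1) _ all_weights_pos[OF True]] r(2)
        by (cases "?r z" a rule: linorder_cases) auto
      then show ?thesis using True r(1) by (auto simp: gap_def)
    qed simp
    then have "{z \<in> space ?M. (if admissible z then ?r z else 0) \<le> a} =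
       {z \<in> space ?M. admissible z \<and> (\<theta> i \<le> a \<or> a \<in> gap i \<and> cot_sum (all_weights z) a \<le> cot (z n / 2)) \<or> \<not> admissible z \<and> 0 \<le> a}"
      by (simp only:)
    also have "\<dots> \<in> sets ?M"
    proof -
      have "Measurable.pred ?M (\<lambda>z. cot_sum (all_weights z) a \<le> cot (z n / 2))"
        unfolding pred_def by (rule borel_measurable_le) fact+
      then have "Measurable.pred ?M (\<lambda>z. admissible z \<and> (\<theta> i \<le> a \<or> a \<in> gap i \<and> cot_sum (all_weights z) a \<le> cot (z n / 2)) \<or> \<not> admissible z \<and> 0 \<le> a)"
        using \<open>Measurable.pred ?M admissible\<close> by (intro pred_intros_logic measurable_const) simp_all
      then show ?thesis by (simp only: pred_def)
    qed
    finally show "{z \<in> space ?M. (if admissible z then ?r z else 0) \<le> a} \<in> sets ?M" .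
  qed
  then show "(\<lambda>z. if admissible z then ?r z else 0) \<in> measurable ?M lborel" by simp
qed

lemma measurable_dirichlet_density:
  assumes "{1..<n} \<subseteq> J"
  shows "dirichlet_density n d d0 \<in> borel_measurable (lborel_Pi J)"
proof -
  have comp: "(\<lambda>z. z j) \<in> borel_measurable (lborel_Pi J)" if "j \<in> {1..<n}" for j
    using that assms by (intro measurable_component_compose) auto
  have [measurable]: "Measurable.pred (lborel_Pi J) (\<lambda>z. \<forall>j\<in>{1..<n}. 0 < z j)"
    using assms by (intro measurable_ball_pos) auto
  have [measurable]: "(\<lambda>z. \<Sum>j=1..<n. z j) \<in> borel_measurable (lborel_Pi J)"
    using comp by (intro borel_measurable_sum) auto
  have [measurable]: "(\<lambda>z. \<Prod>j=1..<n. z j powr (d - 1)) \<in> borel_measurable (lborel_Pi J)"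
    using comp by (intro borel_measurable_prod powr_real_measurable borel_measurable_const) auto
  show ?thesis unfolding dirichlet_density_def[abs_def] atLeastAtMost_insert(2) by measurable
qed

lemma measurable_cis[measurable (raw)]: "f \<in> borel_measurable M \<Longrightarrow> (\<lambda>x. cis (f x)) \<in> borel_measurable M"
proof -
  assume "f \<in> borel_measurable M"
  moreover have "cis \<in> borel_measurable borel"
    by (intro borel_measurable_continuous_onI continuous_intros)
  ultimately show ?thesis by (rule measurable_compose)
qed

lemma measurable_phase_density: "phase_density n d d0 \<in> borel_measurable borel"
  unfolding phase_density_def[abs_def] by measurable

lemma measurable_zero_density: "zero_density n d d0 \<theta> \<in> borel_measurable (lborel_Pi {1..n})"
proof -
  let ?M = "lborel_Pi {1..n}"
  have comp: "(\<lambda>z. z j) \<in> borel_measurable ?M" if "j \<in> {1..n}" for j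
    using that by (intro measurable_component_compose) auto
  have ch: "(\<lambda>\<psi>. norm (f \<psi> - cis (\<psi> l))) \<in> borel_measurable ?M" if l: "l \<in> {1..n}" and f: "f \<in> borel_measurable ?M" for l f
  proof -
    note comp[OF l, measurable] f[measurable]
    show ?thesis by measurable
  qed
  have [measurable]: "Measurable.pred ?M (interlacing n \<theta>)"
    unfolding interlacing_def[abs_def]
  proof (intro pred_intros_finite pred_intros_logic)
    fix j assume j: "j \<in> {1..n}"
    note comp[OF j, measurable]
    show "Measurable.pred ?M (\<lambda>\<psi>. \<theta> (j - 1) < \<psi> j)" "Measurable.pred ?M (\<lambda>\<psi>. \<psi> j < \<theta> j)" by measurable
  qed auto
  have [measurable]: "(\<lambda>\<psi>. \<Prod>l=1..n. norm (cis (\<theta> n) - cis (\<psi> l)) powr (d0 - 1)) \<in> borel_measurable ?M"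
    by (intro borel_measurable_prod powr_real_measurable borel_measurable_const ch) auto
  have [measurable]: "(\<lambda>\<psi>. \<Prod>j=1..n-1. \<Prod>l=1..n. norm (cis (\<theta> j) - cis (\<psi> l)) powr (d - 1)) \<in> borel_measurable ?M"
    by (intro borel_measurable_prod powr_real_measurable borel_measurable_const ch) auto
  have [measurable]: "(\<lambda>\<psi>. \<Prod>k=1..n. \<Prod>j=1..<k. norm (cis (\<psi> k) - cis (\<psi> j))) \<in> borel_measurable ?M"
    by (intro borel_measurable_prod ch measurable_cis comp) auto
  show ?thesis unfolding zero_density_def[abs_def] by measurable
qed

end

text \<open>By \<open>zero_equation\<close> and uniqueness in each gap, \<open>zeros\<close> undoes
  the passage from \<psi> to the parameters, so events about the zeros become events about
  \<psi>.\<close>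

lemma (in interlaced_angles) zeros_mass_phase: "zeros (mass_phase b n {1..<n} (Y \<psi>)) = (\<lambda>i\<in>{1..n}. \<psi> i)"
proof -
  let ?z = "mass_phase b n {1..<n} (Y \<psi>)"
  have z: "?z j = q j" if "j \<in> {1..<n}" for j using that by (simp add: mass_phase_def)
  have zn: "?z n = \<phi>" unfolding mass_phase_def \<phi>_def by simp
  have "(\<Sum>j=1..<n. ?z j) = (\<Sum>j=1..<n. q j)" using z by (intro sum.cong) auto
  then have zs: "(\<Sum>j=1..<n. ?z j) = 1 - 1 / T" unfolding sum_mass .
  show ?thesis
  proof (rule zeros_eq)
    show "admissible ?z" unfolding admissible_def zs zn using z mass_pos \<phi>_range T_pos by auto
    fix i assume i: "i \<in> {1..n}"
    have "(\<Sum>j=1..<n. ?z j * cot ((\<psi> i - \<theta> j) / 2)) = (\<Sum>j=1..<n. q j * cot ((\<psi> i - \<theta> j) / 2))"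
      using z by (intro sum.cong) auto
    then have "cot_sum (all_weights ?z) (\<psi> i) = cot (?z n / 2)"
      unfolding cot_sum_all_weights zs zn cot_half_\<phi> using zero_equation[OF i] by simp
    then show "\<psi> i \<in> gap i \<and> cot_sum (all_weights ?z) (\<psi> i) = cot (?z n / 2)"
      using \<psi>_bounds[OF i] by (simp add: gap_def)
  qed
qed

text \<open>\<open>nn_integral_roots\<close> for the joint density of weights and phase, restricted
  to the event that the zeros lie in \<open>A\<close>. The Vandermonde factor of \<open>b\<close>
  occurs on both sides and cancels, being positive and finite.\<close>

lemma (in poles) nn_integral_zero_density:
  assumes d: "0 < d" "0 < d0" and A[measurable]: "A \<in> sets (lborel_Pi {1..n})"
  shows "(\<integral>\<^sup>+q. (\<integral>\<^sup>+x. ennreal (dirichlet_density n d d0 q) * ennreal (phase_density n d d0 x) * indicator A (zeros (q(n := x))) \<partial>lborel) \<partial>lborel_Pi {1..<n})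
    = (\<integral>\<^sup>+\<psi>. ennreal (zero_density n d d0 \<theta> \<psi>) * indicator A \<psi> \<partial>lborel_Pi {1..n})"
proof -
  let ?M = "lborel_Pi {1..n}" and ?I = "{1..<n}"
  define g where "g z = ennreal (dirichlet_density n d d0 z) * ennreal (phase_density n d d0 (z n)) * indicator A (zeros z)" for z
  note [measurable] = measurable_zeros measurable_zero_density measurable_phase_density
  have [measurable]: "dirichlet_density n d d0 \<in> borel_measurable ?M" by (rule measurable_dirichlet_density) auto
  have [measurable]: "(\<lambda>z. z n) \<in> borel_measurable ?M" using n by (intro measurable_component_compose) auto
  have g: "g \<in> borel_measurable ?M" unfolding g_def[abs_def] by measurable
  have B: "0 < vandermonde ?I b"
    using b_mono by (intro vandermonde_pos strict_mono_on_imp_inj_on) auto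
  have "0 < (real n - 1) * d + d0" using d n by (intro add_nonneg_pos mult_nonneg_nonneg) auto
  then have Gam: "0 < Gamma ((real n - 1) * d + d0)" "0 < Gamma d" "0 < Gamma d0"
    using d by simp_all
  have dn: "0 \<le> dirichlet_density n d d0 z" for z
    unfolding dirichlet_density_def using Gam by (auto intro!: mult_nonneg_nonneg divide_nonneg_nonneg prod_nonneg)
  have pn: "0 \<le> phase_density n d d0 x" for x
    unfolding phase_density_def using Gam by (auto intro!: mult_nonneg_nonneg divide_nonneg_nonneg)
  have gq: "(\<integral>\<^sup>+x. g (q(n := x)) * indicator {0<..<2 * pi} x \<partial>lborel) * indicator {q. (\<forall>i\<in>?I. 0 < q i) \<and> (\<Sum>i\<in>?I. q i) < 1} q
     = (\<integral>\<^sup>+x. ennreal (dirichlet_density n d d0 q) * ennreal (phase_density n d d0 x) * indicator A (zeros (q(n := x))) \<partial>lborel)" for q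
  proof -
    have D: "dirichlet_density n d d0 (q(n := x)) = dirichlet_density n d d0 q" for x
    proof -
      have "(\<forall>j\<in>?I. 0 < (q(n := x)) j) \<longleftrightarrow> (\<forall>j\<in>?I. 0 < q j)" by auto
      moreover have "(\<Sum>j\<in>?I. (q(n := x)) j) = (\<Sum>j\<in>?I. q j)" by (intro sum.cong) auto
      moreover have "(\<Prod>j\<in>?I. (q(n := x)) j powr (d - 1)) = (\<Prod>j\<in>?I. q j powr (d - 1))" by (intro prod.cong) auto
      ultimately show ?thesis unfolding dirichlet_density_def atLeastAtMost_insert(2) by (simp only:)
    qed
    have x: "g (q(n := x)) * indicator {0<..<2 * pi} x = ennreal (dirichlet_density n d d0 q) * ennreal (phase_density n d d0 x) * indicator A (zeros (q(n := x)))" for x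
      unfolding g_def D by (auto simp: phase_density_def indicator_def)
    show ?thesis
    proof (cases "(\<forall>i\<in>?I. 0 < q i) \<and> (\<Sum>i\<in>?I. q i) < 1")
      case True
      then show ?thesis unfolding x by simp
    next
      case False
      then have "dirichlet_density n d d0 q = 0" unfolding dirichlet_density_def atLeastAtMost_insert(2) by (rule if_not_P)
      then show ?thesis using False by simp
    qed
  qed
  have pw: "g (mass_phase b n ?I (Y \<psi>)) * ennreal (mass_phase_jac b n ?I (Y \<psi>)) *
        (ennreal (vandermonde {1..n} (X \<psi>)) * indicator {x. interlaced b n 1 x} (X \<psi>)) *
        (\<Prod>i\<in>{1..n}. ennreal \<bar>1 / (2 * (sin ((\<theta> n - \<psi> i) / 2))\<^sup>2)\<bar> * indicator {\<theta> n - 2 * pi<..<\<theta> n} (\<psi> i))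
     = ennreal (vandermonde ?I b) * (ennreal (zero_density n d d0 \<theta> \<psi>) * indicator A \<psi>)"
    if \<psi>: "\<psi> \<in> space ?M" for \<psi>
  proof (cases "interlacing n \<theta> \<psi>")
    case True
    interpret interlaced_angles n \<theta> \<psi> by unfold_locales (rule True)
    let ?z = "mass_phase b n ?I (Y \<psi>)" and ?J = "mass_phase_jac b n ?I (Y \<psi>)" and ?V = "vandermonde {1..n} (X \<psi>)"
      and ?R = "\<Prod>i=1..n. 1 / (2 * (sin ((\<theta> n - \<psi> i) / 2))\<^sup>2)"
    have "zeros ?z = \<psi>" unfolding zeros_mass_phase
      using \<psi> by (intro extensional_restrict) (auto simp: space_PiM PiE_def)
    moreover have "(\<Prod>i\<in>{1..n}. ennreal \<bar>1 / (2 * (sin ((\<theta> n - \<psi> i) / 2))\<^sup>2)\<bar> * indicator {\<theta> n - 2 * pi<..<\<theta> n} (\<psi> i)) = ennreal ?R"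
    proof -
      have "(\<Prod>i\<in>{1..n}. ennreal \<bar>1 / (2 * (sin ((\<theta> n - \<psi> i) / 2))\<^sup>2)\<bar> * indicator {\<theta> n - 2 * pi<..<\<theta> n} (\<psi> i))
        = (\<Prod>i\<in>{1..n}. ennreal (1 / (2 * (sin ((\<theta> n - \<psi> i) / 2))\<^sup>2)))"
        using \<psi>_range by (intro prod.cong) auto
      then show ?thesis by (simp add: prod_ennreal)
    qed
    moreover have "0 \<le> ?J"
      unfolding mass_phase_jac_eq using P_pos A_pos \<tau>_pos by simp
    moreover have "0 \<le> ?R" by (intro prod_nonneg) auto
    moreover have "ennreal (dirichlet_density n d d0 ?z) * ennreal (phase_density n d d0 (?z n)) * (ennreal ?J * ennreal ?V * ennreal ?R)
       = ennreal (vandermonde ?I b) * ennreal (zero_density n d d0 \<theta> \<psi>)"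
      unfolding ennreal_mult'[OF less_imp_le[OF B], symmetric] density_identity[symmetric]
      using dn pn \<open>0 \<le> ?J\<close> \<open>0 \<le> ?R\<close> by (simp only: ennreal_mult mult_nonneg_nonneg vandermonde_nonneg)
    ultimately show ?thesis
      using interlaced_X B unfolding g_def by (simp add: ennreal_mult' mult_ac)
  next
    case False
    then have "zero_density n d d0 \<theta> \<psi> = 0" by (simp add: zero_density_def)
    \<comment> \<open>Interlacing of the angles can fail in two ways: some \<psi> i leaves the turn
      ending at \<open>\<theta> n\<close>, or the cotangents do not interlace.\<close>
    moreover have "indicator {x. interlaced b n 1 x} (X \<psi>) * (\<Prod>i\<in>{1..n}. ennreal \<bar>1 / (2 * (sin ((\<theta> n - \<psi> i) / 2))\<^sup>2)\<bar> * indicator {\<theta> n - 2 * pi<..<\<theta> n} (\<psi> i)) = 0"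
    proof (cases "\<forall>i\<in>{1..n}. \<theta> n - 2 * pi < \<psi> i \<and> \<psi> i < \<theta> n")
      case True
      then have "\<not> interlaced b n 1 (X \<psi>)" using False interlaced_iff[of \<psi>] by blast
      then show ?thesis by simp
    next
      case False
      then obtain i where "i \<in> {1..n}" "\<psi> i \<notin> {\<theta> n - 2 * pi<..<\<theta> n}" by auto
      then have "(\<Prod>i\<in>{1..n}. ennreal \<bar>1 / (2 * (sin ((\<theta> n - \<psi> i) / 2))\<^sup>2)\<bar> * indicator {\<theta> n - 2 * pi<..<\<theta> n} (\<psi> i)) = 0"
        by (intro prod_zero bexI[of _ i]) (auto simp del: greaterThanLessThan_iff)
      then show ?thesis by simp
    qed
    ultimately show ?thesis by (simp add: mult.assoc)
  qed
  have "ennreal (vandermonde ?I b) * (\<integral>\<^sup>+q. (\<integral>\<^sup>+x. ennreal (dirichlet_density n d d0 q) * ennreal (phase_density n d d0 x) * indicator A (zeros (q(n := x))) \<partial>lborel) \<partial>lborel_Pi ?I)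
    = (\<integral>\<^sup>+\<psi>. ennreal (vandermonde ?I b) * (ennreal (zero_density n d d0 \<theta> \<psi>) * indicator A \<psi>) \<partial>?M)"
    by (subst nn_integral_roots[OF n b_mono g, of "\<theta> n", unfolded gq X_def[symmetric] Y_def[symmetric], symmetric])
       (rule nn_integral_cong, rule pw)
  also have "\<dots> = ennreal (vandermonde ?I b) * (\<integral>\<^sup>+\<psi>. ennreal (zero_density n d d0 \<theta> \<psi>) * indicator A \<psi> \<partial>?M)"
    by (rule nn_integral_cmult) measurable
  finally show ?thesis using B by (simp add: ennreal_mult_cancel_left)
qed

subsection \<open>Distribution of the zeros\<close>

text \<open>Independence is given for two sigma-algebras, and \<open>X\<close> and \<open>Y\<close>
  are merely measurable with respect to them. In the application \<open>X\<close> forgets the last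
  weight and \<open>Y\<close> is the angle \<phi>, recovered from t.\<close>

lemma distributed_Pair_indep_set:
  assumes M: "prob_space M" and S: "sigma_finite_measure S" and T: "sigma_finite_measure T"
    and X: "distributed M S X f" and Y: "distributed M T Y g"
    and indep: "prob_space.indep_set M (sets A) (sets B)"
    and XA: "X \<in> measurable A S" "space A = space M" and YB: "Y \<in> measurable B T" "space B = space M"
  shows "distributed M (S \<Otimes>\<^sub>M T) (\<lambda>x. (X x, Y x)) (\<lambda>(x, y). f x * g y)"
proof -
  interpret prob_space M by fact
  note [measurable] = distributed_measurable[OF X] distributed_measurable[OF Y]
  have "distr M S X \<Otimes>\<^sub>M distr M T Y = distr M (S \<Otimes>\<^sub>M T) (\<lambda>x. (X x, Y x))"
  proof (rule pair_measure_eqI)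
    show "sigma_finite_measure (distr M S X)" "sigma_finite_measure (distr M T Y)"
      by (auto intro!: prob_space_imp_sigma_finite prob_space_distr)
    fix U V assume "U \<in> sets (distr M S X)" "V \<in> sets (distr M T Y)"
    then have [measurable]: "U \<in> sets S" "V \<in> sets T" by auto
    have "prob ((X -` U \<inter> space M) \<inter> (Y -` V \<inter> space M)) = prob (X -` U \<inter> space M) * prob (Y -` V \<inter> space M)"
      using measurable_sets[OF XA(1), of U] measurable_sets[OF YB(1), of V] XA(2) YB(2)
      by (intro indep_setD[OF indep]) auto
    moreover have "(\<lambda>x. (X x, Y x)) -` (U \<times> V) \<inter> space M = (X -` U \<inter> space M) \<inter> (Y -` V \<inter> space M)" by auto
    ultimately show "emeasure (distr M S X) U * emeasure (distr M T Y) V = emeasure (distr M (S \<Otimes>\<^sub>M T) (\<lambda>x. (X x, Y x))) (U \<times> V)"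
      by (simp add: emeasure_distr emeasure_eq_measure ennreal_mult)
  qed simp
  then show ?thesis by (rule distributed_joint_indep'[OF S T X Y])
qed

text \<open>Im (2/(1 - e^(ix))) = cot(x/2), so the angle is a Borel function of t and inherits the
  independence assumed for t.\<close>

lemma angle_from_cis:
  assumes "0 < x" "x < 2 * pi"
  shows "x = pi - 2 * arctan (Im (2 / (1 - cis x)))"
proof -
  have s: "sin (x / 2) \<noteq> 0" using sin_gt_zero[of "x / 2"] assms by auto
  have "2 / (1 - cis x) = 2 * (1 / (1 - cis x))" by simp
  also have "\<dots> = 1 + \<i> * of_real (cot (x / 2))" unfolding inverse_one_minus_cis[OF s] by simp
  finally have "Im (2 / (1 - cis x)) = tan (pi / 2 - x / 2)" by (simp add: tan_cot')
  moreover have "arctan (tan (pi / 2 - x / 2)) = pi / 2 - x / 2"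
    using assms by (intro arctan_tan) auto
  ultimately show ?thesis by simp
qed

theorem theorem3:
  fixes n :: nat and d d0 :: real and \<theta> :: "nat \<Rightarrow> real"
    and M :: "'w measure" and q :: "'w \<Rightarrow> nat \<Rightarrow> real" and \<phi> :: "'w \<Rightarrow> real"
  assumes "1 \<le> n" and "0 < d" and "0 < d0"
    and "0 < \<theta> 1" and "strict_mono_on {1..n} \<theta>" and "\<theta> n \<le> 2 * pi"
    and "\<theta> 0 = \<theta> n - 2 * pi"
    and "prob_space M"
    and "\<And>\<omega> j. \<omega> \<in> space M \<Longrightarrow> j \<in> {1..n} \<Longrightarrow> 0 < q \<omega> j"
    and "\<And>\<omega>. \<omega> \<in> space M \<Longrightarrow> (\<Sum>j=1..n. q \<omega> j) = 1"
    and "distributed M (Pi\<^sub>M {1..n-1} (\<lambda>_. lborel)) (\<lambda>\<omega>. \<lambda>j\<in>{1..n-1}. q \<omega> j)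
           (\<lambda>x. ennreal (dirichlet_density n d d0 x))"
    and "\<And>\<omega>. \<omega> \<in> space M \<Longrightarrow> 0 < \<phi> \<omega> \<and> \<phi> \<omega> < 2 * pi"
    and "distributed M lborel \<phi> (\<lambda>x. ennreal (phase_density n d d0 x))"
    and "prob_space.indep_set M
           (sets (vimage_algebra (space M) (\<lambda>\<omega>. \<lambda>j\<in>{1..n}. q \<omega> j) (Pi\<^sub>M {1..n} (\<lambda>_. borel))))
           (sets (vimage_algebra (space M) (\<lambda>\<omega>. cis (\<phi> \<omega>)) borel))"
  shows "(\<forall>\<omega>\<in>space M. \<exists>!\<psi>. \<psi> \<in> extensional {1..n} \<and> zero_angles n \<theta> (q \<omega>) (cis (\<phi> \<omega>)) \<psi>) \<and>
    (\<forall>\<psi> :: 'w \<Rightarrow> nat \<Rightarrow> real.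
       (\<forall>\<omega>\<in>space M. zero_angles n \<theta> (q \<omega>) (cis (\<phi> \<omega>)) (\<psi> \<omega>)) \<longrightarrow>
       distributed M (Pi\<^sub>M {1..n} (\<lambda>_. lborel)) (\<lambda>\<omega>. \<lambda>i\<in>{1..n}. \<psi> \<omega> i)
         (\<lambda>x. ennreal (zero_density n d d0 \<theta> x)))"
proof -
  interpret poles n \<theta>
    using assms(1,4-7) by unfold_locales auto
  interpret prob_space M by fact
  have q: "(\<Sum>j=1..n. q \<omega> j) = 1" "\<forall>j\<in>{1..n}. 0 < q \<omega> j" and \<phi>: "0 < \<phi> \<omega>" "\<phi> \<omega> < 2 * pi" if "\<omega> \<in> space M" for \<omega>
    using assms(9,10,12) that by auto
  let ?I = "{1..<n}" and ?N = "lborel_Pi {1..n}"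
  define Q where "Q \<omega> = (\<lambda>j\<in>?I. q \<omega> j)" for \<omega>
  have dQ: "distributed M (lborel_Pi ?I) Q (\<lambda>x. ennreal (dirichlet_density n d d0 x))"
    using assms(11) unfolding Q_def[abs_def] atLeastAtMost_insert(2) .
  note d\<phi> = assms(13)
  have joint: "distributed M (lborel_Pi ?I \<Otimes>\<^sub>M lborel) (\<lambda>\<omega>. (Q \<omega>, \<phi> \<omega>))
     (\<lambda>(x, y). ennreal (dirichlet_density n d d0 x) * ennreal (phase_density n d d0 y))"
  proof -
    let ?A = "vimage_algebra (space M) (\<lambda>\<omega>. \<lambda>j\<in>{1..n}. q \<omega> j) (Pi\<^sub>M {1..n} (\<lambda>_. borel))"
    let ?B = "vimage_algebra (space M) (\<lambda>\<omega>. cis (\<phi> \<omega>)) borel"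
    have "(\<lambda>\<omega>. \<lambda>j\<in>{1..n}. q \<omega> j) \<in> measurable ?A (Pi\<^sub>M {1..n} (\<lambda>_. borel))"
      by (intro measurable_vimage_algebra1) (auto simp: space_PiM)
    note m = measurable_compose[OF this measurable_component_singleton]
    have QA: "Q \<in> measurable ?A (lborel_Pi ?I)"
      unfolding Q_def[abs_def]
    proof (rule measurable_restrict)
      fix i assume i: "i \<in> ?I"
      then show "(\<lambda>\<omega>. q \<omega> i) \<in> measurable ?A lborel" using m[of i] by simp
    qed
    have "(\<lambda>\<omega>. cis (\<phi> \<omega>)) \<in> measurable ?B borel"
      by (intro measurable_vimage_algebra1) auto
    then have "(\<lambda>\<omega>. pi - 2 * arctan (Im (2 / (1 - cis (\<phi> \<omega>))))) \<in> measurable ?B lborel" by measurable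
    also have "(\<lambda>\<omega>. pi - 2 * arctan (Im (2 / (1 - cis (\<phi> \<omega>))))) \<in> measurable ?B lborel \<longleftrightarrow> \<phi> \<in> measurable ?B lborel"
      using angle_from_cis[OF \<phi>] by (intro measurable_cong) simp
    finally have \<phi>B: "\<phi> \<in> measurable ?B lborel" .
    show ?thesis
      using QA \<phi>B by (intro distributed_Pair_indep_set[OF assms(8) _ sigma_finite_lborel dQ d\<phi> assms(14)] sigma_finite_lborel_Pi) simp_all
  qed
  \<comment> \<open>Identifies an arbitrary labelling of the zeros with a fixed measurable function
    of the weights and the phase; its measurability and its law are both derived from this.\<close>
  have sol: "(\<lambda>i\<in>{1..n}. \<psi> i) = zeros ((Q \<omega>)(n := \<phi> \<omega>))"
    if \<omega>: "\<omega> \<in> space M" and z: "zero_angles n \<theta> (q \<omega>) (cis (\<phi> \<omega>)) \<psi>" for \<omega> \<psi>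
  proof (rule zeros_eq[symmetric])
    let ?z = "(Q \<omega>)(n := \<phi> \<omega>)"
    have zq: "?z j = q \<omega> j" if "j \<in> ?I" for j using that by (simp add: Q_def)
    have sz: "(\<Sum>j=1..<n. ?z j) = (\<Sum>j=1..<n. q \<omega> j)" by (intro sum.cong zq) auto
    have s: "(\<Sum>j=1..<n. q \<omega> j) = 1 - q \<omega> n"
      using q(1)[OF \<omega>] unfolding atLeastAtMost_insert(1) by simp
    have "0 < q \<omega> n" using q(2)[OF \<omega>] n by simp
    then show "admissible ?z" unfolding admissible_def sz s using zq q(2)[OF \<omega>] \<phi>[OF \<omega>] by auto
    have all_weights: "all_weights ?z j = q \<omega> j" if "j \<in> {1..n}" for j
      using that zq[of j] by (cases "j = n") (auto simp only: all_weights_def sz s if_True if_False fun_upd_same, auto)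
    fix i assume i: "i \<in> {1..n}"
    have "\<psi> i \<in> gap i \<and> cot_sum (q \<omega>) (\<psi> i) = cot (\<phi> \<omega> / 2)"
      using zero_angles_iff[OF q[OF \<omega>] \<phi>[OF \<omega>]] z i by blast
    then show "\<psi> i \<in> gap i \<and> cot_sum (all_weights ?z) (\<psi> i) = cot (?z n / 2)"
      using cot_sum_cong[OF all_weights] by simp
  qed
  show ?thesis
  proof (intro conjI ballI allI impI)
    fix \<omega> assume \<omega>: "\<omega> \<in> space M"
    show "\<exists>!\<psi>. \<psi> \<in> extensional {1..n} \<and> zero_angles n \<theta> (q \<omega>) (cis (\<phi> \<omega>)) \<psi>"
      by (rule zero_angles_ex1[OF q[OF \<omega>] \<phi>[OF \<omega>]])
  next
    fix \<psi> :: "'w \<Rightarrow> nat \<Rightarrow> real"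
    assume z: "\<forall>\<omega>\<in>space M. zero_angles n \<theta> (q \<omega>) (cis (\<phi> \<omega>)) (\<psi> \<omega>)"
    let ?\<Psi> = "\<lambda>\<omega>. \<lambda>i\<in>{1..n}. \<psi> \<omega> i"
    have G2: "(\<lambda>p. zeros ((fst p)(n := snd p))) \<in> measurable (lborel_Pi ?I \<Otimes>\<^sub>M lborel) ?N"
      using measurable_compose[OF measurable_fun_upd_lborel_Pi[of n ?I], of zeros ?N] measurable_zeros
      unfolding atLeastAtMost_insert(1)[symmetric] by (simp add: case_prod_beta')
    have \<Psi>: "?\<Psi> \<in> measurable M ?N"
    proof -
      have "(\<lambda>\<omega>. zeros ((Q \<omega>)(n := \<phi> \<omega>))) \<in> measurable M ?N"
        using measurable_compose[OF distributed_measurable[OF joint] G2] by simp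
      also have "(\<lambda>\<omega>. zeros ((Q \<omega>)(n := \<phi> \<omega>))) \<in> measurable M ?N \<longleftrightarrow> ?\<Psi> \<in> measurable M ?N"
        using sol z by (intro measurable_cong) simp
      finally show ?thesis .
    qed
    note zd[measurable] = measurable_zero_density[of d d0]
    show "distributed M ?N ?\<Psi> (\<lambda>x. ennreal (zero_density n d d0 \<theta> x))"
      unfolding distributed_def
    proof (intro conjI)
      show "(\<lambda>x. ennreal (zero_density n d d0 \<theta> x)) \<in> borel_measurable ?N" by measurable
      show "?\<Psi> \<in> measurable M ?N" by fact
      show "distr M ?N ?\<Psi> = density ?N (\<lambda>x. ennreal (zero_density n d d0 \<theta> x))"
      proof (rule measure_eqI)
        fix A assume "A \<in> sets (distr M ?N ?\<Psi>)"
        then have A[measurable]: "A \<in> sets ?N" by simp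
        have GA: "(\<lambda>p. indicator A (zeros ((fst p)(n := snd p))) :: ennreal) \<in> borel_measurable (lborel_Pi ?I \<Otimes>\<^sub>M lborel)"
          by (rule measurable_compose[OF G2 borel_measurable_indicator[OF A]])
        have "emeasure (distr M ?N ?\<Psi>) A = (\<integral>\<^sup>+\<omega>. indicator A (?\<Psi> \<omega>) \<partial>M)"
        proof -
          have "emeasure (distr M ?N ?\<Psi>) A = (\<integral>\<^sup>+x. indicator A x \<partial>distr M ?N ?\<Psi>)"
            using A by simp
          also have "\<dots> = (\<integral>\<^sup>+\<omega>. indicator A (?\<Psi> \<omega>) \<partial>M)"
            by (rule nn_integral_distr[OF \<Psi>]) (simp only: measurable_distr_eq1 borel_measurable_indicator[OF A])
          finally show ?thesis .
        qed
        also have "\<dots> = (\<integral>\<^sup>+\<omega>. indicator A (zeros ((fst (Q \<omega>, \<phi> \<omega>))(n := snd (Q \<omega>, \<phi> \<omega>)))) \<partial>M)"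
          using sol z by (intro nn_integral_cong) simp
        also have "\<dots> = (\<integral>\<^sup>+p. (case p of (x, y) \<Rightarrow> ennreal (dirichlet_density n d d0 x) * ennreal (phase_density n d d0 y))
            * indicator A (zeros ((fst p)(n := snd p))) \<partial>(lborel_Pi ?I \<Otimes>\<^sub>M lborel))"
          by (rule distributed_nn_integral[OF joint GA, symmetric])
        also have "\<dots> = (\<integral>\<^sup>+x. \<integral>\<^sup>+y. ennreal (dirichlet_density n d d0 x) * ennreal (phase_density n d d0 y)
            * indicator A (zeros (x(n := y))) \<partial>lborel \<partial>lborel_Pi ?I)"
          using borel_measurable_times_ennreal[OF distributed_borel_measurable[OF joint] GA]
          by (subst lborel.nn_integral_fst[symmetric]) (simp_all add: case_prod_beta')
        also have "\<dots> = (\<integral>\<^sup>+x. ennreal (zero_density n d d0 \<theta> x) * indicator A x \<partial>?N)"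
          by (rule nn_integral_zero_density[OF assms(2,3) A])
        also have "\<dots> = emeasure (density ?N (\<lambda>x. ennreal (zero_density n d d0 \<theta> x))) A"
          by (rule emeasure_density[symmetric]) measurable
        finally show "emeasure (distr M ?N ?\<Psi>) A = emeasure (density ?N (\<lambda>x. ennreal (zero_density n d d0 \<theta> x))) A" .
      qed simp
    qed
  qed
qed

end
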